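(* Let $(\nu,\nu')$ be a regular couple of characters of $(\mathcal O_r^E)^\times$ and let $\mathcal C_{\nu,\nu'}$ be the associated cuspidal representation of $GL(2,\mathcal O_r)$. Let $\epsilon\in\mathcal O_r^\times$ be a fixed non-square and $\Phi\in\mathcal O_r^E$ with $\Phi^2=\epsilon$. For every $0\le i\le r-1$, $\alpha\in\mathcal O_r$, $\beta\in\mathcal O_r^\times$ with $\alpha^2-\epsilon\beta^2\varpi^{2i}\in\mathcal O_r^\times$, the character of $\mathcal C_{\nu,\nu'}$ at $C_{i,\alpha,\beta}=\begin{pmatrix}\alpha&\varpi^i\epsilon\beta\\ \varpi^i\beta&\alpha\end{pmatrix}$ is $$\mathrm{tr}(C_{i,\alpha,\beta}|_{\mathcal C_{\nu,\nu'}})=(-q)^i\big(\nu(\alpha+\varpi^i\Phi\beta)\,\nu'(\alpha-\varpi^i\Phi\beta)+\nu(\alpha-\varpi^i\Phi\beta)\,\nu'(\alpha+\varpi^i\Phi\beta)\big).$$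
   Context: $F$ is a non-archimedean local field with ring of integers $\mathcal O$, uniformizer $\varpi$, residue field of cardinality $q$ and characteristic $p\neq2$. $r\ge2$ is an even integer, $l=r/2$, $\mathcal O_r=\mathcal O/\varpi^r\mathcal O$, $G^{(r)}=GL(2,\mathcal O_r)$, $K_l=\{g\in G^{(r)}: g\equiv I \bmod \varpi^l\}$. $\psi:(\mathcal O,+)\to\mathbb C^\times$ is a fixed smooth additive character of level $r$ (trivial on $\varpi^r\mathcal O$ but not on $\varpi^{r-1}\mathcal O$), viewed as a character of $\mathcal O_r$. $E$ is the unramified quadratic extension of $F$, $\sigma$ the nontrivial element of $\mathrm{Gal}(E/F)$, $\mathcal O^E$ the ring of integers of $E$, $\mathcal O^E_k=\mathcal O^E/\varpi^k\mathcal O^E$; $Tr(x)=x+\sigma(x)$, $N(x)=x\sigma(x)$. Put $\mathcal O_r^{E(-)}=\{z\in\mathcal O_r^E:\sigma(z)=-z\}$. A couple $(\nu,\nu')$ of characters $(\mathcal O_r^E)^\times\to\mathbb C^\times$ is regular if the restriction of $\nu\nu'^{-1}$ to the group $1+\varpi^l\mathcal O_r^{E(-)}$ is of level $l$, i.e. nontrivial on $1+\varpi^{r-1}\mathcal O_r^{E(-)}$. To a regular couple is associated the unique $\tau\in\mathcal O_l^E$ such that $\nu(1+\varpi^lz)\,\nu'(1+\varpi^l\sigma(z))=\psi\big(\varpi^l(\tau z+\sigma(\tau)\sigma(z))\big)$ for all $z\in\mathcal O_r^E$; one has $\tau-\sigma(\tau)\not\equiv0$ mod $\varpi$. Let $\hat\tau\in\mathcal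 O_r^E$ be any lift of $\tau$, $\hat\beta=\begin{pmatrix}0&1\\-N(\hat\tau)&Tr(\hat\tau)\end{pmatrix}$, $S=\mathcal O_r[\hat\beta]^\times=\{aI+b\hat\beta: a,b\in\mathcal O_r\}\cap G^{(r)}$, $T=SK_l$. Then $\nu\boxtimes\nu'$ is the one-dimensional representation of $T$ defined by $(\nu\boxtimes\nu')(sk)=\nu(a+b\hat\tau)\,\nu'(a+b\sigma(\hat\tau))\,\psi(\mathrm{Tr}(\hat\beta(k-I)))$ for $s=aI+b\hat\beta\in S$, $k\in K_l$ (Tr being here the matrix trace), and $\mathcal C_{\nu,\nu'}=\mathrm{Ind}_T^{G^{(r)}}(\nu\boxtimes\nu')$. *)

theory Defs
  imports "HOL-Analysis.Analysis" "HOL-Library.Function_Algebras"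
begin

section \<open>Local fields and unramified quadratic extensions\<close>

text \<open>The value of a valuation at 0 carries no meaning (it stands for infinity), so every
  condition below treats 0 separately.\<close>

definition val_ideal :: "('f::field \<Rightarrow> int) \<Rightarrow> int \<Rightarrow> 'f set" where
  "val_ideal v n = {x. x = 0 \<or> n \<le> v x}"

abbreviation val_ring :: "('f::field \<Rightarrow> int) \<Rightarrow> 'f set" where
  "val_ring v \<equiv> val_ideal v 0"

definition residue_field :: "('f::field \<Rightarrow> int) \<Rightarrow> 'f set set" where
  "residue_field v =
     val_ring v // {(x, y). x \<in> val_ring v \<and> y \<in> val_ring v \<and> x - y \<in> val_ideal v 1}"

text \<open>The additive order of 1 in the residue field, which exists when the residue field is finite.\<close>

definition residue_char :: "('f::field \<Rightarrow> int) \<Rightarrow> nat" where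
  "residue_char v = (LEAST n. 0 < n \<and> of_nat n \<in> val_ideal v 1)"

definition uniformizer :: "('f::field \<Rightarrow> int) \<Rightarrow> 'f \<Rightarrow> bool" where
  "uniformizer v p \<longleftrightarrow> p \<noteq> 0 \<and> v p = 1"

locale nonarch_local_field =
  fixes v :: "'f::field \<Rightarrow> int"
  assumes val_mult: "x \<noteq> 0 \<Longrightarrow> y \<noteq> 0 \<Longrightarrow> v (x * y) = v x + v y"
    and val_add: "x \<noteq> 0 \<Longrightarrow> y \<noteq> 0 \<Longrightarrow> x + y \<noteq> 0 \<Longrightarrow> min (v x) (v y) \<le> v (x + y)"
    and val_normalized: "\<exists>p. uniformizer v p"
    and val_complete: "(\<And>n. \<exists>M. \<forall>i\<ge>M. \<forall>j\<ge>M. X i - X j \<in> val_ideal v n)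
          \<Longrightarrow> \<exists>x. \<forall>n. \<exists>M. \<forall>i\<ge>M. (X :: nat \<Rightarrow> 'f) i - x \<in> val_ideal v n"
    and finite_residue_field: "finite (residue_field v)"

text \<open>An extension of degree 2, given by an embedding \<open>\<iota>\<close>, with normalized valuations \<open>v\<close>, \<open>w\<close>.
  It is unramified when \<open>w\<close> restricts to \<open>v\<close>, that is, when the ramification index is 1;
  separability of the residue extension is automatic because the residue fields are finite.\<close>

locale unramified_quadratic_extension =
  F: nonarch_local_field v + E: nonarch_local_field w
  for v :: "'f::field \<Rightarrow> int" and w :: "'e::field \<Rightarrow> int" +
  fixes \<iota> :: "'f \<Rightarrow> 'e" and \<sigma> :: "'e \<Rightarrow> 'e"
  assumes emb_one: "\<iota> 1 = 1"
    and emb_add: "\<iota> (x + y) = \<iota> x + \<iota> y"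
    and emb_mult: "\<iota> (x * y) = \<iota> x * \<iota> y"
    and degree_two: "vector_space.dim (\<lambda>a z. \<iota> a * z) UNIV = 2"
    and unramified: "x \<noteq> 0 \<Longrightarrow> w (\<iota> x) = v x"
    and gal_bij: "bij \<sigma>"
    and gal_add: "\<sigma> (z + z') = \<sigma> z + \<sigma> z'"
    and gal_mult: "\<sigma> (z * z') = \<sigma> z * \<sigma> z'"
    and gal_fixes: "\<sigma> (\<iota> x) = \<iota> x"
    and gal_nontrivial: "\<sigma> \<noteq> id"

section \<open>Finite quotients and characters\<close>

text \<open>\<open>\<pi>\<close> exhibits the type \<open>'b\<close> as the quotient of the subring \<open>A\<close> by its ideal \<open>I\<close>; the
  values of \<open>\<pi>\<close> outside \<open>A\<close> are irrelevant.\<close>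

definition ring_quotient_map :: "'a::comm_ring_1 set \<Rightarrow> 'a set \<Rightarrow> ('a \<Rightarrow> 'b::comm_ring_1) \<Rightarrow> bool" where
  "ring_quotient_map A I \<pi> \<longleftrightarrow>
     \<pi> 1 = 1 \<and>
     (\<forall>x\<in>A. \<forall>y\<in>A. \<pi> (x + y) = \<pi> x + \<pi> y \<and> \<pi> (x * y) = \<pi> x * \<pi> y) \<and>
     \<pi> ` A = UNIV \<and> {x \<in> A. \<pi> x = 0} = I"

text \<open>Triviality on \<open>\<omega>\<^sup>r\<O>\<close> already forces local constancy.\<close>

definition additive_char_of_level :: "('f::field \<Rightarrow> int) \<Rightarrow> 'f \<Rightarrow> nat \<Rightarrow> ('f \<Rightarrow> complex) \<Rightarrow> bool" where
  "additive_char_of_level v \<omega> r \<psi> \<longleftrightarrow>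
     (\<forall>x\<in>val_ring v. \<psi> x \<noteq> 0) \<and>
     (\<forall>x\<in>val_ring v. \<forall>y\<in>val_ring v. \<psi> (x + y) = \<psi> x * \<psi> y) \<and>
     (\<forall>x\<in>val_ring v. \<psi> (\<omega> ^ r * x) = 1) \<and>
     (\<exists>x\<in>val_ring v. \<psi> (\<omega> ^ (r - 1) * x) \<noteq> 1)"

definition unit_character :: "('a::comm_ring_1 \<Rightarrow> complex) \<Rightarrow> bool" where
  "unit_character \<nu> \<longleftrightarrow>
     (\<forall>x. x dvd 1 \<longrightarrow> \<nu> x \<noteq> 0) \<and>
     (\<forall>x y. x dvd 1 \<longrightarrow> y dvd 1 \<longrightarrow> \<nu> (x * y) = \<nu> x * \<nu> y)"

text \<open>From here on \<open>'o\<close> and \<open>'oe\<close> play the roles of \<open>\<O>\<^sub>r\<close> and \<open>\<O>\<^sub>r\<^sup>E\<close>,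
  \<open>\<pi>\<close> is the image of the uniformizer in \<open>'o\<close>, and \<open>j\<close>, \<open>s\<close>, \<open>c\<close> are the maps
  induced on these quotients by \<open>F \<rightarrow> E\<close>, by \<open>\<sigma>\<close> and by \<open>\<psi>\<close>.\<close>

definition regular_couple ::
    "('o::comm_ring_1 \<Rightarrow> 'oe::comm_ring_1) \<Rightarrow> ('oe \<Rightarrow> 'oe) \<Rightarrow> 'o \<Rightarrow> nat
      \<Rightarrow> ('oe \<Rightarrow> complex) \<Rightarrow> ('oe \<Rightarrow> complex) \<Rightarrow> bool" where
  "regular_couple j s \<pi> r \<nu> \<nu>' \<longleftrightarrow>
     unit_character \<nu> \<and> unit_character \<nu>' \<and>
     (\<exists>z. s z = - z \<and> \<nu> (1 + j \<pi> ^ (r - 1) * z) * inverse (\<nu>' (1 + j \<pi> ^ (r - 1) * z)) \<noteq> 1)"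

text \<open>\<open>\<tau>\<close> is an element of \<open>\<O>\<^sub>r\<^sup>E\<close> lifting the element of \<open>\<O>\<^sub>l\<^sup>E\<close> attached to the couple:
  the condition depends on \<open>\<tau>\<close> only through \<open>\<pi>\<^sup>l\<tau>\<close>. The argument of \<open>\<psi>\<close> is a trace and
  so lies in the image of \<open>j\<close>; the map \<open>inv j\<close> reads it in \<open>\<O>\<^sub>r\<close>.\<close>

definition tau_lift ::
    "('o::comm_ring_1 \<Rightarrow> 'oe::comm_ring_1) \<Rightarrow> ('oe \<Rightarrow> 'oe) \<Rightarrow> ('o \<Rightarrow> complex) \<Rightarrow> 'o \<Rightarrow> nat
      \<Rightarrow> ('oe \<Rightarrow> complex) \<Rightarrow> ('oe \<Rightarrow> complex) \<Rightarrow> 'oe \<Rightarrow> bool" where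
  "tau_lift j s c \<pi> l \<nu> \<nu>' \<tau> \<longleftrightarrow>
     (\<forall>z. \<nu> (1 + j \<pi> ^ l * z) * \<nu>' (1 + j \<pi> ^ l * s z)
          = c (inv j (j \<pi> ^ l * (\<tau> * z + s \<tau> * s z))))"

section \<open>The inducing character\<close>

definition mat2 :: "'a::comm_ring_1 \<Rightarrow> 'a \<Rightarrow> 'a \<Rightarrow> 'a \<Rightarrow> 'a^2^2" where
  "mat2 a b c d = vector [vector [a, b], vector [c, d]]"

definition GL2 :: "('a::comm_ring_1^2^2) set" where
  "GL2 = {g. invertible g}"

definition K_cong :: "'a::comm_ring_1 \<Rightarrow> nat \<Rightarrow> ('a^2^2) set" where
  "K_cong \<pi> l = {g \<in> GL2. \<forall>i j. \<pi> ^ l dvd (g - mat 1) $ i $ j}"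

definition beta_hat ::
    "('o::comm_ring_1 \<Rightarrow> 'oe::comm_ring_1) \<Rightarrow> ('oe \<Rightarrow> 'oe) \<Rightarrow> 'oe \<Rightarrow> 'o^2^2" where
  "beta_hat j s \<tau> = mat2 0 1 (- inv j (\<tau> * s \<tau>)) (inv j (\<tau> + s \<tau>))"

definition S_grp :: "'a::comm_ring_1^2^2 \<Rightarrow> ('a^2^2) set" where
  "S_grp B = {mat a + mat b ** B | a b. True} \<inter> GL2"

definition T_grp :: "'a::comm_ring_1^2^2 \<Rightarrow> 'a \<Rightarrow> nat \<Rightarrow> ('a^2^2) set" where
  "T_grp B \<pi> l = {x ** k | x k. x \<in> S_grp B \<and> k \<in> K_cong \<pi> l}"

text \<open>On \<open>T = S K\<^sub>l\<close> the value does not depend on the chosen factorization; off \<open>T\<close> it is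
  meaningless.\<close>

definition box_char ::
    "('o::comm_ring_1 \<Rightarrow> 'oe::comm_ring_1) \<Rightarrow> ('oe \<Rightarrow> 'oe) \<Rightarrow> ('o \<Rightarrow> complex) \<Rightarrow> 'o \<Rightarrow> nat
      \<Rightarrow> ('oe \<Rightarrow> complex) \<Rightarrow> ('oe \<Rightarrow> complex) \<Rightarrow> 'oe \<Rightarrow> 'o^2^2 \<Rightarrow> complex" where
  "box_char j s c \<pi> l \<nu> \<nu>' \<tau> t =
     (THE y. \<exists>a b k. mat a + mat b ** beta_hat j s \<tau> \<in> GL2 \<and> k \<in> K_cong \<pi> l \<and>
        t = (mat a + mat b ** beta_hat j s \<tau>) ** k \<and>
        y = \<nu> (j a + j b * \<tau>) * \<nu>' (j a + j b * s \<tau>)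
            * c (trace (beta_hat j s \<tau> ** (k - mat 1))))"

section \<open>Induced representations and traces\<close>

definition cscale :: "complex \<Rightarrow> ('x \<Rightarrow> complex) \<Rightarrow> 'x \<Rightarrow> complex" where
  "cscale a f = (\<lambda>x. a * f x)"

global_interpretation cfun: vector_space "cscale :: complex \<Rightarrow> ('x \<Rightarrow> complex) \<Rightarrow> 'x \<Rightarrow> complex"
  by standard (auto simp: cscale_def fun_eq_iff algebra_simps)

text \<open>The trace of an endomorphism \<open>A\<close> of a finite-dimensional space \<open>V\<close> of functions, computed
  in a basis of \<open>V\<close>.\<close>

definition subspace_trace :: "('x \<Rightarrow> complex) set \<Rightarrow> (('x \<Rightarrow> complex) \<Rightarrow> ('x \<Rightarrow> complex)) \<Rightarrow> complex" where
  "subspace_trace V A =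
     (let B = (SOME B. cfun.independent B \<and> cfun.span B = V)
      in \<Sum>b\<in>B. cfun.representation B (A b) b)"

text \<open>The representation of \<open>GL2\<close> induced from a character \<open>\<theta>\<close> of a subgroup \<open>T\<close>: functions on
  \<open>GL2\<close> (extended by 0 to all matrices) on which \<open>GL2\<close> acts by right translation.\<close>

definition ind_space :: "('a::comm_ring_1^2^2) set \<Rightarrow> ('a^2^2 \<Rightarrow> complex) \<Rightarrow> ('a^2^2 \<Rightarrow> complex) set" where
  "ind_space T \<theta> = {f. (\<forall>x. x \<notin> GL2 \<longrightarrow> f x = 0) \<and> (\<forall>t\<in>T. \<forall>x\<in>GL2. f (t ** x) = \<theta> t * f x)}"

definition ind_action :: "'a::comm_ring_1^2^2 \<Rightarrow> ('a^2^2 \<Rightarrow> complex) \<Rightarrow> 'a^2^2 \<Rightarrow> complex" where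
  "ind_action g f = (\<lambda>x. f (x ** g))"

definition cuspidal_space ::
    "('o::comm_ring_1 \<Rightarrow> 'oe::comm_ring_1) \<Rightarrow> ('oe \<Rightarrow> 'oe) \<Rightarrow> ('o \<Rightarrow> complex) \<Rightarrow> 'o \<Rightarrow> nat
      \<Rightarrow> ('oe \<Rightarrow> complex) \<Rightarrow> ('oe \<Rightarrow> complex) \<Rightarrow> 'oe \<Rightarrow> ('o^2^2 \<Rightarrow> complex) set" where
  "cuspidal_space j s c \<pi> l \<nu> \<nu>' \<tau> =
     ind_space (T_grp (beta_hat j s \<tau>) \<pi> l) (box_char j s c \<pi> l \<nu> \<nu>' \<tau>)"

end

theory Submission
  imports Defs
begin

text \<open>
  Write \<open>R\<close> for \<open>\<O>\<^sub>r\<close> and \<open>R\<^sup>E\<close> for \<open>\<O>\<^sub>r\<^sup>E\<close>. Since \<open>\<epsilon>\<close> is a non-square unit,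
  \<open>R\<^sup>E = R \<oplus> R\<Phi>\<close> with \<open>s \<Phi> = - \<Phi>\<close>, and the matrix \<open>J = (0, \<epsilon>; 1, 0)\<close> satisfies \<open>J\<^sup>2 = \<epsilon>\<close>.
  Identifying \<open>\<Phi>\<close> with \<open>J\<close> and putting \<open>w = diag(1, -1)\<close>, every matrix is uniquely \<open>u + v w\<close> with
  \<open>u, v \<in> R\<^sup>E\<close>, where \<open>w u = s(u) w\<close> and \<open>det (u + v w) = N u - N v\<close>. Regularity says that
  \<open>\<tau>\<close> generates \<open>R\<^sup>E\<close> over \<open>R\<close>, so the companion matrix of \<open>\<tau>\<close> is conjugate to the image of
  \<open>\<tau>\<close> in this model. Up to that conjugation the inducing group \<open>T\<close> consists of the \<open>u + v w\<close> with \<open>u\<close>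
  a unit and \<open>\<pi>\<^sup>l | v\<close>, and the inducing character becomes simply \<open>u + v w \<mapsto> \<mu> u\<close>, where
  \<open>\<mu> z = \<nu> z \<nu>' (s z)\<close> (lemmas \<open>T_cyc\<close> and \<open>box_char_cyc\<close>).

  Frobenius' formula (\<open>induced_trace\<close>) turns the character into a sum over \<open>x \<in> GL\<^sub>2(R)\<close> with
  \<open>x g x\<inverse> \<in> T\<close>. For \<open>x = u + v w\<close> and \<open>g = a + \<pi>\<^sup>i b \<Phi>\<close> the \<open>R\<^sup>E\<close>-component of
  \<open>x g x\<inverse>\<close> is \<open>a + \<pi>\<^sup>i b \<Phi> (N u + N v)/(N u - N v)\<close>, and membership in \<open>T\<close> means
  \<open>\<pi>\<^sup>l | \<pi>\<^sup>i u v\<close>. Hence the sum splits into three parts, according to which of \<open>u, v\<close> is a unit.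

  If only \<open>u\<close> is a unit, put \<open>t = v/u\<close>. The fraction is \<open>1 + 2 N t/(1 - N t)\<close>, and rescaling
  \<open>t\<close> by a square root of \<open>1/(1 - N t)\<close>, which exists because the residue characteristic is odd, replaces it
  by \<open>1 + 2 N t\<close>. The argument of \<open>\<mu>\<close> now differs from \<open>g\<close> by a multiple of \<open>\<pi>\<^sup>l\<close>, where \<open>\<mu>\<close> is
  given by \<open>\<psi>\<close>, so the part equals, up to a positive factor, \<open>\<mu> g\<close> times a quadratic Gauss sum of
  the norm form; the form being anisotropic, that sum is a power of \<open>- q\<close> up to normalization
  (\<open>gauss_value\<close>). The part where only \<open>v\<close> is a unit is
  symmetric and yields \<open>\<mu> (s g)\<close>. If both are units, which is possible only for \<open>i \<ge> l\<close>, Hilbert 90 makes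
  the norms equidistributed, and the Cayley substitution \<open>y = (1 + n)/(1 - n)\<close> leaves an additive
  character sum (\<open>sum_cayley\<close>). It vanishes unless \<open>i = r - 1\<close>, where it supplies exactly the
  correction that makes the formula uniform in \<open>i\<close>. The three parts are added up in \<open>orbit_sum\<close>.
\<close>

section \<open>Sums over fibres, and units\<close>

lemma sum_comp_const_fibre:
  fixes g :: "'b \<Rightarrow> 'c::semiring_1"
  assumes "finite A" and "\<And>x. x \<in> A \<Longrightarrow> card {y \<in> A. \<phi> y = \<phi> x} = k"
  shows "(\<Sum>x\<in>A. g (\<phi> x)) = of_nat k * (\<Sum>y\<in>\<phi> ` A. g y)"
proof -
  have "(\<Sum>x\<in>A. g (\<phi> x)) = (\<Sum>y\<in>\<phi> ` A. \<Sum>x\<in>{x \<in> A. \<phi> x = y}. g (\<phi> x))"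
    by (rule sum.image_gen[OF assms(1)])
  also have "\<dots> = (\<Sum>y\<in>\<phi> ` A. of_nat k * g y)"
    using assms(2) by (intro sum.cong refl) auto
  finally show ?thesis by (simp add: sum_distrib_left)
qed

lemma sum_additive_map:
  fixes \<phi> :: "'a::ab_group_add \<Rightarrow> 'b::ab_group_add" and g :: "'b \<Rightarrow> 'c::semiring_1"
  assumes "finite A" and add: "\<And>x y. \<phi> (x + y) = \<phi> x + \<phi> y"
    and closed: "\<And>x y. x \<in> A \<Longrightarrow> y \<in> A \<Longrightarrow> x + y \<in> A" "\<And>x. x \<in> A \<Longrightarrow> - x \<in> A"
  shows "(\<Sum>x\<in>A. g (\<phi> x)) = of_nat (card {x \<in> A. \<phi> x = 0}) * (\<Sum>y\<in>\<phi> ` A. g y)"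
proof (rule sum_comp_const_fibre[OF assms(1)])
  fix x assume x: "x \<in> A"
  have z: "\<phi> 0 = 0" using add[of 0 0] by simp
  have "bij_betw (\<lambda>y. y + x) {y \<in> A. \<phi> y = 0} {y \<in> A. \<phi> y = \<phi> x}"
  proof (rule bij_betw_byWitness[where f' = "\<lambda>y. y - x"])
    show "(\<lambda>y. y - x) ` {y \<in> A. \<phi> y = \<phi> x} \<subseteq> {y \<in> A. \<phi> y = 0}"
    proof clarify
      fix y assume y: "y \<in> A" "\<phi> y = \<phi> x"
      have "y - x \<in> A" using closed(1)[OF y(1) closed(2)[OF x]] by simp
      moreover have "\<phi> (y - x) = 0" using add[of "y - x" x] y by simp
      ultimately show "y - x \<in> A \<and> \<phi> (y - x) = 0" by simp
    qed
  qed (auto simp: add closed x)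
  from bij_betw_same_card[OF this]
  show "card {y \<in> A. \<phi> y = \<phi> x} = card {x \<in> A. \<phi> x = 0}" by simp
qed

text \<open>Meaningful on units only, where the inverse is unique.\<close>

definition uinv :: "'a::comm_ring_1 \<Rightarrow> 'a" where
  "uinv x = (SOME y. x * y = 1)"

lemma mult_uinv: "x dvd 1 \<Longrightarrow> x * uinv x = 1"
  unfolding uinv_def dvd_def by (rule someI_ex) auto

lemma uinv_eqI:
  fixes x :: "'a::comm_ring_1"
  assumes "x * y = 1" shows "uinv x = y"
proof -
  have "x * uinv x = 1" using assms by (intro mult_uinv) (auto simp: dvd_def)
  then have "y * (x * uinv x) = y" by simp
  also have "y * (x * uinv x) = (x * y) * uinv x" by (simp only: ac_simps)
  finally show ?thesis using assms by simp
qed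

lemma unit_mult_iff: "x * y dvd 1 \<longleftrightarrow> x dvd 1 \<and> y dvd 1"
  for x :: "'a::comm_ring_1"
proof
  show "x dvd 1 \<and> y dvd 1" if "x * y dvd 1"
    using that dvd_mult_left dvd_mult_right by blast
  show "x * y dvd 1" if "x dvd 1 \<and> y dvd 1"
    using mult_dvd_mono[of x 1 y 1] that by simp
qed

lemma unit_uinv: "x dvd 1 \<Longrightarrow> uinv x dvd 1"
  using mult_uinv[of x] dvd_triv_right[of "uinv x" x] by simp

lemma unit_power: "x dvd 1 \<Longrightarrow> x ^ n dvd 1" for x :: "'a::comm_ring_1"
  by (induction n) (auto simp: unit_mult_iff)

lemma unit_cancel:
  fixes x :: "'a::comm_ring_1"
  assumes "x dvd 1" shows "x * y = x * z \<longleftrightarrow> y = z"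
proof
  assume "x * y = x * z"
  then have "uinv x * (x * y) = uinv x * (x * z)" by simp
  then have "(x * uinv x) * y = (x * uinv x) * z" by (simp only: ac_simps)
  then show "y = z" using assms by (simp add: mult_uinv)
qed simp

lemma unit_eq_0: "x dvd 1 \<Longrightarrow> x * y = 0 \<longleftrightarrow> y = 0"
  for x :: "'a::comm_ring_1"
  using unit_cancel[of x y 0] by simp

lemma dvd_unit_mult:
  fixes u :: "'a::comm_ring_1"
  assumes "u dvd 1" shows "p dvd u * x \<longleftrightarrow> p dvd x"
proof
  assume "p dvd u * x"
  then have "p dvd uinv u * (u * x)" by (rule dvd_mult)
  also have "uinv u * (u * x) = (u * uinv u) * x" by (simp only: ac_simps)
  finally show "p dvd x" using assms by (simp add: mult_uinv)
qed (rule dvd_mult)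

section \<open>Finite chain rings\<close>

text \<open>The common shape of \<open>\<O>\<^sub>r\<close> and \<open>\<O>\<^sub>r\<^sup>E\<close>: a finite local ring whose maximal ideal is generated by
  a nilpotent element \<open>\<pi>\<close>, with \<open>r\<close> its exact order of nilpotency. Multiplication by \<open>\<pi>\<^sup>r\<^sup>-\<^sup>1\<close>
  identifies the residue field with the socle \<open>\<pi>\<^sup>r\<^sup>-\<^sup>1R\<close>, so that \<open>q\<close> below is the
  cardinality of the residue field, expressed without forming a quotient.\<close>

locale finite_chain_ring =
  fixes \<pi> :: "'a::comm_ring_1" and r q :: nat
  assumes finite_ring: "finite (UNIV :: 'a set)"
    and nonunit_dvd: "\<not> x dvd 1 \<Longrightarrow> \<pi> dvd x"
    and pi_top: "\<pi> ^ r = 0" and pi_below: "\<pi> ^ (r - 1) \<noteq> 0" and r_pos: "0 < r"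
    and card_socle: "card (range ((*) (\<pi> ^ (r - 1)))) = q"
begin

lemma fin [simp]: "finite (A :: 'a set)"
  by (rule finite_subset[OF subset_UNIV finite_ring])

lemma pi_pow_eq_0: "\<pi> ^ n = 0 \<longleftrightarrow> r \<le> n"
proof
  assume "r \<le> n"
  then have "\<pi> ^ n = \<pi> ^ r * \<pi> ^ (n - r)" by (simp flip: power_add)
  then show "\<pi> ^ n = 0" by (simp add: pi_top)
next
  assume z: "\<pi> ^ n = 0"
  show "r \<le> n"
  proof (rule ccontr)
    assume "\<not> r \<le> n"
    then have "\<pi> ^ (r - 1) = \<pi> ^ n * \<pi> ^ (r - 1 - n)" by (simp flip: power_add)
    then show False using pi_below z by simp
  qed
qed

lemma one_neq_0: "(1::'a) \<noteq> 0"
proof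
  assume "(1::'a) = 0"
  then have "\<pi> ^ (r - 1) * 1 = 0" by simp
  then show False using pi_below by simp
qed

lemma pi_nonunit: "\<not> \<pi> dvd 1"
  using unit_power[of \<pi> r] pi_top one_neq_0 by auto

lemma unit_iff: "x dvd 1 \<longleftrightarrow> \<not> \<pi> dvd x"
  using nonunit_dvd pi_nonunit dvd_trans by blast

lemma unit_add_pi: "u dvd 1 \<Longrightarrow> \<pi> dvd x \<Longrightarrow> u + x dvd 1"
  by (simp add: unit_iff dvd_add_left_iff)

lemma unit_diff_pi: "u dvd 1 \<Longrightarrow> \<pi> dvd x \<Longrightarrow> u - x dvd 1"
  using unit_add_pi[of u "- x"] by simp

lemma unit_factor: "\<exists>n u. u dvd 1 \<and> x = \<pi> ^ n * u"
proof -
  have "(\<exists>n u. u dvd 1 \<and> x = \<pi> ^ n * u) \<or> \<pi> ^ k dvd x" for k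
  proof (induction k)
    case (Suc k)
    show ?case
    proof (cases "\<pi> ^ k dvd x")
      case True
      then obtain y where y: "x = \<pi> ^ k * y" by blast
      show ?thesis
      proof (cases "y dvd 1")
        case False
        then have "\<pi> dvd y" by (rule nonunit_dvd)
        then have "\<pi> ^ k * \<pi> dvd \<pi> ^ k * y" by (rule mult_dvd_mono[OF dvd_refl])
        then show ?thesis by (simp add: y mult.commute)
      qed (use y in blast)
    qed (use Suc in blast)
  qed simp
  from this[of r] show ?thesis
  proof
    assume "\<pi> ^ r dvd x"
    then have "x = \<pi> ^ r * 1" by (simp add: pi_top)
    then show ?thesis using dvd_refl[of "1::'a"] by blast
  qed
qed

lemma annihilator:
  assumes "k \<le> r"
  shows "\<pi> ^ k * x = 0 \<longleftrightarrow> \<pi> ^ (r - k) dvd x"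
proof
  show "\<pi> ^ k * x = 0" if "\<pi> ^ (r - k) dvd x"
  proof -
    from that obtain y where "x = \<pi> ^ (r - k) * y" by blast
    then have "\<pi> ^ k * x = \<pi> ^ (k + (r - k)) * y" by (simp add: power_add mult.assoc)
    then show ?thesis using assms by (simp add: pi_top)
  qed
  show "\<pi> ^ (r - k) dvd x" if z: "\<pi> ^ k * x = 0"
  proof -
    obtain n u where u: "u dvd 1" "x = \<pi> ^ n * u" using unit_factor by blast
    have "u * \<pi> ^ (k + n) = 0" using z u by (simp add: power_add algebra_simps)
    then have "\<pi> ^ (k + n) = 0" using unit_eq_0[OF u(1)] by blast
    then have "r - k \<le> n" by (simp add: pi_pow_eq_0)
    then show ?thesis using u by (simp add: le_imp_power_dvd)
  qed
qed

lemma pi_pow_dvd_mult: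
  assumes "l \<le> r"
  shows "\<pi> ^ l dvd \<pi> ^ i * x \<longleftrightarrow> \<pi> ^ (l - i) dvd x"
proof (cases "l \<le> i")
  case True
  then show ?thesis by (simp add: le_imp_power_dvd)
next
  case False
  have "\<pi> ^ l dvd \<pi> ^ i * x \<longleftrightarrow> \<pi> ^ (r - l) * (\<pi> ^ i * x) = 0"
    using annihilator[of "r - l" "\<pi> ^ i * x"] assms by simp
  also have "\<dots> \<longleftrightarrow> \<pi> ^ (r - l + i) * x = 0" by (simp add: power_add mult.assoc)
  also have "\<dots> \<longleftrightarrow> \<pi> ^ (l - i) dvd x"
    using annihilator[of "r - l + i" x] assms False by (simp add: )
  finally show ?thesis .
qed

lemma mem_ideal: "x \<in> range ((*) (\<pi> ^ k)) \<longleftrightarrow> \<pi> ^ k dvd x"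
  by (auto simp: dvd_def)

text \<open>Multiplication by \<open>\<pi>\<close> maps \<open>\<pi>\<^sup>kR\<close> onto \<open>\<pi>\<^sup>k\<^sup>+\<^sup>1R\<close> with the socle as its kernel, so every
  step down the chain of ideals divides the cardinality by \<open>q\<close>.\<close>

lemma card_ideal:
  assumes "k \<le> r" shows "card {x. \<pi> ^ k dvd x} = q ^ (r - k)"
  using assms
proof (induction k rule: inc_induct)
  case base
  then show ?case by (simp add: pi_top)
next
  case (step k)
  let ?A = "{x. \<pi> ^ k dvd x}"
  have im: "(*) \<pi> ` ?A = {x. \<pi> ^ Suc k dvd x}"
    by (auto simp: dvd_def image_iff mult.assoc)
  have ker: "{x \<in> ?A. \<pi> * x = 0} = range ((*) (\<pi> ^ (r - 1)))"
  proof -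
    have "\<pi> * x = 0 \<longleftrightarrow> \<pi> ^ (r - 1) dvd x" for x
      using annihilator[of 1 x] r_pos by simp
    moreover have "\<pi> ^ k dvd \<pi> ^ (r - 1)" using step by (intro le_imp_power_dvd) auto
    ultimately show ?thesis using mem_ideal dvd_trans by blast
  qed
  have "card ?A = (\<Sum>x\<in>?A. 1)" by simp
  also have "\<dots> = of_nat (card {x \<in> ?A. \<pi> * x = 0}) * (\<Sum>y\<in>(*) \<pi> ` ?A. 1)"
    by (rule sum_additive_map[where g = "\<lambda>_. 1"]) (auto simp: distrib_left)
  also have "\<dots> = q * q ^ (r - Suc k)" 
    unfolding im ker card_socle using step.IH by simp
  also have "\<dots> = q ^ (r - k)" using step by (simp add: Suc_diff_Suc flip: power_Suc)
  finally show ?case .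
qed

lemma card_ring: "card (UNIV :: 'a set) = q ^ r"
  using card_ideal[of 0] by simp

lemma q_pos: "0 < q"
proof -
  have "0 < card (range ((*) (\<pi> ^ (r - 1))))" unfolding card_gt_0_iff by simp
  then show ?thesis unfolding card_socle .
qed

lemma card_units: "card {x::'a. x dvd 1} + q ^ (r - 1) = q ^ r"
proof -
  have "card {x::'a. x dvd 1} + card {x. \<pi> dvd x} = card ({x. x dvd 1} \<union> {x. \<pi> dvd x})"
    by (rule card_Un_disjoint[symmetric]) (auto simp: unit_iff)
  also have "{x. x dvd 1} \<union> {x. \<pi> dvd x} = UNIV" by (auto simp: unit_iff)
  finally show ?thesis using card_ideal[of 1] r_pos by (simp add: card_ring)
qed

lemma units_nonempty: "card {x::'a. x dvd 1} \<noteq> 0"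
  by (subst card_0_eq) (auto intro: exI[of _ 1])

lemma sum_scale:
  fixes f :: "'a \<Rightarrow> complex"
  assumes "m \<le> r"
  shows "(\<Sum>x\<in>UNIV. f (\<pi> ^ m * x)) = of_nat (q ^ m) * (\<Sum>x | \<pi> ^ m dvd x. f x)"
proof -
  have "(\<Sum>x\<in>UNIV. f (\<pi> ^ m * x))
      = of_nat (card {x \<in> UNIV. \<pi> ^ m * x = 0}) * (\<Sum>y\<in>range ((*) (\<pi> ^ m)). f y)"
    by (rule sum_additive_map) (auto simp: distrib_left)
  moreover have "card {x. \<pi> ^ m * x = 0} = q ^ m"
    using card_ideal[of "r - m"] annihilator[OF assms] assms by simp
  moreover have "range ((*) (\<pi> ^ m)) = {x. \<pi> ^ m dvd x}"
    by (rule set_eqI) (simp only: mem_ideal mem_Collect_eq)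
  ultimately show ?thesis by simp
qed

lemma sum_units:
  fixes f :: "'a \<Rightarrow> complex"
  shows "(\<Sum>x | x dvd 1. f x) = (\<Sum>x\<in>UNIV. f x) - (\<Sum>x | \<pi> dvd x. f x)"
proof -
  have "{x. x dvd 1} = UNIV - {x. \<pi> dvd x}" by (auto simp: unit_iff)
  then show ?thesis by (simp add: sum_diff)
qed

text \<open>Squaring is injective on the finite set \<open>1 + (\<pi>)\<close>: if \<open>u\<^sup>2 = u'\<^sup>2\<close> there, then
  \<open>(u - u')(u + u') = 0\<close> with \<open>u + u'\<close> congruent to the unit 2. So it is also surjective.\<close>

lemma square_root_unique:
  assumes "(2::'a) dvd 1" "\<pi> dvd u - 1" "\<pi> dvd u' - 1" "u\<^sup>2 = u'\<^sup>2"
  shows "u = u'"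
proof -
  have "\<pi> dvd (u - 1) + (u' - 1)" using assms dvd_add by blast
  then have "2 + ((u - 1) + (u' - 1)) dvd 1" by (rule unit_add_pi[OF assms(1)])
  then have "u + u' dvd 1" by (simp add: algebra_simps)
  moreover have "(u + u') * (u - u') = 0" using assms(4) by (simp add: algebra_simps power2_eq_square)
  ultimately have "u - u' = 0" by (simp only: unit_eq_0)
  then show ?thesis by simp
qed

lemma square_root_exists:
  assumes "(2::'a) dvd 1" "\<pi> dvd x - 1"
  shows "\<exists>u. \<pi> dvd u - 1 \<and> u\<^sup>2 = x"
proof -
  let ?A = "{u. \<pi> dvd u - 1}"
  have sub: "(\<lambda>u. u\<^sup>2) ` ?A \<subseteq> ?A"
  proof clarify
    fix u assume "\<pi> dvd u - 1"
    then have "\<pi> dvd (u - 1) * (u + 1)" by (rule dvd_mult2)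
    then show "\<pi> dvd u\<^sup>2 - 1" by (simp add: algebra_simps power2_eq_square)
  qed
  have "inj_on (\<lambda>u. u\<^sup>2) ?A" using square_root_unique[OF assms(1)] by (auto simp: inj_on_def)
  then have "(\<lambda>u. u\<^sup>2) ` ?A = ?A" using sub by (intro endo_inj_surj) auto
  moreover have "x \<in> ?A" using assms(2) by simp
  ultimately have "x \<in> (\<lambda>u. u\<^sup>2) ` ?A" by simp
  then show ?thesis by auto
qed

end

section \<open>Additive characters of a finite chain ring\<close>

text \<open>Primitivity is nontriviality on the socle, hence on every nonzero ideal.\<close>

locale chain_ring_character = finite_chain_ring \<pi> r q
  for \<pi> :: "'a::comm_ring_1" and r q :: nat +
  fixes c :: "'a \<Rightarrow> complex"
  assumes c_add: "c (x + y) = c x * c y" and c_neq_0: "c x \<noteq> 0"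
    and c_primitive: "\<exists>x. c (\<pi> ^ (r - 1) * x) \<noteq> 1"
begin

lemma c_0 [simp]: "c 0 = 1"
  using c_add[of 0 0] c_neq_0[of 0] by simp

text \<open>Translation by an element on which the character is not 1 multiplies the sum by a number other than 1.\<close>

lemma sum_char:
  assumes "\<kappa> dvd 1" "k < r"
  shows "(\<Sum>x\<in>UNIV. c (\<kappa> * \<pi> ^ k * x)) = 0"
proof -
  obtain x1 where x1: "c (\<pi> ^ (r - 1) * x1) \<noteq> 1" using c_primitive by blast
  define x0 where "x0 = uinv \<kappa> * \<pi> ^ (r - 1 - k) * x1"
  have "\<kappa> * \<pi> ^ k * x0 = (\<kappa> * uinv \<kappa>) * \<pi> ^ (k + (r - 1 - k)) * x1"
    by (simp add: x0_def power_add algebra_simps)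
  then have x0: "\<kappa> * \<pi> ^ k * x0 = \<pi> ^ (r - 1) * x1" using assms by (simp add: mult_uinv)
  let ?S = "\<Sum>x\<in>UNIV. c (\<kappa> * \<pi> ^ k * x)"
  have "?S = (\<Sum>x\<in>UNIV. c (\<kappa> * \<pi> ^ k * (x0 + x)))"
    by (rule sum.reindex_bij_betw[symmetric]) (rule bij_plus)
  also have "\<dots> = c (\<pi> ^ (r - 1) * x1) * ?S"
    by (simp add: distrib_left c_add x0 sum_distrib_left)
  finally show ?thesis using x1 by simp
qed

lemma sum_char_ideal:
  assumes "\<kappa> dvd 1"
  shows "(\<Sum>x | \<pi> dvd x. c (\<kappa> * \<pi> ^ k * x)) = (if k + 1 < r then 0 else of_nat q ^ (r - 1))"
proof -
  have "of_nat q * (\<Sum>x | \<pi> dvd x. c (\<kappa> * \<pi> ^ k * x)) = (\<Sum>x\<in>UNIV. c (\<kappa> * \<pi> ^ k * (\<pi> * x)))"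
    using sum_scale[of 1 "\<lambda>x. c (\<kappa> * \<pi> ^ k * x)"] r_pos by simp
  also have "\<dots> = (\<Sum>x\<in>UNIV. c (\<kappa> * \<pi> ^ (k + 1) * x))" by (simp add: algebra_simps)
  also have "\<dots> = (if k + 1 < r then 0 else of_nat q ^ r)"
  proof (cases "k + 1 < r")
    case True
    show ?thesis unfolding sum_char[OF assms True] using True by simp
  next
    case False
    then have z: "\<pi> ^ (k + 1) = 0" unfolding pi_pow_eq_0 by simp
    show ?thesis unfolding z using False by (simp add: card_ring)
  qed
  also have "\<dots> = of_nat q * (if k + 1 < r then 0 else of_nat q ^ (r - 1))"
    using r_pos by (simp add: power_eq_if)
  finally show ?thesis using q_pos by simp
qed

lemma sum_char_units:
  assumes "\<kappa> dvd 1" "k < r"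
  shows "(\<Sum>x | x dvd 1. c (\<kappa> * \<pi> ^ k * x)) = (if k + 1 < r then 0 else - (of_nat q ^ (r - 1)))"
  using sum_char[OF assms] sum_char_ideal[OF assms(1)] by (simp add: sum_units)

end

section \<open>The norm of an unramified pair\<close>

text \<open>The extension \<open>\<O>\<^sub>r \<rightarrow> \<O>\<^sub>r\<^sup>E\<close> with basis \<open>1, \<Phi>\<close> and conjugation \<open>s\<close>. That the image of
  \<open>\<pi>\<close> still generates the maximal ideal expresses that the extension is unramified; it forces the norm
  form to be anisotropic modulo \<open>\<pi>\<close>, that is, \<open>N z\<close> is a unit only if \<open>z\<close> is one.\<close>

locale unramified_pair =
  R: finite_chain_ring \<pi> r q + E: finite_chain_ring "j \<pi>" r qE
  for \<pi> :: "'o::comm_ring_1" and r q qE :: nat and j :: "'o \<Rightarrow> 'oe::comm_ring_1" +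
  fixes s :: "'oe \<Rightarrow> 'oe" and \<Phi> :: 'oe and \<epsilon> :: 'o
  assumes two_unit: "(2::'o) dvd 1" and eps_unit: "\<epsilon> dvd 1"
    and j_1 [simp]: "j 1 = 1" and j_add: "j (a + b) = j a + j b" and j_mult: "j (a * b) = j a * j b"
    and s_add: "s (x + y) = s x + s y" and s_mult: "s (x * y) = s x * s y"
    and s_j [simp]: "s (j a) = j a" and s_Phi [simp]: "s \<Phi> = - \<Phi>"
    and Phi_sq: "\<Phi> * \<Phi> = j \<epsilon>"
    and decomp: "\<exists>a b. z = j a + j b * \<Phi>"
begin

lemma j_0 [simp]: "j 0 = 0"
  using j_add[of 0 0] by simp

lemma j_minus: "j (- a) = - j a"
  using j_add[of a "- a"] by (simp add: eq_neg_iff_add_eq_0 add.commute)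

lemma j_diff: "j (a - b) = j a - j b"
  using j_add[of a "- b"] by (simp add: j_minus)

lemma j_power: "j (a ^ n) = j a ^ n"
  by (induction n) (simp_all add: j_mult)

lemma j_2: "j 2 = 2"
  using j_add[of 1 1] by simp

lemma s_0 [simp]: "s 0 = 0"
  using s_add[of 0 0] by simp

lemma s_1 [simp]: "s 1 = 1"
  using s_j[of 1] by simp

lemma s_minus: "s (- a) = - s a"
  using s_add[of a "- a"] by (simp add: eq_neg_iff_add_eq_0 add.commute)

lemma s_diff: "s (a - b) = s a - s b"
  using s_add[of a "- b"] by (simp add: s_minus)

lemma j_unit: "a dvd 1 \<Longrightarrow> j a dvd 1"
  using j_mult[of a "uinv a"] by (simp add: mult_uinv dvd_def) (rule exI)

lemma s_unit: "x dvd 1 \<Longrightarrow> s x dvd 1"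
  using s_mult[of x "uinv x"] by (simp add: mult_uinv dvd_def) (rule exI)

lemma j_unit_iff: "j a dvd 1 \<longleftrightarrow> a dvd 1"
proof
  assume u: "j a dvd 1"
  show "a dvd 1"
  proof (rule ccontr)
    assume "\<not> a dvd 1"
    then obtain b where "a = \<pi> * b" using R.nonunit_dvd by (auto simp: dvd_def)
    then have "j \<pi> dvd j a" by (simp add: j_mult)
    then show False using u E.unit_iff by simp
  qed
qed (rule j_unit)

lemma E_two_unit: "(2::'oe) dvd 1"
  using j_unit[OF two_unit] by (simp add: j_2)

lemma j_eq_0: "j a = 0 \<longleftrightarrow> a = 0"
proof
  assume z: "j a = 0"
  obtain n u where u: "u dvd 1" "a = \<pi> ^ n * u" using R.unit_factor[of a] by auto
  have "j u * j \<pi> ^ n = 0" using z u(2) by (simp add: j_mult j_power mult.commute)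
  then have "j \<pi> ^ n = 0" using unit_eq_0[OF j_unit[OF u(1)]] by simp
  then have "\<pi> ^ n = 0" by (simp only: E.pi_pow_eq_0 R.pi_pow_eq_0)
  then show "a = 0" using u(2) by simp
qed simp

lemma inj_j: "inj j"
proof (rule injI)
  fix a b assume "j a = j b"
  then have "j (a - b) = 0" by (simp add: j_diff)
  then show "a = b" by (simp add: j_eq_0)
qed

lemma inv_j [simp]: "inv j (j a) = a"
  by (rule inv_f_f[OF inj_j])

lemma coords_0: "j a + j b * \<Phi> = 0 \<Longrightarrow> a = 0 \<and> b = 0"
proof -
  assume z: "j a + j b * \<Phi> = 0"
  from arg_cong[OF z, of s] have z': "j a - j b * \<Phi> = 0" by (simp add: s_add s_mult)
  have "2 * j a = (j a + j b * \<Phi>) + (j a - j b * \<Phi>)" by simp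
  then have "j a = 0" using z z' unit_eq_0[OF E_two_unit] by simp
  then have a: "a = 0" by (simp add: j_eq_0)
  have "j \<epsilon> * j b = (j a + j b * \<Phi>) * \<Phi>" by (simp add: a mult.assoc Phi_sq mult.commute[of "j \<epsilon>"])
  then have "j b = 0" using z unit_eq_0[OF j_unit[OF eps_unit]] by simp
  then show ?thesis using a by (simp add: j_eq_0)
qed

lemma coords_eq: "j a + j b * \<Phi> = j a' + j b' * \<Phi> \<longleftrightarrow> a = a' \<and> b = b'"
proof
  assume "j a + j b * \<Phi> = j a' + j b' * \<Phi>"
  then have "j (a - a') + j (b - b') * \<Phi> = 0" by (simp add: j_diff algebra_simps)
  then show "a = a' \<and> b = b'" using coords_0 by fastforce
qed simp

text \<open>The coordinates with respect to the basis \<open>1, \<Phi>\<close>.\<close>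

definition re :: "'oe \<Rightarrow> 'o" where "re z = (SOME a. \<exists>b. z = j a + j b * \<Phi>)"
definition im :: "'oe \<Rightarrow> 'o" where "im z = (SOME b. \<exists>a. z = j a + j b * \<Phi>)"

lemma re_coords [simp]: "re (j a + j b * \<Phi>) = a"
  unfolding re_def by (rule some_equality) (auto simp: coords_eq)

lemma im_coords [simp]: "im (j a + j b * \<Phi>) = b"
  unfolding im_def by (rule some_equality) (auto simp: coords_eq)

lemma re_j_Phi [simp]: "re (j b * \<Phi>) = 0" and im_j_Phi [simp]: "im (j b * \<Phi>) = b"
  using re_coords[of 0 b] im_coords[of 0 b] by simp_all

lemma re_im: "z = j (re z) + j (im z) * \<Phi>"
proof -
  obtain a b where z: "z = j a + j b * \<Phi>" using decomp[of z] by auto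
  show ?thesis by (simp add: z)
qed

lemma re_j [simp]: "re (j a) = a" and im_j [simp]: "im (j a) = 0"
  using re_coords[of a 0] im_coords[of a 0] by simp_all

lemma re_Phi [simp]: "re \<Phi> = 0" and im_Phi [simp]: "im \<Phi> = 1"
  using re_coords[of 0 1] im_coords[of 0 1] by simp_all

lemma eq_iff_coords: "x = y \<longleftrightarrow> re x = re y \<and> im x = im y"
proof
  assume "re x = re y \<and> im x = im y"
  then show "x = y" using re_im[of x] re_im[of y] by simp
qed simp

lemma add_coords: "re (x + y) = re x + re y \<and> im (x + y) = im x + im y"
proof -
  have "x + y = j (re x + re y) + j (im x + im y) * \<Phi>"
    by (subst re_im[of x], subst re_im[of y]) (simp add: j_add algebra_simps)
  then show ?thesis by simp
qed

lemma re_add [simp]: "re (x + y) = re x + re y" and im_add [simp]: "im (x + y) = im x + im y"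
  using add_coords by simp_all

lemma mult_coords: "re (x * y) = re x * re y + \<epsilon> * im x * im y \<and> im (x * y) = re x * im y + im x * re y"
proof -
  have sq: "\<Phi> * (\<Phi> * z) = j \<epsilon> * z" for z by (simp add: Phi_sq flip: mult.assoc)
  have "x * y = j (re x * re y + \<epsilon> * im x * im y) + j (re x * im y + im x * re y) * \<Phi>"
    by (subst re_im[of x], subst re_im[of y])
       (simp add: j_add j_mult algebra_simps Phi_sq sq)
  then show ?thesis by simp
qed

lemma re_mult: "re (x * y) = re x * re y + \<epsilon> * im x * im y"
  and im_mult: "im (x * y) = re x * im y + im x * re y"
  using mult_coords by simp_all

lemma s_coords: "re (s z) = re z \<and> im (s z) = - im z"
proof -
  have "s z = j (re z) + j (- im z) * \<Phi>"
    by (subst re_im[of z]) (simp add: s_add s_mult j_minus)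
  then show ?thesis by simp
qed

lemma re_s [simp]: "re (s z) = re z" and im_s [simp]: "im (s z) = - im z"
  using s_coords by simp_all

lemma re_0 [simp]: "re 0 = 0" and im_0 [simp]: "im 0 = 0" and re_1 [simp]: "re 1 = 1" and im_1 [simp]: "im 1 = 0"
  using re_j[of 0] im_j[of 0] re_j[of 1] im_j[of 1] by simp_all

lemma re_minus [simp]: "re (- z) = - re z" and im_minus [simp]: "im (- z) = - im z"
  using re_add[of z "- z"] im_add[of z "- z"] by (simp_all add: eq_neg_iff_add_eq_0 add.commute)

lemma re_diff [simp]: "re (x - y) = re x - re y" and im_diff [simp]: "im (x - y) = im x - im y"
  using re_add[of x "- y"] im_add[of x "- y"] by simp_all

lemma s_s [simp]: "s (s z) = z"
  by (simp add: eq_iff_coords)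

definition nrm :: "'oe \<Rightarrow> 'o" where "nrm z = re z * re z - \<epsilon> * im z * im z"

lemma j_nrm: "j (nrm z) = z * s z"
  by (simp add: eq_iff_coords re_mult im_mult nrm_def)

lemma nrm_mult: "nrm (x * y) = nrm x * nrm y"
  by (simp add: nrm_def re_mult im_mult algebra_simps)

lemma nrm_j: "nrm (j a) = a * a"
  by (simp add: nrm_def)

lemma nrm_unit_iff: "nrm z dvd 1 \<longleftrightarrow> z dvd 1"
  using j_unit_iff[of "nrm z"] s_unit[of z] by (auto simp: j_nrm unit_mult_iff)

lemma pi_dvd_nrm: "\<pi> dvd nrm z \<longleftrightarrow> j \<pi> dvd z"
  using nrm_unit_iff[of z] R.unit_iff[of "nrm z"] E.unit_iff[of z] by simp

lemma dvd_coords: "j \<pi> ^ m dvd z \<longleftrightarrow> \<pi> ^ m dvd re z \<and> \<pi> ^ m dvd im z"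
proof
  assume "j \<pi> ^ m dvd z"
  then obtain y where "z = j (\<pi> ^ m) * y" by (auto simp: dvd_def j_power)
  then show "\<pi> ^ m dvd re z \<and> \<pi> ^ m dvd im z" by (simp add: re_mult im_mult)
next
  assume "\<pi> ^ m dvd re z \<and> \<pi> ^ m dvd im z"
  then obtain a b where ab: "re z = \<pi> ^ m * a" "im z = \<pi> ^ m * b" by (auto simp: dvd_def)
  have "z = j \<pi> ^ m * (j a + j b * \<Phi>)"
    by (subst re_im[of z]) (simp add: ab j_mult j_power algebra_simps)
  then show "j \<pi> ^ m dvd z" by simp
qed

lemma dvd_s: "j \<pi> ^ m dvd s z \<longleftrightarrow> j \<pi> ^ m dvd z"
  by (simp add: dvd_coords)

lemma card_E: "card (UNIV :: 'oe set) = (q ^ r)\<^sup>2"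
proof -
  have "bij_betw (\<lambda>z. (re z, im z)) UNIV UNIV"
  proof (rule bij_betw_byWitness[where f' = "\<lambda>(a, b). j a + j b * \<Phi>"])
    show "\<forall>z\<in>UNIV. (case (re z, im z) of (a, b) \<Rightarrow> j a + j b * \<Phi>) = z"
      using re_im by simp
  qed auto
  from bij_betw_same_card[OF this] show ?thesis
    by (simp add: card_prod R.card_ring power2_eq_square flip: UNIV_Times_UNIV)
qed

text \<open>Counting \<open>\<O>\<^sub>r\<^sup>E\<close> by coordinates recovers the residue degree 2.\<close>

lemma qE_eq: "qE = q\<^sup>2"
proof -
  have "qE ^ r = (q\<^sup>2) ^ r" using card_E E.card_ring by (simp flip: power_mult add: mult.commute)
  then show ?thesis using R.r_pos by (simp add: power_eq_iff_eq_base)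
qed

subsection \<open>Hilbert 90 and the distribution of norms\<close>

text \<open>The usual element \<open>y = 1 + z\<close> works unless it lies in the maximal ideal. Then \<open>z\<close> is congruent
  to \<open>- 1\<close>, so \<open>1 - z\<close> is a unit with \<open>z s(1 - z) = - (1 - z)\<close>, and the sign is absorbed by
  \<open>s \<Phi> = - \<Phi>\<close>.\<close>

lemma hilbert90:
  assumes "nrm z = 1"
  shows "\<exists>y. y dvd 1 \<and> y = z * s y"
proof (cases "1 + z dvd 1")
  case True
  have "z * s (1 + z) = z + j (nrm z)" by (simp add: s_add j_nrm algebra_simps)
  then have "1 + z = z * s (1 + z)" using assms by (simp add: add.commute)
  then show ?thesis using True by (intro exI[of _ "1 + z"] conjI)
next
  case False
  have "z * s (1 - z) = z - j (nrm z)" by (simp add: s_diff j_nrm algebra_simps)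
  then have eq: "z * s (1 - z) = - (1 - z)" using assms by simp
  have "2 - (1 + z) dvd 1" by (rule E.unit_diff_pi[OF E_two_unit E.nonunit_dvd[OF False]])
  then have "1 - z dvd 1" by simp
  moreover have "\<Phi> dvd 1" using j_unit[OF eps_unit] by (simp add: unit_mult_iff flip: Phi_sq)
  ultimately have "\<Phi> * (1 - z) dvd 1" by (simp add: unit_mult_iff)
  moreover have "\<Phi> * (1 - z) = z * s (\<Phi> * (1 - z))"
  proof -
    have "z * s (\<Phi> * (1 - z)) = - \<Phi> * (z * s (1 - z))" by (simp add: s_mult mult.left_commute)
    also have "\<dots> = \<Phi> * (1 - z)" unfolding eq by (simp only: minus_mult_minus)
    finally show ?thesis by simp
  qed
  ultimately show ?thesis by (intro exI[of _ "\<Phi> * (1 - z)"] conjI)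
qed

lemma div_eq_iff: "y dvd 1 \<Longrightarrow> x * uinv y = z \<longleftrightarrow> x = z * y" for x :: "'x::comm_ring_1"
proof
  assume y: "y dvd 1"
  show "x * uinv y = z" if "x = z * y"
    using that mult_uinv[OF y] by (simp add: mult.assoc)
  show "x = z * y" if "x * uinv y = z"
  proof -
    have "z * y = x * (y * uinv y)" by (simp only: that[symmetric] ac_simps)
    then show ?thesis by (simp add: mult_uinv[OF y])
  qed
qed

text \<open>The fibres of \<open>y \<mapsto> y / s y\<close> on units are the cosets of the units of \<open>\<O>\<^sub>r\<close>, and by
  Hilbert 90 its image is the group of elements of norm 1.\<close>

lemma card_units_split:
  "card {x::'oe. x dvd 1} = card {z. nrm z = 1} * card {a::'o. a dvd 1}"
proof -
  let ?U = "{x::'oe. x dvd 1}" and ?\<phi> = "\<lambda>y. y * uinv (s y)"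
  have fibre: "card {y \<in> ?U. ?\<phi> y = ?\<phi> x} = card {a::'o. a dvd 1}" if "x \<in> ?U" for x
  proof -
    have x: "x dvd 1" using that by simp
    have "bij_betw (\<lambda>a. j a * x) {a. a dvd 1} {y \<in> ?U. ?\<phi> y = ?\<phi> x}"
    proof (rule bij_betw_byWitness[where f' = "\<lambda>y. re (y * uinv x)"])
      have yx: "j a * x * uinv x = j a" for a
        using mult_uinv[OF x] by (simp add: mult.assoc)
      show "\<forall>a\<in>{a. a dvd 1}. re (j a * x * uinv x) = a" by (simp add: yx)
      have fixed: "y * uinv x = j (re (y * uinv x))" if y: "y dvd 1" "?\<phi> y = ?\<phi> x" for y
      proof -
        have "y = x * uinv (s x) * s y" using y by (simp only: div_eq_iff s_unit)
        also have "\<dots> = x * (s y * uinv (s x))" by (simp only: ac_simps)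
        finally have "y = s y * uinv (s x) * x" by (simp only: ac_simps)
        then have e: "y * uinv x = s y * uinv (s x)" by (simp only: div_eq_iff x)
        have "s x * s (uinv x) = 1" using mult_uinv[OF x] by (simp flip: s_mult)
        then have "s (y * uinv x) = y * uinv x" by (simp add: e s_mult uinv_eqI)
        from arg_cong[OF this, of im] have m: "- im (y * uinv x) = im (y * uinv x)"
          by (simp only: im_s)
        have "2 * im (y * uinv x) = im (y * uinv x) - (- im (y * uinv x))" by simp
        also have "\<dots> = 0" unfolding m by (rule diff_self)
        finally have z: "im (y * uinv x) = 0" by (simp only: unit_eq_0[OF two_unit])
        have "y * uinv x = j (re (y * uinv x)) + j (im (y * uinv x)) * \<Phi>" by (rule re_im)
        then show ?thesis unfolding z by simp
      qed
      show "\<forall>y\<in>{y \<in> ?U. ?\<phi> y = ?\<phi> x}. j (re (y * uinv x)) * x = y"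
      proof clarify
        fix y assume y: "y dvd 1" "?\<phi> y = ?\<phi> x"
        show "j (re (y * uinv x)) * x = y"
          unfolding fixed[OF y, symmetric] using mult_uinv[OF x]
          by (simp add: mult.assoc mult.commute[of "uinv x"])
      qed
      show "(\<lambda>a. j a * x) ` {a. a dvd 1} \<subseteq> {y \<in> ?U. ?\<phi> y = ?\<phi> x}"
      proof (intro subsetI, elim imageE)
        fix y a assume a: "a \<in> {a. a dvd 1}" and y: "y = j a * x"
        have u: "y dvd 1" using a x by (simp add: y unit_mult_iff j_unit)
        have "j a * x = x * uinv (s x) * (j a * s x)"
          using mult_uinv[OF s_unit[OF x]] by (simp add: ac_simps)
        then have "y = ?\<phi> x * s y" unfolding y s_mult s_j .
        then have "?\<phi> y = ?\<phi> x" by (simp only: div_eq_iff[OF s_unit[OF u]])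
        then show "y \<in> {y \<in> ?U. ?\<phi> y = ?\<phi> x}" using u by simp
      qed
      show "(\<lambda>y. re (y * uinv x)) ` {y \<in> ?U. ?\<phi> y = ?\<phi> x} \<subseteq> {a. a dvd 1}"
      proof (intro subsetI, elim imageE)
        fix a y assume y: "y \<in> {y \<in> ?U. ?\<phi> y = ?\<phi> x}" and a: "a = re (y * uinv x)"
        have "y * uinv x dvd 1" using y x by (simp add: unit_mult_iff unit_uinv)
        then have "j a dvd 1" using fixed[of y] y a by simp
        then show "a \<in> {a. a dvd 1}" by (simp add: j_unit_iff)
      qed
    qed
    from bij_betw_same_card[OF this] show ?thesis by simp
  qed
  have im: "?\<phi> ` ?U = {z. nrm z = 1}"
  proof (intro equalityI subsetI)
    fix z assume "z \<in> ?\<phi> ` ?U"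
    then obtain y where y: "y dvd 1" "z = ?\<phi> y" by auto
    then have "y = z * s y" using div_eq_iff[OF s_unit[OF y(1)], of y z] by simp
    then have "nrm y = nrm (z * s y)" by (rule arg_cong)
    also have "\<dots> = nrm z * nrm (s y)" by (rule nrm_mult)
    also have "nrm (s y) = nrm y" by (simp add: nrm_def)
    finally have e: "nrm y = nrm z * nrm y" .
    have "nrm y * nrm z = nrm y * 1"
      unfolding mult_1_right mult.commute[of "nrm y"] by (rule e[symmetric])
    then show "z \<in> {z. nrm z = 1}" using y(1) by (simp only: unit_cancel nrm_unit_iff mem_Collect_eq)
  next
    fix z assume "z \<in> {z. nrm z = 1}"
    then obtain y where y: "y dvd 1" "y = z * s y" using hilbert90[of z] by auto
    have "?\<phi> y = z" by (rule iffD2[OF div_eq_iff[OF s_unit[OF y(1)]] y(2)])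
    then show "z \<in> ?\<phi> ` ?U" by (rule image_eqI[OF sym]) (simp add: y(1))
  qed
  have "card ?U = (\<Sum>x\<in>?U. 1)" by simp
  also have "\<dots> = of_nat (card {a::'o. a dvd 1}) * (\<Sum>y\<in>?\<phi> ` ?U. 1)"
    by (rule sum_comp_const_fibre[where g = "\<lambda>_. 1"]) (use fibre in auto)
  finally show ?thesis by (simp add: im mult.commute)
qed

lemma nrm_fibre:
  assumes x: "x dvd 1"
  shows "card {y \<in> {y. y dvd 1}. nrm y = nrm x} = card {z. nrm z = 1}"
proof -
  have "bij_betw (\<lambda>z. x * z) {z. nrm z = 1} {y \<in> {y. y dvd 1}. nrm y = nrm x}"
  proof (rule bij_betw_byWitness[where f' = "\<lambda>y. uinv x * y"])
    have e: "x * (uinv x * y) = y" "uinv x * (x * y) = y" for y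
      using mult_uinv[OF x] by (simp_all add: mult.commute flip: mult.assoc)
    show "\<forall>z\<in>{z. nrm z = 1}. uinv x * (x * z) = z" by (simp add: e)
    show "\<forall>y\<in>{y \<in> {y. y dvd 1}. nrm y = nrm x}. x * (uinv x * y) = y" by (simp add: e)
    show "(*) x ` {z. nrm z = 1} \<subseteq> {y \<in> {y. y dvd 1}. nrm y = nrm x}"
    proof clarify
      fix z assume z: "nrm z = 1"
      then have "z dvd 1" using nrm_unit_iff[of z] by simp
      then show "x * z \<in> {y. y dvd 1} \<and> nrm (x * z) = nrm x"
        using z x by (simp add: unit_mult_iff nrm_mult)
    qed
    show "(\<lambda>y. uinv x * y) ` {y \<in> {y. y dvd 1}. nrm y = nrm x} \<subseteq> {z. nrm z = 1}"
    proof clarify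
      fix y assume y: "nrm y = nrm x"
      have "nrm x * nrm (uinv x * y) = nrm x * 1" using y by (simp only: e flip: nrm_mult) simp
      then show "nrm (uinv x * y) = 1" using x by (simp only: unit_cancel nrm_unit_iff)
    qed
  qed
  from bij_betw_same_card[OF this] show ?thesis by simp
qed

text \<open>The fibres of the norm on units are the cosets of the elements of norm 1, so the previous count
  leaves for its image as many elements as \<open>\<O>\<^sub>r\<close> has units.\<close>

lemma nrm_units: "nrm ` {x. x dvd 1} = {a. a dvd 1}"
proof (rule card_subset_eq)
  show "nrm ` {x. x dvd 1} \<subseteq> {a. a dvd 1}" by (auto simp: nrm_unit_iff)
  have "card {x::'oe. x dvd 1} = (\<Sum>x\<in>{x::'oe. x dvd 1}. 1)" by simp
  also have "\<dots> = of_nat (card {z. nrm z = 1}) * (\<Sum>y\<in>nrm ` {x. x dvd 1}. 1)"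
    by (rule sum_comp_const_fibre[where g = "\<lambda>_. 1"]) (use nrm_fibre in auto)
  finally have "card {x::'oe. x dvd 1} = card {z. nrm z = 1} * card (nrm ` {x. x dvd 1})" by simp
  from trans[OF sym[OF this] card_units_split]
  have "card {z. nrm z = 1} * card (nrm ` {x. x dvd 1}) = card {z. nrm z = 1} * card {a::'o. a dvd 1}" .
  moreover have "card {z. nrm z = 1} \<noteq> 0"
  proof
    assume "card {z. nrm z = 1} = 0"
    from card_units_split[unfolded this] have "card {x::'oe. x dvd 1} = 0" by (simp only: mult_0)
    with E.units_nonempty show False by contradiction
  qed
  ultimately show "card (nrm ` {x. x dvd 1}) = card {a::'o. a dvd 1}"
    by (simp only: mult_cancel1) simp
qed simp

lemma sum_nrm_units:
  fixes f :: "'o \<Rightarrow> complex"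
  shows "(\<Sum>x | x dvd 1. f (nrm x)) = of_nat (card {z. nrm z = 1}) * (\<Sum>a | a dvd 1. f a)"
  unfolding nrm_units[symmetric] by (rule sum_comp_const_fibre) (use nrm_fibre in auto)

lemma card_norm_one: "card {z. nrm z = 1} = (q + 1) * q ^ (r - 1)"
proof -
  have UR: "q ^ (r - 1) * q = q ^ r" using R.r_pos by (simp add: power_eq_if)
  have UE: "(q\<^sup>2) ^ (r - 1) * q\<^sup>2 = (q\<^sup>2) ^ r" using R.r_pos by (simp add: power_eq_if)
  let ?k = "card {z. nrm z = 1}" and ?u = "card {a::'o. a dvd 1}"
  have u: "?u = q ^ (r - 1) * (q - 1)" using R.card_units UR by (simp add: diff_mult_distrib2)
  have "?k * ?u = (q\<^sup>2) ^ (r - 1) * (q\<^sup>2 - 1)"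
    using E.card_units UE card_units_split by (simp add: qE_eq diff_mult_distrib2)
  also have "(q\<^sup>2) ^ (r - 1) = q ^ (r - 1) * q ^ (r - 1)" by (simp add: power2_eq_square power_mult_distrib)
  also have "q\<^sup>2 - 1 = (q + 1) * (q - 1)"
    by (simp add: power2_eq_square diff_mult_distrib2 diff_mult_distrib)
  also have "q ^ (r - 1) * q ^ (r - 1) * ((q + 1) * (q - 1)) = ((q + 1) * q ^ (r - 1)) * ?u"
    unfolding u by (simp only: ac_simps)
  finally have "?k * ?u = ((q + 1) * q ^ (r - 1)) * ?u" .
  then show ?thesis using R.units_nonempty by (simp only: mult_cancel2) simp
qed

end

section \<open>Character sums over norms\<close>

context unramified_pair
begin

lemma sum_E_scale:
  fixes f :: "'oe \<Rightarrow> complex"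
  assumes "m \<le> r"
  shows "(\<Sum>x\<in>UNIV. f (j \<pi> ^ m * x)) = of_nat q ^ (2 * m) * (\<Sum>x | j \<pi> ^ m dvd x. f x)"
  using E.sum_scale[OF assms, of f] by (simp add: qE_eq power_mult)

text \<open>For \<open>N t\<close> in the maximal ideal, \<open>1/(1 - N t)\<close> has a square root \<open>\<rho>\<close> congruent to 1, and
  \<open>\<theta> t = \<rho> t\<close> satisfies \<open>N (\<theta> t) = N t/(1 - N t)\<close>. Since \<open>n \<mapsto> n/(1 - n)\<close> is injective,
  \<open>\<theta> t\<close> determines \<open>N t\<close>, hence \<open>\<rho>\<close>, hence \<open>t\<close>; so \<open>\<theta>\<close> permutes each ideal.\<close>

lemma sum_norm_reparam:
  fixes f :: "'o \<Rightarrow> complex"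
  assumes "1 \<le> m"
  shows "(\<Sum>t | j \<pi> ^ m dvd t. f (nrm t * uinv (1 - nrm t))) = (\<Sum>t | j \<pi> ^ m dvd t. f (nrm t))"
proof -
  let ?M = "{t. j \<pi> ^ m dvd t}"
  define \<rho> where "\<rho> n = (SOME u. \<pi> dvd u - 1 \<and> u\<^sup>2 = uinv (1 - n))" for n
  define \<theta> where "\<theta> t = j (\<rho> (nrm t)) * t" for t
  have unit: "1 - n dvd 1" if "\<pi> dvd n" for n
    by (rule R.unit_diff_pi[OF dvd_refl that])
  have \<rho>: "\<pi> dvd \<rho> n - 1 \<and> (\<rho> n)\<^sup>2 = uinv (1 - n)" if "\<pi> dvd n" for n
    unfolding \<rho>_def
  proof (rule someI_ex, rule R.square_root_exists[OF two_unit])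
    have "uinv (1 - n) - 1 = uinv (1 - n) - (1 - n) * uinv (1 - n)"
      by (simp only: mult_uinv[OF unit[OF that]])
    also have "\<dots> = n * uinv (1 - n)" by (simp add: algebra_simps)
    finally show "\<pi> dvd uinv (1 - n) - 1" using that by simp
  qed
  have M: "\<pi> dvd nrm t" if "t \<in> ?M" for t
  proof -
    have "j \<pi> ^ 1 dvd j \<pi> ^ m" by (rule le_imp_power_dvd[OF assms])
    then have "j \<pi> dvd t" using that dvd_trans[of "j \<pi>" "j \<pi> ^ m" t] by simp
    then show ?thesis by (simp only: pi_dvd_nrm)
  qed
  have nrm_\<theta>: "nrm (\<theta> t) = nrm t * uinv (1 - nrm t)" if "t \<in> ?M" for t
    using \<rho>[OF M[OF that]] by (simp add: \<theta>_def nrm_mult nrm_j power2_eq_square mult.commute)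
  have \<rho>_unit: "\<rho> n dvd 1" if "\<pi> dvd n" for n
  proof -
    have "1 + (\<rho> n - 1) dvd 1" using \<rho>[OF that] by (intro R.unit_add_pi) simp_all
    then show ?thesis by simp
  qed
  have inj: "inj_on \<theta> ?M"
  proof (rule inj_onI)
    fix t t' assume t: "t \<in> ?M" and t': "t' \<in> ?M" and eq: "\<theta> t = \<theta> t'"
    let ?n = "nrm t" and ?n' = "nrm t'"
    have "?n * uinv (1 - ?n) = ?n' * uinv (1 - ?n')" using nrm_\<theta>[OF t] nrm_\<theta>[OF t'] eq by simp
    then have "?n = ?n' * uinv (1 - ?n') * (1 - ?n)" by (simp only: div_eq_iff unit M[OF t])
    also have "\<dots> = ?n' * (1 - ?n) * uinv (1 - ?n')" by (simp only: ac_simps)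
    finally have "?n' * (1 - ?n) * uinv (1 - ?n') = ?n" ..
    then have "?n' * (1 - ?n) = ?n * (1 - ?n')" by (simp only: div_eq_iff unit M[OF t'])
    then have n: "?n = ?n'" by (simp add: algebra_simps)
    have "j (\<rho> ?n) * t = j (\<rho> ?n) * t'" using eq unfolding \<theta>_def n .
    then show "t = t'" by (simp only: unit_cancel j_unit \<rho>_unit M[OF t])
  qed
  moreover have "\<theta> ` ?M \<subseteq> ?M" by (auto simp: \<theta>_def)
  ultimately have im: "\<theta> ` ?M = ?M" by (intro endo_inj_surj) simp_all
  have "(\<Sum>t\<in>?M. f (nrm t)) = (\<Sum>t\<in>\<theta> ` ?M. f (nrm t))" by (simp only: im)
  also have "\<dots> = (\<Sum>t\<in>?M. f (nrm (\<theta> t)))" by (simp only: sum.reindex[OF inj] o_def)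
  also have "\<dots> = (\<Sum>t\<in>?M. f (nrm t * uinv (1 - nrm t)))"
    by (rule sum.cong[OF refl]) (simp only: nrm_\<theta>)
  finally show ?thesis ..
qed

end

locale unramified_pair_character =
  unramified_pair \<pi> r q qE j s \<Phi> \<epsilon> + C: chain_ring_character \<pi> r q c
  for \<pi> :: "'o::comm_ring_1" and r q qE :: nat and j :: "'o \<Rightarrow> 'oe::comm_ring_1"
    and s \<Phi> \<epsilon> and c :: "'o \<Rightarrow> complex"
begin

text \<open>The quadratic Gauss sum of the norm form.\<close>

definition gauss :: "'o \<Rightarrow> nat \<Rightarrow> complex" where
  "gauss \<kappa> e = (\<Sum>t\<in>UNIV. c (\<kappa> * \<pi> ^ e * nrm t))"

lemma gauss_top: "r \<le> e \<Longrightarrow> gauss \<kappa> e = of_nat q ^ (2 * r)"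
proof -
  assume "r \<le> e"
  then have z: "\<pi> ^ e = 0" by (simp only: R.pi_pow_eq_0)
  show ?thesis unfolding gauss_def z by (simp add: card_E power_mult[symmetric] mult.commute)
qed

lemma gauss_ideal:
  assumes "m \<le> r"
  shows "of_nat q ^ (2 * m) * (\<Sum>t | j \<pi> ^ m dvd t. c (\<kappa> * \<pi> ^ i * nrm t)) = gauss \<kappa> (i + 2 * m)"
proof -
  have "nrm (j \<pi> ^ m * t) = \<pi> ^ (2 * m) * nrm t" for t
    by (simp add: nrm_mult nrm_j mult_2 power_add flip: j_power)
  then have "gauss \<kappa> (i + 2 * m) = (\<Sum>t\<in>UNIV. c (\<kappa> * \<pi> ^ i * nrm (j \<pi> ^ m * t)))"
    unfolding gauss_def by (simp add: power_add mult.assoc)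
  then show ?thesis using sum_E_scale[OF assms, of "\<lambda>t. c (\<kappa> * \<pi> ^ i * nrm t)"] by simp
qed

text \<open>Non-units are \<open>\<pi>\<close> times an arbitrary element, which contributes the Gauss sum with exponent raised
  by 2. Over the units the norm is equidistributed, and a linear character sum over the units of
  \<open>\<O>\<^sub>r\<close> remains. It is nonzero only when the character has conductor \<open>\<pi>\<close>.\<close>

lemma gauss_step:
  assumes "\<kappa> dvd 1" "e < r"
  shows "of_nat q ^ 2 * gauss \<kappa> e
    = of_nat q ^ 2 * (of_nat ((q + 1) * q ^ (r - 1)) * (if e + 1 < r then 0 else - (of_nat q ^ (r - 1))))
      + gauss \<kappa> (e + 2)"
proof -
  let ?f = "\<lambda>t. c (\<kappa> * \<pi> ^ e * nrm t)"
  have "gauss \<kappa> e = (\<Sum>t | t dvd 1. ?f t) + (\<Sum>t | j \<pi> dvd t. ?f t)"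
    unfolding gauss_def using E.sum_units[of ?f] by simp
  moreover have "(\<Sum>t | t dvd 1. ?f t) = of_nat ((q + 1) * q ^ (r - 1)) * (\<Sum>a | a dvd 1. c (\<kappa> * \<pi> ^ e * a))"
    using sum_nrm_units[of "\<lambda>a. c (\<kappa> * \<pi> ^ e * a)"] by (simp only: card_norm_one)
  moreover have "of_nat q ^ 2 * (\<Sum>t | j \<pi> dvd t. ?f t) = gauss \<kappa> (e + 2)"
    using gauss_ideal[of 1 \<kappa> e] R.r_pos by simp
  ultimately show ?thesis unfolding C.sum_char_units[OF assms] by (simp only: distrib_left)
qed

text \<open>Lowering the exponent by 2 multiplies the sum by \<open>q\<^sup>-\<^sup>2\<close>; the sign enters at \<open>k = 1\<close>, where
  the unit part outweighs the trivial part: \<open>1 - (q + 1) = - q\<close>.\<close>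

lemma gauss_value:
  assumes "\<kappa> dvd 1"
  shows "k \<le> r \<Longrightarrow> (- of_nat q) ^ k * gauss \<kappa> (r - k) = of_nat q ^ (2 * r)"
proof (induction k rule: less_induct)
  case (less k)
  consider "k = 0" | "k = 1" | k' where "k = Suc (Suc k')" by (metis One_nat_def not0_implies_Suc)
  then show ?case
  proof cases
    case 1
    then show ?thesis using gauss_top[of r] by simp
  next
    case 2
    let ?Q = "of_nat q :: complex"
    have e: "r - 1 < r" "\<not> r - 1 + 1 < r" using R.r_pos by auto
    have g: "gauss \<kappa> (r - 1 + 2) = ?Q ^ (2 * r)" by (rule gauss_top) simp
    have "2 * r = 2 + (r - 1) + (r - 1)" using R.r_pos by simp
    then have p: "?Q ^ (2 * r) = ?Q ^ 2 * ?Q ^ (r - 1) * ?Q ^ (r - 1)" by (simp only: power_add)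
    have "?Q ^ 2 * gauss \<kappa> (r - 1)
        = ?Q ^ 2 * ((?Q + 1) * ?Q ^ (r - 1) * (- (?Q ^ (r - 1)))) + ?Q ^ (2 * r)"
      unfolding gauss_step[OF assms e(1)] using e(2) g
      by (simp only: if_False of_nat_mult of_nat_add of_nat_power of_nat_1)
    also have "\<dots> = - (?Q ^ (2 * r) * ?Q)" unfolding p by (simp add: algebra_simps)
    finally have "?Q * (- ?Q * gauss \<kappa> (r - 1)) = ?Q * ?Q ^ (2 * r)"
      by (simp add: power2_eq_square mult.assoc mult.commute)
    then have "- ?Q * gauss \<kappa> (r - 1) = ?Q ^ (2 * r)" using R.q_pos by (simp only: mult_cancel_left) simp
    then show ?thesis using 2 by simp
  next
    case 3
    have lt: "r - k < r" "r - k + 1 < r" and eq: "r - k + 2 = r - k'" using 3 less.prems by auto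
    have "of_nat q ^ 2 * gauss \<kappa> (r - k) = gauss \<kappa> (r - k')"
      using gauss_step[OF assms lt(1)] lt(2) unfolding eq by simp
    then have "(- of_nat q) ^ k' * (of_nat q ^ 2 * gauss \<kappa> (r - k)) = of_nat q ^ (2 * r)"
      using less.IH[of k'] 3 less.prems by simp
    then show ?thesis using 3 by (simp add: power2_eq_square mult.assoc mult.left_commute)
  qed
qed

text \<open>The Cayley transform \<open>n \<mapsto> (1 + n)/(1 - n)\<close> maps the units \<open>n\<close> with \<open>1 - n\<close> a unit onto the
  elements not congruent to \<open>1\<close> or \<open>- 1\<close>. The sum over the whole ring vanishes, so only the two
  excluded residue classes contribute.\<close>

lemma sum_cayley:
  assumes "\<kappa> dvd 1" "i < r"
  shows "(\<Sum>n | n dvd 1 \<and> 1 - n dvd 1. c (\<kappa> * \<pi> ^ i * ((1 + n) * uinv (1 - n))))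
    = - (if i + 1 < r then 0 else of_nat q ^ (r - 1)) * (c (\<kappa> * \<pi> ^ i) + c (- (\<kappa> * \<pi> ^ i)))"
proof -
  let ?f = "\<lambda>y. c (\<kappa> * \<pi> ^ i * y)"
  let ?A = "{n::'o. n dvd 1 \<and> 1 - n dvd 1}" and ?B = "{y::'o. y - 1 dvd 1 \<and> y + 1 dvd 1}"
  have bij: "bij_betw (\<lambda>n. (1 + n) * uinv (1 - n)) ?A ?B"
  proof (rule bij_betw_byWitness[where f' = "\<lambda>y. (y - 1) * uinv (y + 1)"])
    have y: "(1 + n) * uinv (1 - n) + 1 = 2 * uinv (1 - n) \<and> (1 + n) * uinv (1 - n) - 1 = 2 * n * uinv (1 - n)"
      if "1 - n dvd 1" for n :: 'o
    proof -
      have "(1 + n) * uinv (1 - n) + 1 = (1 + n) * uinv (1 - n) + (1 - n) * uinv (1 - n)"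
        by (simp only: mult_uinv[OF that])
      moreover have "(1 + n) * uinv (1 - n) - 1 = (1 + n) * uinv (1 - n) - (1 - n) * uinv (1 - n)"
        by (simp only: mult_uinv[OF that])
      ultimately show ?thesis by (simp add: algebra_simps)
    qed
    have n: "1 - (y - 1) * uinv (y + 1) = 2 * uinv (y + 1) \<and> 1 + (y - 1) * uinv (y + 1) = 2 * y * uinv (y + 1)"
      if "y + 1 dvd 1" for y :: 'o
    proof -
      have "1 - (y - 1) * uinv (y + 1) = (y + 1) * uinv (y + 1) - (y - 1) * uinv (y + 1)"
        by (simp only: mult_uinv[OF that])
      moreover have "1 + (y - 1) * uinv (y + 1) = (y + 1) * uinv (y + 1) + (y - 1) * uinv (y + 1)"
        by (simp only: mult_uinv[OF that])
      ultimately show ?thesis by (simp add: algebra_simps)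
    qed
    show "(\<lambda>n. (1 + n) * uinv (1 - n)) ` ?A \<subseteq> ?B"
      using y by (auto simp: unit_mult_iff two_unit unit_uinv)
    show "(\<lambda>y. (y - 1) * uinv (y + 1)) ` ?B \<subseteq> ?A"
      using n by (auto simp: unit_mult_iff two_unit unit_uinv)
    show "\<forall>m\<in>?A. ((1 + m) * uinv (1 - m) - 1) * uinv ((1 + m) * uinv (1 - m) + 1) = m"
    proof
      fix m :: 'o assume m: "m \<in> ?A"
      have "2 * uinv (1 - m) dvd 1" using m by (simp add: unit_mult_iff two_unit unit_uinv)
      then have "2 * m * uinv (1 - m) * uinv (2 * uinv (1 - m)) = m"
        by (simp only: div_eq_iff) (simp add: ac_simps)
      then show "((1 + m) * uinv (1 - m) - 1) * uinv ((1 + m) * uinv (1 - m) + 1) = m"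
        using y[of m] m by simp
    qed
    show "\<forall>z\<in>?B. (1 + (z - 1) * uinv (z + 1)) * uinv (1 - (z - 1) * uinv (z + 1)) = z"
    proof
      fix z :: 'o assume z: "z \<in> ?B"
      have "2 * uinv (z + 1) dvd 1" using z by (simp add: unit_mult_iff two_unit unit_uinv)
      then have "2 * z * uinv (z + 1) * uinv (2 * uinv (z + 1)) = z"
        by (simp only: div_eq_iff) (simp add: ac_simps)
      then show "(1 + (z - 1) * uinv (z + 1)) * uinv (1 - (z - 1) * uinv (z + 1)) = z"
        using n[of z] z by simp
    qed
  qed
  have shift: "(\<Sum>y | \<pi> dvd y - a. ?f y) = ?f a * (if i + 1 < r then 0 else of_nat q ^ (r - 1))" for a
  proof -
    have "(\<Sum>y | \<pi> dvd y - a. ?f y) = (\<Sum>x | \<pi> dvd x. ?f (a + x))"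
      by (rule sum.reindex_bij_witness[where j = "\<lambda>y. y - a" and i = "\<lambda>x. a + x"]) auto
    also have "\<dots> = ?f a * (\<Sum>x | \<pi> dvd x. ?f x)"
      by (simp add: distrib_left C.c_add sum_distrib_left)
    finally show ?thesis unfolding C.sum_char_ideal[OF assms(1)] .
  qed
  have disj: "\<not> (\<pi> dvd y - 1 \<and> \<pi> dvd y + 1)" for y
  proof
    assume h: "\<pi> dvd y - 1 \<and> \<pi> dvd y + 1"
    have "\<pi> dvd (y + 1) - (y - 1)" by (rule dvd_diff[OF conjunct2[OF h] conjunct1[OF h]])
    then show False using two_unit R.unit_iff[of 2] by simp
  qed
  have "?B = UNIV - ({y. \<pi> dvd y - 1} \<union> {y. \<pi> dvd y + 1})" by (auto simp: R.unit_iff)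
  then have "(\<Sum>y\<in>?B. ?f y) = (\<Sum>y\<in>UNIV. ?f y) - (\<Sum>y\<in>{y. \<pi> dvd y - 1} \<union> {y. \<pi> dvd y + 1}. ?f y)"
    by (simp add: sum_diff)
  also have "(\<Sum>y\<in>{y. \<pi> dvd y - 1} \<union> {y. \<pi> dvd y + 1}. ?f y)
      = (\<Sum>y | \<pi> dvd y - 1. ?f y) + (\<Sum>y | \<pi> dvd y + 1. ?f y)"
    using disj by (intro sum.union_disjoint) auto
  also have "\<dots> = (if i + 1 < r then 0 else of_nat q ^ (r - 1)) * (c (\<kappa> * \<pi> ^ i) + c (- (\<kappa> * \<pi> ^ i)))"
    using shift[of 1] shift[of "- 1"] by (simp add: algebra_simps)
  also have "(\<Sum>y\<in>UNIV. ?f y) = 0" by (rule C.sum_char[OF assms])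
  finally have "(\<Sum>y\<in>?B. ?f y) = - (if i + 1 < r then 0 else of_nat q ^ (r - 1)) * (c (\<kappa> * \<pi> ^ i) + c (- (\<kappa> * \<pi> ^ i)))"
    by simp
  then show ?thesis using sum.reindex_bij_betw[OF bij, of ?f] by simp
qed

end

section \<open>The trace of an induced representation\<close>

lemma sum_fun_apply: "(\<Sum>i\<in>I. f i) x = (\<Sum>i\<in>I. f i x)"
  for f :: "'i \<Rightarrow> 'x \<Rightarrow> complex"
  by (induction I rule: infinite_finite_induct) auto

text \<open>If evaluation at the points of \<open>X\<close> expands every \<open>f \<in> V\<close> in the spanning family \<open>e\<close>, then the
  trace can be read off from \<open>e\<close> although \<open>e\<close> need not be a basis: expressing each \<open>e x\<close> in
  the basis \<open>B\<close> and interchanging the two sums reassembles \<open>\<Sum>\<^sub>b rep (e x) b \<cdot> b = e x\<close>. The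
  computation is the same for every \<open>B\<close>, so the arbitrary choice made in \<open>subspace_trace\<close> is harmless,
  and coset representatives can be avoided below.\<close>

lemma subspace_trace_pullback:
  fixes V :: "('x \<Rightarrow> complex) set"
  assumes V: "cfun.subspace V" and X: "finite X" and e: "\<And>x. x \<in> X \<Longrightarrow> e x \<in> V"
    and expand: "\<And>f. f \<in> V \<Longrightarrow> f = (\<Sum>x\<in>X. cscale (k * f x) (e x))"
    and pull: "\<And>f. f \<in> V \<Longrightarrow> (\<lambda>x. f (\<phi> x)) \<in> V"
  shows "subspace_trace V (\<lambda>f x. f (\<phi> x)) = (\<Sum>x\<in>X. k * e x (\<phi> x))"
proof -
  define B where "B = (SOME B. cfun.independent B \<and> cfun.span B = V)"
  have "\<exists>B. cfun.independent B \<and> cfun.span B = V"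
  proof -
    obtain B where "B \<subseteq> V" "cfun.independent B" "V \<subseteq> cfun.span B"
      by (rule cfun.maximal_independent_subset)
    moreover have "cfun.span B \<subseteq> V" using \<open>B \<subseteq> V\<close> V by (rule cfun.span_minimal)
    ultimately show ?thesis by blast
  qed
  then have B: "cfun.independent B" "cfun.span B = V"
    unfolding B_def using someI_ex[of "\<lambda>B. cfun.independent B \<and> cfun.span B = V"] by auto
  have BV: "B \<subseteq> V" using cfun.span_superset[of B] B(2) by simp
  have "V \<subseteq> cfun.span (e ` X)"
  proof
    fix f assume "f \<in> V"
    then have "f = (\<Sum>x\<in>X. cscale (k * f x) (e x))" by (rule expand)
    also have "\<dots> \<in> cfun.span (e ` X)"
      by (intro cfun.span_sum cfun.span_scale cfun.span_base imageI)
    finally show "f \<in> cfun.span (e ` X)" .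
  qed
  with BV have "B \<subseteq> cfun.span (e ` X)" by simp
  then have fB: "finite B" using cfun.independent_span_bound[OF finite_imageI[OF X] B(1)] by simp
  have rep: "cfun.representation B (\<lambda>x. b (\<phi> x)) b = (\<Sum>x\<in>X. k * b (\<phi> x) * cfun.representation B (e x) b)"
    if "b \<in> B" for b
  proof -
    have "(\<lambda>x. b (\<phi> x)) \<in> V" using that BV pull by auto
    then have "cfun.representation B (\<lambda>x. b (\<phi> x)) = cfun.representation B (\<Sum>x\<in>X. cscale (k * b (\<phi> x)) (e x))"
      using expand[of "\<lambda>x. b (\<phi> x)"] by simp
    also have "\<dots> = (\<lambda>b'. \<Sum>x\<in>X. cfun.representation B (cscale (k * b (\<phi> x)) (e x)) b')"
      by (rule cfun.representation_sum[OF B(1)]) (simp add: B(2) e cfun.subspace_scale[OF V])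
    also have "\<dots> = (\<lambda>b'. \<Sum>x\<in>X. k * b (\<phi> x) * cfun.representation B (e x) b')"
      using e B(2) by (intro ext sum.cong refl) (simp add: cfun.representation_scale[OF B(1)])
    finally show ?thesis by simp
  qed
  have recombine: "(\<Sum>b\<in>B. cfun.representation B (e x) b * b y) = e x y" if "x \<in> X" for x y
  proof -
    have "(\<Sum>b\<in>B. cscale (cfun.representation B (e x) b) b) = e x"
      by (rule cfun.sum_representation_eq[OF B(1)]) (use e[OF that] B(2) fB in auto)
    from fun_cong[OF this, of y] show ?thesis by (simp add: sum_fun_apply cscale_def)
  qed
  have "subspace_trace V (\<lambda>f x. f (\<phi> x)) = (\<Sum>b\<in>B. cfun.representation B (\<lambda>x. b (\<phi> x)) b)"
    unfolding subspace_trace_def B_def Let_def ..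
  also have "\<dots> = (\<Sum>b\<in>B. \<Sum>x\<in>X. k * b (\<phi> x) * cfun.representation B (e x) b)"
    by (rule sum.cong[OF refl rep])
  also have "\<dots> = (\<Sum>x\<in>X. k * (\<Sum>b\<in>B. cfun.representation B (e x) b * b (\<phi> x)))"
    by (subst sum.swap) (simp add: sum_distrib_left mult.assoc mult.commute)
  also have "\<dots> = (\<Sum>x\<in>X. k * e x (\<phi> x))"
    by (rule sum.cong[OF refl]) (simp only: recombine)
  finally show ?thesis .
qed

lemma invertible_inverse:
  fixes x :: "'a::comm_ring_1^2^2"
  assumes "invertible x"
  shows "x ** matrix_inv x = mat 1" "matrix_inv x ** x = mat 1" "invertible (matrix_inv x)"
proof -
  have "x ** matrix_inv x = mat 1 \<and> matrix_inv x ** x = mat 1"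
    using assms unfolding matrix_inv_def invertible_def by (rule someI_ex)
  then show "x ** matrix_inv x = mat 1" "matrix_inv x ** x = mat 1" by simp_all
  then show "invertible (matrix_inv x)" unfolding invertible_def by (intro exI[of _ x] conjI)
qed

lemma matrix_inv_eqI:
  fixes x :: "'a::comm_ring_1^2^2"
  assumes "x ** y = mat 1" "y ** x = mat 1"
  shows "matrix_inv x = y"
proof -
  have "invertible x" using assms unfolding invertible_def by (intro exI[of _ y] conjI)
  then have "matrix_inv x ** (x ** y) = y" by (simp add: matrix_mul_assoc invertible_inverse)
  then show ?thesis by (simp add: assms)
qed

lemma mult_inv_cancel:
  fixes x :: "'a::comm_ring_1^2^2"
  assumes "invertible x"
  shows "y ** x ** matrix_inv x = y" "y ** matrix_inv x ** x = y"
  using invertible_inverse[OF assms] by (simp_all flip: matrix_mul_assoc)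

lemma matrix_inv_mult:
  fixes a b :: "'a::comm_ring_1^2^2"
  assumes "invertible a" "invertible b"
  shows "matrix_inv (a ** b) = matrix_inv b ** matrix_inv a"
  by (rule matrix_inv_eqI)
     (simp_all add: assms invertible_inverse mult_inv_cancel matrix_mul_assoc)

lemma GL2_mult: "x \<in> GL2 \<Longrightarrow> y \<in> GL2 \<Longrightarrow> x ** y \<in> GL2"
  for x :: "'a::comm_ring_1^2^2"
  unfolding GL2_def by (auto intro: invertible_mult)

text \<open>Frobenius' formula. The function \<open>e x\<close> is supported on the coset \<open>T x\<close> and transforms by
  \<open>\<theta>\<close> there; averaging over all \<open>x\<close> in the group instead of over a transversal accounts for the
  factor \<open>card T\<close>.\<close>

theorem induced_trace:
  fixes T :: "('a::comm_ring_1^2^2) set"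
  assumes fin: "finite (GL2 :: ('a^2^2) set)"
    and T: "T \<subseteq> GL2" "mat 1 \<in> T" "\<And>a b. a \<in> T \<Longrightarrow> b \<in> T \<Longrightarrow> a ** b \<in> T"
      "\<And>a. a \<in> T \<Longrightarrow> matrix_inv a \<in> T"
    and \<theta>: "\<And>a b. a \<in> T \<Longrightarrow> b \<in> T \<Longrightarrow> \<theta> (a ** b) = \<theta> a * \<theta> b"
    and g: "g \<in> GL2"
  shows "of_nat (card T) * subspace_trace (ind_space T \<theta>) (ind_action g)
    = (\<Sum>x | x \<in> GL2 \<and> x ** g ** matrix_inv x \<in> T. \<theta> (x ** g ** matrix_inv x))"
proof -
  define e :: "'a^2^2 \<Rightarrow> 'a^2^2 \<Rightarrow> complex" where
    "e x y = (if y \<in> GL2 \<and> y ** matrix_inv x \<in> T then \<theta> (y ** matrix_inv x) else 0)" for x y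
  let ?V = "ind_space T \<theta>" and ?k = "1 / of_nat (card T) :: complex"
  have inv: "invertible x" if "x \<in> GL2" for x :: "'a^2^2" using that by (simp add: GL2_def)
  have finT: "finite T" using T(1) fin by (rule finite_subset)
  have cT: "card T \<noteq> 0" using finT T(2) by auto
  have V: "cfun.subspace ?V"
    unfolding cfun.subspace_def ind_space_def by (auto simp: cscale_def algebra_simps)
  have T_iff: "t ** y \<in> T \<longleftrightarrow> y \<in> T" if "t \<in> T" for t y
  proof
    assume "t ** y \<in> T"
    from T(3)[OF T(4)[OF that] this] show "y \<in> T"
      using inv[of t] that T(1) by (auto simp: matrix_mul_assoc invertible_inverse)
  qed (rule T(3)[OF that])
  have TG: "t \<in> GL2" if "t \<in> T" for t using that T(1) by blast
  have e_V: "e x \<in> ?V" for x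
    unfolding ind_space_def
  proof (clarsimp, intro conjI allI impI ballI)
    fix y :: "'a^2^2" assume "y \<notin> GL2" then show "e x y = 0" by (simp add: e_def)
  next
    fix t y :: "'a^2^2" assume t: "t \<in> T" and y: "y \<in> GL2"
    have "t ** y ** matrix_inv x = t ** (y ** matrix_inv x)" by (simp only: matrix_mul_assoc)
    then show "e x (t ** y) = \<theta> t * e x y"
      using T_iff[OF t] \<theta>[OF t] GL2_mult[OF TG[OF t] y] y by (simp add: e_def)
  qed
  \<comment> \<open>Counting the \<open>x\<close> with \<open>y x\<inverse> \<in> T\<close> by \<open>t = y x\<inverse>\<close>.\<close>
  have count: "card {x \<in> GL2. y ** matrix_inv x \<in> T} = card T" if y: "y \<in> GL2" for y
  proof -
    have "bij_betw (\<lambda>t. matrix_inv t ** y) T {x \<in> GL2. y ** matrix_inv x \<in> T}"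
    proof (rule bij_betw_byWitness[where f' = "\<lambda>x. y ** matrix_inv x"])
      have inv_inv: "matrix_inv (matrix_inv a) = a" if "invertible a" for a :: "'a^2^2"
        by (rule matrix_inv_eqI) (simp_all add: that invertible_inverse)
      have c1: "y ** matrix_inv (matrix_inv t ** y) = t" if "t \<in> T" for t
      proof -
        have t: "invertible t" using that TG inv by blast
        then have "y ** matrix_inv (matrix_inv t ** y) = y ** matrix_inv y ** t"
          using inv[OF y] by (simp add: matrix_inv_mult inv_inv invertible_inverse matrix_mul_assoc)
        then show ?thesis using inv[OF y] by (simp add: invertible_inverse)
      qed
      have c2: "matrix_inv (y ** matrix_inv x) ** y = x" if "x \<in> GL2" for x
        using inv[OF y] inv[OF that]
        by (simp add: matrix_inv_mult inv_inv invertible_inverse mult_inv_cancel)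
      show "\<forall>t\<in>T. y ** matrix_inv (matrix_inv t ** y) = t" using c1 by blast
      show "\<forall>x\<in>{x \<in> GL2. y ** matrix_inv x \<in> T}. matrix_inv (y ** matrix_inv x) ** y = x"
        using c2 by blast
      show "(\<lambda>t. matrix_inv t ** y) ` T \<subseteq> {x \<in> GL2. y ** matrix_inv x \<in> T}"
        using c1 GL2_mult[OF TG[OF T(4)] y] by auto
    qed auto
    from bij_betw_same_card[OF this] show ?thesis by simp
  qed
  have expand: "f = (\<Sum>x\<in>GL2. cscale (?k * f x) (e x))" if f: "f \<in> ?V" for f
  proof
    fix y
    show "f y = (\<Sum>x\<in>GL2. cscale (?k * f x) (e x)) y"
    proof (cases "y \<in> GL2")
      case False
      then show ?thesis using f by (simp add: ind_space_def sum_fun_apply cscale_def e_def)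
    next
      case True
      have "f x * e x y = (if y ** matrix_inv x \<in> T then f y else 0)" if x: "x \<in> GL2" for x
      proof (cases "y ** matrix_inv x \<in> T")
        case t: True
        have "f (y ** matrix_inv x ** x) = \<theta> (y ** matrix_inv x) * f x"
          using f t x by (simp add: ind_space_def)
        then show ?thesis using t True by (simp add: e_def mult_inv_cancel inv[OF x])
      qed (simp add: e_def)
      then have "(\<Sum>x\<in>GL2. cscale (?k * f x) (e x)) y = (\<Sum>x\<in>GL2. ?k * (if y ** matrix_inv x \<in> T then f y else 0))"
        by (simp add: sum_fun_apply cscale_def mult.assoc)
      also have "\<dots> = ?k * (of_nat (card {x \<in> GL2. y ** matrix_inv x \<in> T}) * f y)"
        by (simp only: sum_distrib_left[symmetric] sum.inter_filter[OF fin, symmetric] sum_constant)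
      also have "\<dots> = f y" using cT by (simp add: count[OF True])
      finally show ?thesis ..
    qed
  qed
  have pull: "(\<lambda>x. f (x ** g)) \<in> ?V" if f: "f \<in> ?V" for f
    unfolding ind_space_def
  proof (clarsimp, intro conjI allI impI ballI)
    fix x :: "'a^2^2" assume x: "x \<notin> GL2"
    have "x ** g \<notin> GL2"
    proof
      assume "x ** g \<in> GL2"
      moreover have "matrix_inv g \<in> GL2" by (simp add: GL2_def invertible_inverse(3)[OF inv[OF g]])
      ultimately have "x ** g ** matrix_inv g \<in> GL2" by (rule GL2_mult)
      then show False using x by (simp add: mult_inv_cancel inv[OF g])
    qed
    then show "f (x ** g) = 0" using f by (simp add: ind_space_def)
  next
    fix t x :: "'a^2^2" assume "t \<in> T" "x \<in> GL2"
    then show "f (t ** x ** g) = \<theta> t * f (x ** g)"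
      using f GL2_mult[OF _ g] by (simp add: ind_space_def flip: matrix_mul_assoc)
  qed
  have act: "ind_action g = (\<lambda>f x. f (x ** g))" by (intro ext) (simp add: ind_action_def)
  have "subspace_trace ?V (\<lambda>f x. f (x ** g)) = (\<Sum>x\<in>GL2. ?k * e x (x ** g))"
    by (rule subspace_trace_pullback[OF V fin e_V expand pull])
  then have "of_nat (card T) * subspace_trace ?V (ind_action g) = (\<Sum>x\<in>GL2. e x (x ** g))"
    unfolding act sum_distrib_left[symmetric] using cT by simp
  also have "\<dots> = (\<Sum>x\<in>GL2. if x ** g ** matrix_inv x \<in> T then \<theta> (x ** g ** matrix_inv x) else 0)"
    using GL2_mult[OF _ g] by (intro sum.cong refl) (simp add: e_def)
  also have "\<dots> = (\<Sum>x | x \<in> GL2 \<and> x ** g ** matrix_inv x \<in> T. \<theta> (x ** g ** matrix_inv x))"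
    by (rule sum.inter_filter[OF fin, symmetric])
  finally show ?thesis .
qed

section \<open>The sum over the conjugacy orbit\<close>

lemma uinv_mult: "x dvd 1 \<Longrightarrow> y dvd 1 \<Longrightarrow> uinv (x * y) = uinv x * uinv y"
  for x :: "'a::comm_ring_1"
proof (rule uinv_eqI)
  assume "x dvd 1" "y dvd 1"
  then have "(x * uinv x) * (y * uinv y) = 1" by (simp add: mult_uinv)
  then show "x * y * (uinv x * uinv y) = 1" by (simp only: ac_simps)
qed

lemma uinv_minus: "x dvd 1 \<Longrightarrow> uinv (- x) = - uinv x"
  for x :: "'a::comm_ring_1"
  by (rule uinv_eqI) (simp add: mult_uinv)

text \<open>The substitution \<open>v = u t\<close> for pairs \<open>(u, v)\<close> with \<open>u\<close> a unit, when the summand depends on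
  \<open>t\<close> only.\<close>

lemma sum_unit_pairs:
  fixes P :: "('a::comm_ring_1 \<times> 'a) set" and F :: "'a \<times> 'a \<Rightarrow> complex"
  assumes "\<And>u t. u dvd 1 \<Longrightarrow> (u, u * t) \<in> P \<longleftrightarrow> t \<in> R" and "\<And>u v. (u, v) \<in> P \<Longrightarrow> u dvd 1"
    and "\<And>u t. u dvd 1 \<Longrightarrow> t \<in> R \<Longrightarrow> F (u, u * t) = H t"
  shows "(\<Sum>p\<in>P. F p) = of_nat (card {u::'a. u dvd 1}) * (\<Sum>t\<in>R. H t)"
proof -
  have c: "u * (uinv u * v) = v" "uinv u * (u * v) = v" if "u dvd 1" for u v :: 'a
    using mult_uinv[OF that] by (simp_all add: mult.commute flip: mult.assoc)
  let ?i = "\<lambda>p::'a \<times> 'a. (fst p, fst p * snd p)" and ?j = "\<lambda>p::'a \<times> 'a. (fst p, uinv (fst p) * snd p)"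
  have "(\<Sum>p\<in>P. F p) = (\<Sum>p\<in>{u::'a. u dvd 1} \<times> R. H (snd p))"
  proof (rule sum.reindex_bij_witness[where i = ?i and j = ?j])
    fix p assume p: "p \<in> P"
    have u: "fst p dvd 1" using assms(2)[of "fst p" "snd p"] p by simp
    show "?i (?j p) = p" by (simp add: c[OF u])
    have R: "uinv (fst p) * snd p \<in> R"
      using assms(1)[OF u, of "uinv (fst p) * snd p"] p by (simp add: c[OF u])
    then show "?j p \<in> {u. u dvd 1} \<times> R" using u by simp
    show "H (snd (?j p)) = F p" using assms(3)[OF u R] by (simp add: c[OF u])
  next
    fix p assume p: "p \<in> {u::'a. u dvd 1} \<times> R"
    then have u: "fst p dvd 1" "snd p \<in> R" by auto
    show "?j (?i p) = p" by (simp add: c[OF u(1)])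
    show "?i p \<in> P" using assms(1)[OF u(1)] u(2) by simp
  qed
  also have "\<dots> = (\<Sum>u\<in>{u::'a. u dvd 1}. \<Sum>t\<in>R. H t)"
    by (simp only: sum.cartesian_product case_prod_unfold)
  finally show ?thesis by simp
qed

text \<open>Here \<open>\<mu>\<close> stands for \<open>z \<mapsto> \<nu> z \<nu>' (s z)\<close>, and \<open>mu_cong\<close> is the defining property of \<open>\<tau>\<close>, whose
  trace form is written as \<open>Tr z = 2 re z\<close>. That \<open>im \<tau>\<close> is a unit is regularity.\<close>

locale orbit_sum =
  unramified_pair_character \<pi> r q qE j s \<Phi> \<epsilon> c
  for \<pi> :: "'o::comm_ring_1" and r q qE :: nat and j :: "'o \<Rightarrow> 'oe::comm_ring_1"
    and s \<Phi> \<epsilon> and c :: "'o \<Rightarrow> complex" +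
  fixes \<mu> :: "'oe \<Rightarrow> complex" and l :: nat and \<tau> :: 'oe
  assumes r_eq: "r = 2 * l"
    and mu_mult: "x dvd 1 \<Longrightarrow> y dvd 1 \<Longrightarrow> \<mu> (x * y) = \<mu> x * \<mu> y"
    and mu_cong: "j \<pi> ^ l dvd x \<Longrightarrow> \<mu> (1 + x) = c (2 * re (\<tau> * x))"
    and im_tau: "im \<tau> dvd 1"
begin

lemma l_pos: "1 \<le> l"
  using R.r_pos r_eq by simp

lemma l_le: "l \<le> r"
  using r_eq by simp

lemma dvd_j_pi: "1 \<le> m \<Longrightarrow> j \<pi> ^ m dvd x \<Longrightarrow> j \<pi> dvd x"
  using le_imp_power_dvd[of 1 m "j \<pi>"] dvd_trans by auto

lemma mu_add:
  assumes "g dvd 1" "j \<pi> ^ l dvd x"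
  shows "\<mu> (g + x) = \<mu> g * c (2 * re (\<tau> * uinv g * x))"
proof -
  have d: "j \<pi> ^ l dvd uinv g * x" using assms(2) by (rule dvd_mult)
  have u: "1 + uinv g * x dvd 1"
    by (rule E.unit_add_pi[OF dvd_refl dvd_j_pi[OF l_pos d]])
  have "g + x = g * (1 + uinv g * x)"
    using mult_uinv[OF assms(1)] by (simp add: distrib_left flip: mult.assoc)
  then have "\<mu> (g + x) = \<mu> g * \<mu> (1 + uinv g * x)" by (simp only: mu_mult[OF assms(1) u])
  then show ?thesis by (simp add: mu_cong[OF d] mult.assoc)
qed

text \<open>As \<open>y = ratio u v\<close> varies, \<open>elt a b i y\<close> runs through the \<open>\<O>\<^sub>r\<^sup>E\<close>-components of the conjugates
  \<open>x g x\<inverse>\<close> with \<open>x = u + v w\<close>; the values \<open>y = 1\<close> and \<open>y = - 1\<close> give \<open>g\<close> and its conjugate.\<close>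

definition elt :: "'o \<Rightarrow> 'o \<Rightarrow> nat \<Rightarrow> 'o \<Rightarrow> 'oe" where
  "elt a b i y = j a + j (\<pi> ^ i * b * y) * \<Phi>"

definition ratio :: "'oe \<Rightarrow> 'oe \<Rightarrow> 'o" where
  "ratio u v = (nrm u + nrm v) * uinv (nrm u - nrm v)"

lemma re_mult_j: "re (x * j a) = re x * a"
  by (simp add: re_mult)

lemma re_mult_Phi: "re (x * \<Phi>) = \<epsilon> * im x"
  by (simp add: re_mult)

lemma ratio_unit_left:
  assumes "u dvd 1" "1 - nrm t dvd 1"
  shows "ratio u (u * t) = (1 + nrm t) * uinv (1 - nrm t)"
proof -
  have "ratio u (u * t) = (nrm u * (1 + nrm t)) * uinv (nrm u * (1 - nrm t))"
    by (simp add: ratio_def nrm_mult algebra_simps)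
  also have "\<dots> = (nrm u * uinv (nrm u)) * ((1 + nrm t) * uinv (1 - nrm t))"
    using assms by (simp only: uinv_mult nrm_unit_iff) (simp only: ac_simps)
  finally show ?thesis using assms by (simp add: mult_uinv nrm_unit_iff)
qed

lemma nrm_diff_unit_left:
  assumes "u dvd 1" shows "nrm u - nrm (u * t) dvd 1 \<longleftrightarrow> 1 - nrm t dvd 1"
proof -
  have "nrm u - nrm (u * t) = nrm u * (1 - nrm t)" by (simp add: nrm_mult algebra_simps)
  then show ?thesis using assms by (simp add: unit_mult_iff nrm_unit_iff)
qed

text \<open>Modulo \<open>\<pi>\<close> the element \<open>g\<close> is a scalar, so \<open>\<tau>/g\<close> has a unit as its \<open>\<Phi>\<close>-coordinate,
  just as \<open>\<tau>\<close>.\<close>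

lemma im_tau_uinv:
  assumes g: "g dvd 1" "\<pi> dvd im g"
  shows "im (\<tau> * uinv g) dvd 1"
proof -
  let ?h = "uinv g"
  have h: "g * ?h = 1" using g by (simp add: mult_uinv)
  have a: "re g * re ?h + \<epsilon> * im g * im ?h = 1" using arg_cong[OF h, of re] by (simp add: re_mult)
  have b: "re g * im ?h + im g * re ?h = 0" using arg_cong[OF h, of im] by (simp add: im_mult)
  have "re g * re ?h = 1 - \<epsilon> * im g * im ?h" using a by (simp add: algebra_simps)
  moreover have "1 - \<epsilon> * im g * im ?h dvd 1"
    using g(2) by (intro R.unit_diff_pi dvd_refl) simp
  ultimately have "re g * re ?h dvd 1" by (simp only:)
  then have u: "re g dvd 1" "re ?h dvd 1" by (simp_all only: unit_mult_iff)
  have "re g * im ?h = - (im g * re ?h)" using b by (simp only: eq_neg_iff_add_eq_0)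
  then have "\<pi> dvd re g * im ?h" using g(2) by simp
  then have "\<pi> dvd im ?h" using dvd_unit_mult[OF u(1)] by simp
  then have "\<pi> dvd re \<tau> * im ?h" by simp
  moreover have "im \<tau> * re ?h dvd 1" using u im_tau by (simp add: unit_mult_iff)
  ultimately have "im \<tau> * re ?h + re \<tau> * im ?h dvd 1" by (intro R.unit_add_pi)
  then show ?thesis by (simp add: im_mult add.commute)
qed

text \<open>With \<open>t = v/u\<close> the fraction is \<open>1 + 2 N t/(1 - N t)\<close>, which \<open>sum_norm_reparam\<close> replaces by
  \<open>1 + 2 N t\<close>. Since \<open>\<pi>\<^sup>l | \<pi>\<^sup>i t\<close>, the argument of \<open>\<mu>\<close> differs from \<open>g\<close> by a multiple of
  \<open>\<pi>\<^sup>l\<close>, so \<open>\<mu>\<close> takes the value \<open>\<mu> g\<close> times an additive character of \<open>N t\<close>. The exponent \<open>m\<close>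
  combines the two conditions on \<open>t\<close>: it is a non-unit and \<open>\<pi>\<^sup>l | \<pi>\<^sup>i t\<close>. For \<open>i = 0\<close> the
  coefficient \<open>\<kappa>\<close> may fail to be a unit, but then \<open>2 m = r\<close> and the Gauss sum is trivial.\<close>

lemma sum_unit_nonunit:
  fixes i :: nat
  assumes g: "elt a b i 1 dvd 1" and b: "b dvd 1"
  defines "m \<equiv> max 1 (l - i)"
  defines "P \<equiv> {(u, v). u dvd 1 \<and> \<not> v dvd 1 \<and> nrm u - nrm v dvd 1 \<and> j \<pi> ^ l dvd j \<pi> ^ i * (u * v)}"
  shows "\<exists>\<kappa>. (1 \<le> i \<longrightarrow> \<kappa> dvd 1) \<and> of_nat q ^ (2 * m) * (\<Sum>(u, v)\<in>P. \<mu> (elt a b i (ratio u v)))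
     = of_nat (card {u::'oe. u dvd 1}) * (\<mu> (elt a b i 1) * gauss \<kappa> (i + 2 * m))"
proof -
  let ?g = "elt a b i 1" and ?M = "{t. j \<pi> ^ m dvd t}"
  define \<kappa> where "\<kappa> = 2 * re (\<tau> * uinv ?g * (j (2 * b) * \<Phi>))"
  have m: "1 \<le> m" "m \<le> r" using l_pos l_le by (auto simp: m_def)
  have M: "t \<in> ?M \<longleftrightarrow> \<not> t dvd 1 \<and> j \<pi> ^ l dvd j \<pi> ^ i * t" for t
  proof -
    have "j \<pi> ^ l dvd j \<pi> ^ i * t \<longleftrightarrow> j \<pi> ^ (l - i) dvd t" by (rule E.pi_pow_dvd_mult[OF l_le])
    moreover have "\<not> t dvd 1 \<longleftrightarrow> j \<pi> ^ 1 dvd t" by (simp add: E.unit_iff)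
    moreover have "j \<pi> ^ m dvd t \<longleftrightarrow> j \<pi> ^ 1 dvd t \<and> j \<pi> ^ (l - i) dvd t"
    proof (cases "1 \<le> l - i")
      case True
      then show ?thesis using dvd_j_pi[of "l - i" t] by (auto simp: m_def max_def)
    qed (auto simp: m_def max_def)
    ultimately show ?thesis by simp
  qed
  have Mu: "1 - nrm t dvd 1" if "t \<in> ?M" for t
  proof -
    have "\<pi> dvd nrm t" using that dvd_j_pi[OF m(1)] by (simp add: pi_dvd_nrm)
    then show ?thesis by (intro R.unit_diff_pi dvd_refl)
  qed
  have "(\<Sum>p\<in>P. (\<lambda>(u, v). \<mu> (elt a b i (ratio u v))) p)
      = of_nat (card {u::'oe. u dvd 1}) * (\<Sum>t\<in>?M. \<mu> (elt a b i (1 + 2 * (nrm t * uinv (1 - nrm t)))))"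
  proof (rule sum_unit_pairs)
    fix u t :: 'oe assume u: "u dvd 1"
    have "j \<pi> ^ l dvd j \<pi> ^ i * (u * (u * t)) \<longleftrightarrow> j \<pi> ^ l dvd j \<pi> ^ i * t"
      using dvd_unit_mult[of "u * u" "j \<pi> ^ l" "j \<pi> ^ i * t"] u by (simp add: unit_mult_iff ac_simps)
    then show "(u, u * t) \<in> P \<longleftrightarrow> t \<in> ?M"
      unfolding P_def M using u Mu[of t] unfolding M
      by (auto simp: unit_mult_iff nrm_diff_unit_left)
    assume t: "t \<in> ?M"
    have "(1 + nrm t) * uinv (1 - nrm t) = (1 - nrm t) * uinv (1 - nrm t) + 2 * (nrm t * uinv (1 - nrm t))"
      by (simp add: algebra_simps)
    then have "ratio u (u * t) = 1 + 2 * (nrm t * uinv (1 - nrm t))"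
      by (simp only: ratio_unit_left[OF u Mu[OF t]] mult_uinv[OF Mu[OF t]])
    then show "(\<lambda>(u, v). \<mu> (elt a b i (ratio u v))) (u, u * t) = \<mu> (elt a b i (1 + 2 * (nrm t * uinv (1 - nrm t))))"
      by simp
  qed (auto simp: P_def)
  also have "(\<Sum>t\<in>?M. \<mu> (elt a b i (1 + 2 * (nrm t * uinv (1 - nrm t)))))
      = (\<Sum>t\<in>?M. \<mu> (elt a b i (1 + 2 * nrm t)))"
    using sum_norm_reparam[OF m(1), of "\<lambda>n. \<mu> (elt a b i (1 + 2 * n))"] .
  also have "\<dots> = (\<Sum>t\<in>?M. \<mu> ?g * c (\<kappa> * \<pi> ^ i * nrm t))"
  proof (rule sum.cong[OF refl])
    fix t assume "t \<in> ?M"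
    then have "j \<pi> ^ l dvd j \<pi> ^ i * t" using M[of t] by simp
    then have "j \<pi> ^ l dvd (j \<pi> ^ i * t) * (s t * j (2 * b) * \<Phi>)" by (rule dvd_mult2)
    also have eq: "(j \<pi> ^ i * t) * (s t * j (2 * b) * \<Phi>) = (j (2 * b) * \<Phi>) * j (\<pi> ^ i * nrm t)"
      by (simp only: j_mult j_nrm j_power ac_simps)
    finally have d: "j \<pi> ^ l dvd (j (2 * b) * \<Phi>) * j (\<pi> ^ i * nrm t)" .
    have "elt a b i (1 + 2 * nrm t) = ?g + (j (2 * b) * \<Phi>) * j (\<pi> ^ i * nrm t)"
      by (simp add: elt_def j_add j_mult algebra_simps)
    then have "\<mu> (elt a b i (1 + 2 * nrm t)) = \<mu> ?g * c (2 * re (\<tau> * uinv ?g * ((j (2 * b) * \<Phi>) * j (\<pi> ^ i * nrm t))))"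
      by (simp only: mu_add[OF g d])
    also have "2 * re (\<tau> * uinv ?g * ((j (2 * b) * \<Phi>) * j (\<pi> ^ i * nrm t))) = \<kappa> * \<pi> ^ i * nrm t"
      by (simp only: mult.assoc[symmetric] re_mult_j \<kappa>_def)
    finally show "\<mu> (elt a b i (1 + 2 * nrm t)) = \<mu> ?g * c (\<kappa> * \<pi> ^ i * nrm t)" .
  qed
  finally have S: "(\<Sum>(u, v)\<in>P. \<mu> (elt a b i (ratio u v))) = of_nat (card {u::'oe. u dvd 1}) * (\<mu> ?g * (\<Sum>t\<in>?M. c (\<kappa> * \<pi> ^ i * nrm t)))"
    by (simp add: sum_distrib_left)
  have "\<kappa> dvd 1" if i: "1 \<le> i"
  proof -
    have "\<pi> dvd im ?g" using i by (simp add: elt_def)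
    then have im: "im (\<tau> * uinv ?g) dvd 1" by (rule im_tau_uinv[OF g])
    have "\<kappa> = 2 * (\<epsilon> * im (\<tau> * uinv ?g) * (2 * b))"
      unfolding \<kappa>_def mult.commute[of "j (2 * b)"] by (simp only: mult.assoc[symmetric] re_mult_j re_mult_Phi)
    then show ?thesis using im b by (simp only: unit_mult_iff two_unit eps_unit)
  qed
  moreover have "of_nat q ^ (2 * m) * (\<Sum>(u, v)\<in>P. \<mu> (elt a b i (ratio u v)))
     = of_nat (card {u::'oe. u dvd 1}) * (\<mu> ?g * gauss \<kappa> (i + 2 * m))"
    unfolding S gauss_ideal[OF m(2), of \<kappa> i, symmetric] by (simp only: ac_simps)
  ultimately show ?thesis by (intro exI[of _ \<kappa>] conjI impI)
qed

text \<open>The remainder of the computation is bookkeeping of exponents: the Gauss sum has exponent \<open>r - i\<close> for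
  \<open>1 \<le> i < l\<close> and \<open>i + 2\<close> for \<open>i \<ge> l\<close>, and both lead to the same power of \<open>- q\<close> because \<open>r\<close> is
  even. The last exponent \<open>i = r - 1\<close> is different, as \<open>\<pi>\<^sup>i\<^sup>+\<^sup>2 = 0\<close> makes the Gauss sum trivial
  there.\<close>

lemma sum_unit_nonunit_value:
  fixes i :: nat
  assumes g: "elt a b i 1 dvd 1" and b: "b dvd 1" and i: "i < r"
  defines "P \<equiv> {(u, v). u dvd 1 \<and> \<not> v dvd 1 \<and> nrm u - nrm v dvd 1 \<and> j \<pi> ^ l dvd j \<pi> ^ i * (u * v)}"
  shows "(\<Sum>(u, v)\<in>P. \<mu> (elt a b i (ratio u v)))
     = of_nat (card {u::'oe. u dvd 1}) * \<mu> (elt a b i 1) *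
       (if i + 1 < r then of_nat q ^ r * (- of_nat q) ^ i else of_nat q ^ (2 * r - 2))"
proof -
  let ?m = "max 1 (l - i)" and ?Q = "of_nat q :: complex"
  let ?V = "if i + 1 < r then ?Q ^ r * (- ?Q) ^ i else ?Q ^ (2 * r - 2)"
  obtain \<kappa> where \<kappa>: "1 \<le> i \<longrightarrow> \<kappa> dvd 1"
    and S: "?Q ^ (2 * ?m) * (\<Sum>(u, v)\<in>P. \<mu> (elt a b i (ratio u v)))
     = of_nat (card {u::'oe. u dvd 1}) * (\<mu> (elt a b i 1) * gauss \<kappa> (i + 2 * ?m))"
    using sum_unit_nonunit[OF g b] unfolding P_def by auto
  have Q: "?Q \<noteq> 0" using R.q_pos by simp
  have "gauss \<kappa> (i + 2 * ?m) = ?Q ^ (2 * ?m) * ?V"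
  proof (cases "r \<le> i + 2 * ?m")
    case True
    then have gt: "gauss \<kappa> (i + 2 * ?m) = ?Q ^ (2 * r)" by (rule gauss_top)
    consider "i = 0" | "i = r - 1" "l \<le> i" | "i = r - 2" "l \<le> i" "2 \<le> r"
    proof (cases "l \<le> i")
      case le: True
      then have "?m = 1" by simp
      then have "i = r - 1 \<or> i = r - 2 \<and> 2 \<le> r" using True i r_eq l_pos by linarith
      then show ?thesis using le that by blast
    next
      case False
      then have "?m = l - i" by simp
      then have "i = 0" using True False r_eq by linarith
      then show ?thesis using that by blast
    qed
    then show ?thesis
    proof cases
      case 1
      then have "?m = l" "i + 1 < r" using l_pos r_eq by auto
      then show ?thesis using 1 unfolding gt by (simp add: r_eq power_add[symmetric])
    next
      case 2
      then have m: "?m = 1" and lt: "\<not> i + 1 < r" by auto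
      have e: "2 + (2 * r - 2) = 2 * r" using R.r_pos by simp
      have "?Q ^ (2 * r) = ?Q ^ 2 * ?Q ^ (2 * r - 2)" by (simp only: power_add[symmetric] e)
      then show ?thesis unfolding gt using lt by (simp only: m if_False mult_1_right)
    next
      case 3
      then have m: "?m = 1" and lt: "i + 1 < r" by auto
      have "even i" using 3 r_eq by simp
      then have neg: "(- ?Q) ^ i = ?Q ^ i" by simp
      have e: "2 + (r + i) = 2 * r" using 3 by simp
      show ?thesis unfolding gt using lt
        by (simp only: m if_True neg mult_1_right power_add[symmetric] e)
    qed
  next
    case False
    define k where "k = r - (i + 2 * ?m)"
    have k: "k \<le> r" "r - k = i + 2 * ?m" using False by (auto simp: k_def)
    have i1: "1 \<le> i" "i + 1 < r" using False r_eq l_pos by (auto simp: max_def split: if_splits)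
    have "(- ?Q) ^ k * gauss \<kappa> (i + 2 * ?m) = ?Q ^ (2 * r)"
      using gauss_value[of \<kappa> k] \<kappa> i1 k by simp
    moreover have "(- ?Q) ^ k * (?Q ^ (2 * ?m) * (?Q ^ r * (- ?Q) ^ i)) = ?Q ^ (2 * r)"
    proof -
      have e: "k + i + 2 * ?m = r" using k by simp
      then have "even (k + i)" using r_eq by presburger
      then have "(- ?Q) ^ (k + i) = ?Q ^ (k + i)" by simp
      then have "(- ?Q) ^ k * (?Q ^ (2 * ?m) * (?Q ^ r * (- ?Q) ^ i)) = ?Q ^ (k + i + 2 * ?m + r)"
        by (simp add: power_add ac_simps)
      also have "k + i + 2 * ?m + r = 2 * r" using e by simp
      finally show ?thesis .
    qed
    ultimately have "(- ?Q) ^ k * gauss \<kappa> (i + 2 * ?m) = (- ?Q) ^ k * (?Q ^ (2 * ?m) * (?Q ^ r * (- ?Q) ^ i))"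
      by (simp only:)
    then show ?thesis using Q i1 by (simp only: mult_cancel_left) simp
  qed
  then have "?Q ^ (2 * ?m) * (\<Sum>(u, v)\<in>P. \<mu> (elt a b i (ratio u v)))
      = ?Q ^ (2 * ?m) * (of_nat (card {u::'oe. u dvd 1}) * \<mu> (elt a b i 1) * ?V)"
    unfolding S by (simp only: ac_simps)
  then show ?thesis using Q by (simp only: mult_cancel_left) simp
qed

text \<open>Exchanging \<open>u\<close> and \<open>v\<close> changes the sign of \<open>ratio u v\<close>, which amounts to replacing \<open>b\<close> by
  \<open>- b\<close>.\<close>

lemma sum_nonunit_unit_value:
  fixes i :: nat
  assumes g: "elt a b i (- 1) dvd 1" and b: "b dvd 1" and i: "i < r"
  defines "P \<equiv> {(u, v). \<not> u dvd 1 \<and> v dvd 1 \<and> nrm u - nrm v dvd 1 \<and> j \<pi> ^ l dvd j \<pi> ^ i * (u * v)}"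
  shows "(\<Sum>(u, v)\<in>P. \<mu> (elt a b i (ratio u v)))
     = of_nat (card {u::'oe. u dvd 1}) * \<mu> (elt a b i (- 1)) *
       (if i + 1 < r then of_nat q ^ r * (- of_nat q) ^ i else of_nat q ^ (2 * r - 2))"
proof -
  have elt: "elt a (- b) i y = elt a b i (- y)" for y by (simp add: elt_def)
  have minus_unit: "- x dvd 1 \<longleftrightarrow> x dvd 1" for x :: 'o by simp
  have ratio: "ratio v u = - ratio u v" if "nrm u - nrm v dvd 1" for u v
  proof -
    have "nrm v - nrm u = - (nrm u - nrm v)" by simp
    then have "ratio v u = (nrm u + nrm v) * uinv (- (nrm u - nrm v))"
      unfolding ratio_def by (simp only: add.commute)
    then show ?thesis unfolding uinv_minus[OF that] ratio_def by simp
  qed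
  have swap: "nrm v - nrm u dvd 1 \<longleftrightarrow> nrm u - nrm v dvd 1" for u v
    using minus_unit[of "nrm u - nrm v"] by simp
  let ?P' = "{(u, v). u dvd 1 \<and> \<not> v dvd 1 \<and> nrm u - nrm v dvd 1 \<and> j \<pi> ^ l dvd j \<pi> ^ i * (u * v)}"
  have "(\<Sum>(u, v)\<in>P. \<mu> (elt a b i (ratio u v))) = (\<Sum>(u, v)\<in>?P'. \<mu> (elt a (- b) i (ratio u v)))"
  proof (rule sum.reindex_bij_witness[where i = prod.swap and j = prod.swap])
    fix p assume p: "p \<in> P"
    obtain u v where uv: "p = (u, v)" by (cases p)
    show "prod.swap (prod.swap p) = p" by simp
    show "prod.swap p \<in> ?P'" using p swap[of v u] by (auto simp: uv P_def mult.commute)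
    show "(case prod.swap p of (u, v) \<Rightarrow> \<mu> (elt a (- b) i (ratio u v))) = (case p of (u, v) \<Rightarrow> \<mu> (elt a b i (ratio u v)))"
      using p ratio[of u v] by (simp add: uv P_def elt)
  next
    fix p assume p: "p \<in> ?P'"
    obtain u v where uv: "p = (u, v)" by (cases p)
    show "prod.swap (prod.swap p) = p" by simp
    show "prod.swap p \<in> P" using p swap[of v u] by (auto simp: uv P_def mult.commute)
  qed
  also have "\<dots> = of_nat (card {u::'oe. u dvd 1}) * \<mu> (elt a (- b) i 1) *
       (if i + 1 < r then of_nat q ^ r * (- of_nat q) ^ i else of_nat q ^ (2 * r - 2))"
    by (rule sum_unit_nonunit_value) (use g b i in \<open>simp_all add: elt\<close>)
  finally show ?thesis by (simp add: elt)
qed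

text \<open>Two units satisfy \<open>\<pi>\<^sup>l | \<pi>\<^sup>i u v\<close> only if \<open>i \<ge> l\<close>. Then \<open>a\<close> is a unit and \<open>\<mu>\<close> is, up to the
  factor \<open>\<mu> a\<close>, an additive character of \<open>ratio u v\<close>; equidistribution of norms reduces the sum to
  \<open>sum_cayley\<close>.\<close>

lemma sum_unit_unit_value:
  fixes i :: nat
  assumes g: "elt a b i 1 dvd 1" and b: "b dvd 1" and i: "i < r"
  defines "P \<equiv> {(u, v). u dvd 1 \<and> v dvd 1 \<and> nrm u - nrm v dvd 1 \<and> j \<pi> ^ l dvd j \<pi> ^ i * (u * v)}"
  shows "(\<Sum>(u, v)\<in>P. \<mu> (elt a b i (ratio u v)))
     = of_nat (card {u::'oe. u dvd 1}) * (if i + 1 < r then 0 else - (of_nat (q + 1) * of_nat q ^ (2 * r - 2)))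
       * (\<mu> (elt a b i 1) + \<mu> (elt a b i (- 1)))"
proof (cases "l \<le> i")
  case False
  have "\<not> j \<pi> ^ l dvd j \<pi> ^ i * (u * v)" if "u dvd 1" "v dvd 1" for u v
  proof
    assume "j \<pi> ^ l dvd j \<pi> ^ i * (u * v)"
    then have "j \<pi> ^ (l - i) dvd u * v" by (simp only: E.pi_pow_dvd_mult[OF l_le])
    then have "j \<pi> dvd u * v" using False by (intro dvd_j_pi[of "l - i"]) simp_all
    then show False using that unit_mult_iff[of u v] E.unit_iff[of "u * v"] by simp
  qed
  then have "P = {}" unfolding P_def by auto
  then show ?thesis using False r_eq by simp
next
  case True
  then have i1: "1 \<le> i" using l_pos by simp
  let ?c = "\<lambda>y. \<mu> (j a) * c (2 * re (\<tau> * uinv (j a) * (j b * \<Phi>)) * \<pi> ^ i * y)"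
  define \<kappa> where "\<kappa> = 2 * re (\<tau> * uinv (j a) * (j b * \<Phi>))"
  have a: "j a dvd 1"
  proof -
    have "j \<pi> dvd j (\<pi> ^ i * b * 1) * \<Phi>" using i1 by (simp add: j_mult j_power)
    from E.unit_diff_pi[OF g this] show ?thesis by (simp add: elt_def)
  qed
  have \<kappa>: "\<kappa> dvd 1"
  proof -
    have im: "im (\<tau> * uinv (j a)) dvd 1" by (rule im_tau_uinv[OF a]) simp
    have "\<kappa> = 2 * (\<epsilon> * im (\<tau> * uinv (j a)) * b)"
      unfolding \<kappa>_def mult.commute[of "j b"] by (simp only: mult.assoc[symmetric] re_mult_j re_mult_Phi)
    then show ?thesis using im b by (simp only: unit_mult_iff two_unit eps_unit)
  qed
  have val: "\<mu> (elt a b i y) = \<mu> (j a) * c (\<kappa> * \<pi> ^ i * y)" for y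
  proof -
    have d: "j \<pi> ^ l dvd (j b * \<Phi>) * j (\<pi> ^ i * y)"
      using le_imp_power_dvd[OF True, of "j \<pi>"] by (simp add: j_mult j_power)
    have "elt a b i y = j a + (j b * \<Phi>) * j (\<pi> ^ i * y)"
      by (simp add: elt_def j_mult ac_simps)
    then have "\<mu> (elt a b i y) = \<mu> (j a) * c (2 * re (\<tau> * uinv (j a) * ((j b * \<Phi>) * j (\<pi> ^ i * y))))"
      by (simp only: mu_add[OF a d])
    also have "2 * re (\<tau> * uinv (j a) * ((j b * \<Phi>) * j (\<pi> ^ i * y))) = \<kappa> * \<pi> ^ i * y"
      by (simp only: mult.assoc[symmetric] re_mult_j \<kappa>_def)
    finally show ?thesis .
  qed
  define f where "f n = (if 1 - n dvd 1 then \<mu> (elt a b i ((1 + n) * uinv (1 - n))) else 0)" for n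
  have "(\<Sum>p\<in>P. (\<lambda>(u, v). \<mu> (elt a b i (ratio u v))) p)
      = of_nat (card {u::'oe. u dvd 1}) * (\<Sum>t | t dvd 1 \<and> 1 - nrm t dvd 1. \<mu> (elt a b i ((1 + nrm t) * uinv (1 - nrm t))))"
  proof (rule sum_unit_pairs)
    fix u t :: 'oe assume u: "u dvd 1"
    have "j \<pi> ^ l dvd j \<pi> ^ i * (u * (u * t))"
      by (rule dvd_mult2[OF le_imp_power_dvd[OF True]])
    then show "(u, u * t) \<in> P \<longleftrightarrow> t \<in> {t. t dvd 1 \<and> 1 - nrm t dvd 1}"
      unfolding P_def using u by (auto simp: unit_mult_iff nrm_diff_unit_left)
    assume "t \<in> {t. t dvd 1 \<and> 1 - nrm t dvd 1}"
    then show "(\<lambda>(u, v). \<mu> (elt a b i (ratio u v))) (u, u * t) = \<mu> (elt a b i ((1 + nrm t) * uinv (1 - nrm t)))"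
      using ratio_unit_left[OF u, of t] by simp
  qed (auto simp: P_def)
  also have "(\<Sum>t | t dvd 1 \<and> 1 - nrm t dvd 1. \<mu> (elt a b i ((1 + nrm t) * uinv (1 - nrm t))))
      = (\<Sum>t | t dvd 1. f (nrm t))"
    unfolding f_def by (subst sum.inter_filter[symmetric]) (simp_all)
  also have "\<dots> = of_nat ((q + 1) * q ^ (r - 1)) * (\<Sum>n | n dvd 1. f n)"
    unfolding sum_nrm_units card_norm_one ..
  also have "(\<Sum>n | n dvd 1. f n) = (\<Sum>n | n dvd 1 \<and> 1 - n dvd 1. \<mu> (elt a b i ((1 + n) * uinv (1 - n))))"
    unfolding f_def by (subst sum.inter_filter[symmetric]) (simp_all)
  also have "\<dots> = \<mu> (j a) * (\<Sum>n | n dvd 1 \<and> 1 - n dvd 1. c (\<kappa> * \<pi> ^ i * ((1 + n) * uinv (1 - n))))"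
    by (simp only: val sum_distrib_left)
  also have "\<dots> = - (if i + 1 < r then 0 else of_nat q ^ (r - 1)) * (\<mu> (elt a b i 1) + \<mu> (elt a b i (- 1)))"
    unfolding sum_cayley[OF \<kappa> i] val by (simp add: algebra_simps)
  finally have "(\<Sum>(u, v)\<in>P. \<mu> (elt a b i (ratio u v))) = of_nat (card {u::'oe. u dvd 1}) * (of_nat ((q + 1) * q ^ (r - 1)) *
     (- (if i + 1 < r then 0 else of_nat q ^ (r - 1)) * (\<mu> (elt a b i 1) + \<mu> (elt a b i (- 1)))))"
    by simp
  moreover have "(of_nat q :: complex) ^ (2 * r - 2) = of_nat q ^ (r - 1) * of_nat q ^ (r - 1)"
  proof -
    have e: "2 * r - 2 = (r - 1) + (r - 1)" by simp
    show ?thesis unfolding e power_add ..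
  qed
  ultimately show ?thesis by (cases "i + 1 < r") (simp_all add: algebra_simps)
qed

text \<open>For \<open>i = r - 1\<close> the parts combine as \<open>q\<^sup>2\<^sup>r\<^sup>-\<^sup>2 (1 - (q + 1)) = - q\<^sup>2\<^sup>r\<^sup>-\<^sup>1\<close>, which agrees with
  \<open>q\<^sup>r (- q)\<^sup>i\<close> because \<open>i\<close> is odd.\<close>

theorem orbit_sum:
  fixes i :: nat
  assumes g: "elt a b i 1 dvd 1" and b: "b dvd 1" and i: "i < r"
  shows "(\<Sum>(u, v) | nrm u - nrm v dvd 1 \<and> j \<pi> ^ l dvd j \<pi> ^ i * (u * v). \<mu> (elt a b i (ratio u v)))
     = of_nat (card {u::'oe. u dvd 1} * q ^ r) * ((- of_nat q) ^ i * (\<mu> (elt a b i 1) + \<mu> (elt a b i (- 1))))"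
proof -
  let ?Q = "of_nat q :: complex" and ?F = "\<lambda>(u, v). \<mu> (elt a b i (ratio u v))"
  let ?C = "\<lambda>u v. nrm u - nrm v dvd 1 \<and> j \<pi> ^ l dvd j \<pi> ^ i * (u * v)"
  let ?A = "{(u, v). u dvd 1 \<and> \<not> v dvd 1 \<and> ?C u v}" and ?B = "{(u, v). \<not> u dvd 1 \<and> v dvd 1 \<and> ?C u v}"
    and ?D = "{(u, v). u dvd 1 \<and> v dvd 1 \<and> ?C u v}"
  have fin: "finite (X :: ('oe \<times> 'oe) set)" for X
    by (rule finite_subset[OF subset_UNIV]) (simp add: finite_prod flip: UNIV_Times_UNIV)
  have g': "elt a b i (- 1) dvd 1"
  proof -
    have "elt a b i (- 1) = s (elt a b i 1)" by (simp add: elt_def s_add s_mult j_minus)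
    then show ?thesis using s_unit[OF g] by simp
  qed
  have one: "u dvd 1 \<or> v dvd 1" if "nrm u - nrm v dvd 1" for u v
  proof (rule ccontr)
    assume "\<not> (u dvd 1 \<or> v dvd 1)"
    then have "\<pi> dvd nrm u" "\<pi> dvd nrm v" by (simp_all add: pi_dvd_nrm E.unit_iff)
    then have "\<pi> dvd nrm u - nrm v" by (rule dvd_diff)
    then show False using that R.unit_iff by simp
  qed
  have "{(u, v). ?C u v} = ?A \<union> ?B \<union> ?D" using one by auto
  then have "(\<Sum>p | case p of (u, v) \<Rightarrow> ?C u v. ?F p) = (\<Sum>p\<in>?A \<union> ?B \<union> ?D. ?F p)" by simp
  also have "\<dots> = (\<Sum>p\<in>?A. ?F p) + (\<Sum>p\<in>?B. ?F p) + (\<Sum>p\<in>?D. ?F p)"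
    using fin by (subst sum.union_disjoint, auto)+
  finally have S: "(\<Sum>p | case p of (u, v) \<Rightarrow> ?C u v. ?F p) = \<dots>" .
  have r1: "i = r - 1" if "\<not> i + 1 < r" using that i by simp
  have "even r" using r_eq by simp
  have p: "?Q ^ (2 * r - 2) - of_nat (q + 1) * ?Q ^ (2 * r - 2) = ?Q ^ r * (- ?Q) ^ i" if "\<not> i + 1 < r"
  proof -
    have "odd i" using r1[OF that] \<open>even r\<close> R.r_pos by simp
    then have "?Q ^ r * (- ?Q) ^ i = - (?Q ^ (r + i))" by (simp add: power_add)
    also have "r + i = Suc (2 * r - 2)" using r1[OF that] R.r_pos by simp
    finally show ?thesis by (simp add: algebra_simps)
  qed
  show ?thesis
  proof (cases "i + 1 < r")
    case True
    then show ?thesis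
      unfolding S sum_unit_nonunit_value[OF g b i] sum_nonunit_unit_value[OF g' b i]
        sum_unit_unit_value[OF g b i] by (simp add: algebra_simps)
  next
    case False
    have "(\<Sum>p\<in>?A. ?F p) + (\<Sum>p\<in>?B. ?F p) + (\<Sum>p\<in>?D. ?F p)
      = of_nat (card {u::'oe. u dvd 1}) * (\<mu> (elt a b i 1) + \<mu> (elt a b i (- 1))) * (?Q ^ (2 * r - 2) - of_nat (q + 1) * ?Q ^ (2 * r - 2))"
      unfolding sum_unit_nonunit_value[OF g b i] sum_nonunit_unit_value[OF g' b i]
        sum_unit_unit_value[OF g b i] using False by (simp add: algebra_simps)
    then show ?thesis unfolding S p[OF False] by (simp add: ac_simps)
  qed
qed

end

section \<open>Matrices as a cyclic algebra\<close>

lemma mat2_nth [simp]: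
  "mat2 a b c d $ 1 $ 1 = a" "mat2 a b c d $ 1 $ 2 = b"
  "mat2 a b c d $ 2 $ 1 = c" "mat2 a b c d $ 2 $ 2 = d"
  by (simp_all add: mat2_def)

lemma mat2_entries: "X = mat2 (X $ 1 $ 1) (X $ 1 $ 2) (X $ 2 $ 1) (X $ 2 $ 2)"
  by (simp add: vec_eq_iff forall_2)

lemma mat2_eq_iff: "mat2 a b c d = mat2 a' b' c' d' \<longleftrightarrow> a = a' \<and> b = b' \<and> c = c' \<and> d = d'"
  by (auto simp: vec_eq_iff forall_2)

lemma mat2_mult: "mat2 a b c d ** mat2 a' b' c' d'
    = mat2 (a * a' + b * c') (a * b' + b * d') (c * a' + d * c') (c * b' + d * d')"
  by (simp add: vec_eq_iff forall_2 matrix_matrix_mult_def sum_2)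

lemma mat2_diff: "mat2 a b c d - mat2 a' b' c' d' = mat2 (a - a') (b - b') (c - c') (d - d')"
  by (simp add: vec_eq_iff forall_2)

lemma mat2_add: "mat2 a b c d + mat2 a' b' c' d' = mat2 (a + a') (b + b') (c + c') (d + d')"
  by (simp add: vec_eq_iff forall_2)

lemma mat_eq_mat2: "mat a = mat2 a 0 0 a"
  by (simp add: vec_eq_iff forall_2 mat_def)

lemma finite_mat2:
  assumes "finite (UNIV :: 'a::comm_ring_1 set)"
  shows "finite (A :: ('a^2^2) set)"
proof (rule finite_subset)
  show "A \<subseteq> (\<lambda>(a, b, c, d). mat2 a b c d) ` UNIV"
  proof
    fix X assume "X \<in> A"
    show "X \<in> (\<lambda>(a, b, c, d). mat2 a b c d) ` UNIV"
      by (rule image_eqI[of _ _ "(X $ 1 $ 1, X $ 1 $ 2, X $ 2 $ 1, X $ 2 $ 2)"]) (simp_all add: mat2_entries[symmetric])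
  qed
  have "finite (UNIV :: ('a \<times> 'a \<times> 'a \<times> 'a) set)"
    by (simp add: assms finite_prod)
  then show "finite ((\<lambda>(a, b, c, d). mat2 a b c d) ` (UNIV :: ('a \<times> 'a \<times> 'a \<times> 'a) set))"
    by (rule finite_imageI)
qed

lemma mat_commute: "mat b ** X = X ** mat b"
  for X :: "'a::comm_ring_1^2^2"
  by (subst (1 2) mat2_entries[of X]) (simp add: mat_eq_mat2 mat2_mult mat2_eq_iff mult.commute)

definition entries_dvd :: "'a::comm_ring_1 \<Rightarrow> 'a^2^2 \<Rightarrow> bool" where
  "entries_dvd p X \<longleftrightarrow> (\<forall>i k. p dvd X $ i $ k)"

lemma entries_dvd_mult:
  assumes "entries_dvd p X" shows "entries_dvd p (A ** X ** B)"
proof -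
  have "entries_dvd p (A ** X)"
    using assms unfolding entries_dvd_def matrix_matrix_mult_def by (auto intro!: dvd_sum dvd_mult)
  moreover have "entries_dvd p (Y ** B)" if "entries_dvd p Y" for Y
    using that unfolding entries_dvd_def matrix_matrix_mult_def by (auto intro!: dvd_sum dvd_mult2)
  ultimately show ?thesis by simp
qed

locale cuspidal_datum =
  orbit_sum \<pi> r q qE j s \<Phi> \<epsilon> c \<mu> l \<tau>
  for \<pi> :: "'o::comm_ring_1" and r q qE :: nat and j :: "'o \<Rightarrow> 'oe::comm_ring_1"
    and s \<Phi> \<epsilon> and c :: "'o \<Rightarrow> complex" and \<mu> l \<tau> +
  fixes \<nu> \<nu>' :: "'oe \<Rightarrow> complex"
  assumes mu_eq: "\<mu> z = \<nu> z * \<nu>' (s z)"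
begin

text \<open>The matrix \<open>u + v w\<close> with \<open>\<Phi>\<close> sent to \<open>(0, \<epsilon>; 1, 0)\<close> and \<open>w = diag(1, - 1)\<close>. The next lemma is
  the rule \<open>w u = s(u) w\<close>.\<close>

definition cyc :: "'oe \<Rightarrow> 'oe \<Rightarrow> 'o^2^2" where
  "cyc u v = mat2 (re u + re v) (\<epsilon> * (im u - im v)) (im u + im v) (re u - re v)"

lemma cyc_mult: "cyc u v ** cyc u' v' = cyc (u * u' + v * s v') (u * v' + v * s u')"
  by (simp add: cyc_def mat2_mult mat2_eq_iff re_mult im_mult algebra_simps)

lemma cyc_diff: "cyc u v - cyc u' v' = cyc (u - u') (v - v')"
  by (simp add: cyc_def mat2_diff mat2_eq_iff algebra_simps)

lemma cyc_add: "cyc u v + cyc u' v' = cyc (u + u') (v + v')"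
  by (simp add: cyc_def mat2_add mat2_eq_iff algebra_simps)

lemma cyc_scalar: "mat a = cyc (j a) 0"
  by (simp add: cyc_def mat_eq_mat2)

lemma cyc_one: "mat 1 = cyc 1 0"
  using cyc_scalar[of 1] by simp

lemma cyc_surj: "\<exists>u v. X = cyc u v"
proof -
  let ?h = "uinv 2 :: 'o"
  have h: "2 * ?h = 1" by (rule mult_uinv[OF two_unit])
  have half: "(x + y) * ?h + (x - y) * ?h = x" "(x + y) * ?h - (x - y) * ?h = y" for x y :: 'o
  proof -
    have "(x + y) * ?h + (x - y) * ?h = (2 * ?h) * x" by (simp add: algebra_simps)
    then show "(x + y) * ?h + (x - y) * ?h = x" by (simp only: h mult_1_left)
    have "(x + y) * ?h - (x - y) * ?h = (2 * ?h) * y" by (simp add: algebra_simps)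
    then show "(x + y) * ?h - (x - y) * ?h = y" by (simp only: h mult_1_left)
  qed
  let ?a = "X $ 1 $ 1" and ?d = "X $ 2 $ 2" and ?c = "X $ 2 $ 1" and ?b = "uinv \<epsilon> * X $ 1 $ 2"
  have "X $ 1 $ 2 = \<epsilon> * ?b" using mult_uinv[OF eps_unit] by (simp flip: mult.assoc)
  then have "X = mat2 ?a (\<epsilon> * ?b) ?c ?d" using mat2_entries[of X] by simp
  also have "\<dots> = cyc (j ((?a + ?d) * ?h) + j ((?c + ?b) * ?h) * \<Phi>) (j ((?a - ?d) * ?h) + j ((?c - ?b) * ?h) * \<Phi>)"
    unfolding cyc_def re_coords im_coords half ..
  finally show ?thesis by (intro exI)
qed

lemma cyc_eq_iff: "cyc u v = cyc u' v' \<longleftrightarrow> u = u' \<and> v = v'"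
proof
  assume eq: "cyc u v = cyc u' v'"
  have half: "x = x' \<and> y = y'" if "x + y = x' + y'" "x - y = x' - y'" for x y x' y' :: 'o
  proof -
    have "2 * x = (x + y) + (x - y)" by simp
    also have "\<dots> = (x' + y') + (x' - y')" unfolding that ..
    also have "\<dots> = 2 * x'" by simp
    finally have "x = x'" by (simp only: unit_cancel[OF two_unit])
    then show ?thesis using that(1) by simp
  qed
  from eq have "re u + re v = re u' + re v'" "re u - re v = re u' - re v'"
    "im u + im v = im u' + im v'" "\<epsilon> * (im u - im v) = \<epsilon> * (im u' - im v')"
    unfolding cyc_def mat2_eq_iff by simp_all
  moreover from this(4) have "im u - im v = im u' - im v'" by (simp only: unit_cancel[OF eps_unit])
  ultimately show "u = u' \<and> v = v'"
    using half[of "re u" "re v" "re u'" "re v'"] half[of "im u" "im v" "im u'" "im v'"]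
    by (simp add: eq_iff_coords)
qed simp

lemma det_cyc: "det (cyc u v) = nrm u - nrm v"
  by (simp add: det_2 cyc_def nrm_def algebra_simps)

lemma trace_cyc: "trace (cyc u v) = 2 * re u"
  by (simp add: trace_def sum_2 cyc_def)

lemma inv_cyc:
  assumes "nrm u - nrm v dvd 1"
  defines "d \<equiv> j (uinv (nrm u - nrm v))"
  shows "matrix_inv (cyc u v) = cyc (s u * d) (- (v * d))" "cyc u v \<in> GL2"
proof -
  have "(u * s u - v * s v) * d = j ((nrm u - nrm v) * uinv (nrm u - nrm v))"
    by (simp only: d_def j_mult j_diff j_nrm)
  then have d: "(u * s u - v * s v) * d = 1" by (simp add: mult_uinv[OF assms(1)])
  have sd: "s d = d" by (simp add: d_def)
  have 1: "cyc u v ** cyc (s u * d) (- (v * d)) = mat 1"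
    unfolding cyc_mult cyc_one cyc_eq_iff using d
    by (simp add: s_mult s_minus sd algebra_simps)
  have 2: "cyc (s u * d) (- (v * d)) ** cyc u v = mat 1"
    unfolding cyc_mult cyc_one cyc_eq_iff using d
    by (simp add: s_mult s_minus sd algebra_simps)
  show "matrix_inv (cyc u v) = cyc (s u * d) (- (v * d))" by (rule matrix_inv_eqI[OF 1 2])
  show "cyc u v \<in> GL2" unfolding GL2_def invertible_def using 1 2 by blast
qed

lemma GL2_iff: "X \<in> GL2 \<longleftrightarrow> det X dvd 1" for X :: "'o^2^2"
proof
  assume "X \<in> GL2"
  then obtain Y where "X ** Y = mat 1" by (auto simp: GL2_def invertible_def)
  then have "det X * det Y = 1" by (simp flip: det_mul)
  then show "det X dvd 1" by (intro dvdI[of _ _ "det Y"]) simp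
next
  assume d: "det X dvd 1"
  obtain u v where X: "X = cyc u v" using cyc_surj by blast
  show "X \<in> GL2" using d inv_cyc(2)[of u v] unfolding X det_cyc by simp
qed

lemma GL2_cyc: "cyc u v \<in> GL2 \<longleftrightarrow> nrm u - nrm v dvd 1"
  by (simp add: GL2_iff det_cyc)

lemma entries_dvd_cyc: "entries_dvd (\<pi> ^ m) (cyc u v) \<longleftrightarrow> j \<pi> ^ m dvd u \<and> j \<pi> ^ m dvd v"
proof
  let ?p = "\<pi> ^ m"
  have half: "?p dvd x \<and> ?p dvd y" if "?p dvd x + y" "?p dvd x - y" for x y
  proof -
    have "?p dvd (x + y) + (x - y)" "?p dvd (x + y) - (x - y)" using that by (rule dvd_add, rule dvd_diff)
    then have "?p dvd 2 * x" "?p dvd 2 * y" by simp_all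
    then show ?thesis by (simp only: dvd_unit_mult[OF two_unit])
  qed
  assume "entries_dvd ?p (cyc u v)"
  then have d: "?p dvd re u + re v" "?p dvd re u - re v" "?p dvd im u + im v" "?p dvd \<epsilon> * (im u - im v)"
    by (simp_all add: entries_dvd_def cyc_def forall_2)
  from d(4) have d4: "?p dvd im u - im v" by (simp only: dvd_unit_mult[OF eps_unit])
  show "j \<pi> ^ m dvd u \<and> j \<pi> ^ m dvd v"
    unfolding dvd_coords using half[OF d(1,2)] half[OF d(3) d4] by (intro conjI) (erule conjE, assumption)+
next
  assume "j \<pi> ^ m dvd u \<and> j \<pi> ^ m dvd v"
  then show "entries_dvd (\<pi> ^ m) (cyc u v)"
    by (simp add: entries_dvd_def cyc_def forall_2 dvd_coords)
qed

subsection \<open>The inducing subgroup in these coordinates\<close>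

text \<open>Conjugation by this matrix carries the image of \<open>\<tau>\<close> to its companion matrix: the rows of \<open>h\<close> are
  \<open>(0, 1)\<close> and \<open>(0, 1)\<close> times the image of \<open>\<tau>\<close>, a cyclic basis because \<open>im \<tau>\<close> is a unit.\<close>

definition h :: "'o^2^2" where "h = mat2 0 1 (im \<tau>) (re \<tau>)"

lemma h_GL2: "h \<in> GL2"
  using im_tau by (simp add: GL2_iff h_def det_2)

lemma inv_h: "h ** matrix_inv h = mat 1" "matrix_inv h ** h = mat 1"
  using invertible_inverse h_GL2 by (auto simp: GL2_def)

definition conj_h :: "'o^2^2 \<Rightarrow> 'o^2^2" where "conj_h X = h ** X ** matrix_inv h"

lemma conj_h_mult: "conj_h X ** conj_h Y = conj_h (X ** Y)"
proof -
  have "conj_h X ** conj_h Y = h ** X ** (matrix_inv h ** h) ** Y ** matrix_inv h"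
    unfolding conj_h_def by (simp only: matrix_mul_assoc)
  then show ?thesis by (simp add: inv_h conj_h_def matrix_mul_assoc)
qed

lemma conj_h_eq_iff: "conj_h X = conj_h Y \<longleftrightarrow> X = Y"
proof
  assume "conj_h X = conj_h Y"
  then have "matrix_inv h ** conj_h X ** h = matrix_inv h ** conj_h Y ** h" by simp
  then have "(matrix_inv h ** h) ** X ** (matrix_inv h ** h) = (matrix_inv h ** h) ** Y ** (matrix_inv h ** h)"
    unfolding conj_h_def by (simp only: matrix_mul_assoc)
  then show "X = Y" by (simp add: inv_h)
qed simp

lemma conj_h_back: "conj_h (matrix_inv h ** X ** h) = X"
proof -
  have "conj_h (matrix_inv h ** X ** h) = (h ** matrix_inv h) ** X ** (h ** matrix_inv h)"
    unfolding conj_h_def by (simp only: matrix_mul_assoc)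
  then show ?thesis by (simp add: inv_h)
qed

lemma conj_h_cyc_surj: "\<exists>u v. X = conj_h (cyc u v)"
proof -
  obtain u v where "matrix_inv h ** X ** h = cyc u v" using cyc_surj by blast
  then have "X = conj_h (cyc u v)" using conj_h_back[of X] by simp
  then show ?thesis by (intro exI)
qed

lemma conj_h_one: "conj_h (mat 1) = mat 1"
  by (simp add: conj_h_def inv_h)

lemma conj_h_scalar: "conj_h (mat a) = mat a"
proof -
  have "conj_h (mat a) = mat a ** (h ** matrix_inv h)"
    unfolding conj_h_def mat_commute[of a h, symmetric] by (rule matrix_mul_assoc[symmetric])
  then show ?thesis by (simp add: inv_h)
qed

lemma conj_h_add: "conj_h X + conj_h Y = conj_h (X + Y)"
proof -
  have "(A + B) ** C = A ** C + B ** C" for A B C :: "'o^2^2"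
    by (simp add: vec_eq_iff matrix_matrix_mult_def distrib_right sum.distrib)
  then show ?thesis by (simp add: conj_h_def matrix_add_ldistrib)
qed

lemma conj_h_diff: "conj_h X - conj_h Y = conj_h (X - Y)"
  using conj_h_add[of "X - Y" Y] by (simp add: algebra_simps)

lemma trace_conj_h: "trace (conj_h X) = trace X"
  unfolding conj_h_def by (subst trace_mul_sym) (simp add: matrix_mul_assoc inv_h)

lemma det_conj_h: "det (conj_h X) = det X"
proof -
  have "det h * det (matrix_inv h) = 1" by (simp add: inv_h flip: det_mul)
  moreover have "det (conj_h X) = (det h * det (matrix_inv h)) * det X"
    by (simp add: conj_h_def det_mul ac_simps)
  ultimately show ?thesis by simp
qed

lemma conj_h_cyc_GL2: "conj_h (cyc u v) \<in> GL2 \<longleftrightarrow> nrm u - nrm v dvd 1"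
  by (simp add: GL2_iff det_conj_h det_cyc)

lemma entries_dvd_conj_h: "entries_dvd p (conj_h X) \<longleftrightarrow> entries_dvd p X"
proof
  assume "entries_dvd p (conj_h X)"
  then have "entries_dvd p (matrix_inv h ** conj_h X ** h)" by (rule entries_dvd_mult)
  also have "matrix_inv h ** conj_h X ** h = (matrix_inv h ** h) ** X ** (matrix_inv h ** h)"
    unfolding conj_h_def by (simp only: matrix_mul_assoc)
  finally show "entries_dvd p X" by (simp add: inv_h)
qed (simp add: conj_h_def entries_dvd_mult)

lemma beta_hat_cyc: "beta_hat j s \<tau> = conj_h (cyc \<tau> 0)"
proof -
  have tr: "inv j (\<tau> + s \<tau>) = 2 * re \<tau>"
  proof -
    have "\<tau> + s \<tau> = j (2 * re \<tau>)" by (simp add: eq_iff_coords)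
    then show ?thesis by simp
  qed
  have nm: "inv j (\<tau> * s \<tau>) = nrm \<tau>" by (simp flip: j_nrm)
  have "beta_hat j s \<tau> ** h = h ** cyc \<tau> 0"
    by (simp add: beta_hat_def tr nm h_def cyc_def mat2_mult mat2_eq_iff nrm_def algebra_simps)
  then have "beta_hat j s \<tau> ** h ** matrix_inv h = conj_h (cyc \<tau> 0)" by (simp add: conj_h_def)
  then show ?thesis by (simp add: inv_h flip: matrix_mul_assoc)
qed

lemma S_elt: "mat a + mat b ** beta_hat j s \<tau> = conj_h (cyc (j a + j b * \<tau>) 0)"
proof -
  have "mat a + mat b ** beta_hat j s \<tau> = conj_h (mat a) + conj_h (mat b) ** conj_h (cyc \<tau> 0)"
    by (simp only: conj_h_scalar beta_hat_cyc)
  also have "\<dots> = conj_h (cyc (j a + j b * \<tau>) 0)"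
    by (simp add: conj_h_mult conj_h_add cyc_scalar cyc_mult cyc_add)
  finally show ?thesis .
qed

lemma tau_generates: "\<exists>a b. z = j a + j b * \<tau>"
proof -
  let ?b = "im z * uinv (im \<tau>)"
  have "?b * im \<tau> = im z * (im \<tau> * uinv (im \<tau>))" by (simp only: ac_simps)
  then have "?b * im \<tau> = im z" by (simp add: mult_uinv[OF im_tau])
  then have "z = j (re z - ?b * re \<tau>) + j ?b * \<tau>" by (simp add: eq_iff_coords re_mult im_mult)
  then show ?thesis by (intro exI)
qed

lemma K_cong_cyc: "conj_h (cyc u v) \<in> K_cong \<pi> l \<longleftrightarrow> j \<pi> ^ l dvd u - 1 \<and> j \<pi> ^ l dvd v"
proof -
  have "conj_h (cyc u v) - mat 1 = conj_h (cyc (u - 1) v)"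
    by (subst conj_h_one[symmetric]) (simp only: conj_h_diff cyc_one cyc_diff diff_zero)
  then have "(\<forall>i k. \<pi> ^ l dvd (conj_h (cyc u v) - mat 1) $ i $ k) \<longleftrightarrow> j \<pi> ^ l dvd u - 1 \<and> j \<pi> ^ l dvd v"
    by (simp only: entries_dvd_def[symmetric] entries_dvd_conj_h entries_dvd_cyc)
  moreover have "conj_h (cyc u v) \<in> GL2" if "j \<pi> ^ l dvd u - 1" "j \<pi> ^ l dvd v"
  proof -
    have "1 + (u - 1) dvd 1" by (rule E.unit_add_pi[OF dvd_refl dvd_j_pi[OF l_pos that(1)]])
    then have "nrm u dvd 1" by (simp add: nrm_unit_iff)
    moreover have "\<pi> dvd nrm v" using dvd_j_pi[OF l_pos that(2)] by (simp add: pi_dvd_nrm)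
    ultimately show ?thesis unfolding conj_h_cyc_GL2 by (rule R.unit_diff_pi)
  qed
  ultimately show ?thesis unfolding K_cong_def by blast
qed

lemma cong_one_unit: "j \<pi> ^ l dvd u - 1 \<Longrightarrow> u dvd 1"
  using E.unit_add_pi[OF dvd_refl dvd_j_pi[OF l_pos, of "u - 1"]] by simp

abbreviation "T \<equiv> T_grp (beta_hat j s \<tau>) \<pi> l"

lemma S_grp_cyc: "X \<in> S_grp (beta_hat j s \<tau>) \<longleftrightarrow> (\<exists>z. z dvd 1 \<and> X = conj_h (cyc z 0))"
proof
  assume "X \<in> S_grp (beta_hat j s \<tau>)"
  then obtain a b where "X = conj_h (cyc (j a + j b * \<tau>) 0)" "X \<in> GL2" by (auto simp: S_grp_def S_elt)
  then show "\<exists>z. z dvd 1 \<and> X = conj_h (cyc z 0)"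
    by (intro exI[of _ "j a + j b * \<tau>"]) (simp add: conj_h_cyc_GL2 nrm_unit_iff nrm_def[of 0])
next
  assume "\<exists>z. z dvd 1 \<and> X = conj_h (cyc z 0)"
  then obtain z where z: "z dvd 1" "X = conj_h (cyc z 0)" by blast
  obtain a b where ab: "z = j a + j b * \<tau>" using tau_generates by blast
  have "X = mat a + mat b ** beta_hat j s \<tau>" unfolding S_elt z(2) ab ..
  moreover have "X \<in> GL2" using z by (simp add: conj_h_cyc_GL2 nrm_unit_iff nrm_def[of 0])
  ultimately show "X \<in> S_grp (beta_hat j s \<tau>)" unfolding S_grp_def by blast
qed

text \<open>A product \<open>z (k\<^sub>1 + k\<^sub>2 w)\<close> with \<open>z\<close> a unit, \<open>k\<^sub>1\<close> congruent to 1 and \<open>k\<^sub>2\<close> to 0 modulo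
  \<open>\<pi>\<^sup>l\<close> has \<open>z k\<^sub>1\<close> and \<open>z k\<^sub>2\<close> as its components; conversely \<open>z = u\<close> always works.\<close>

lemma T_cyc: "conj_h (cyc u v) \<in> T \<longleftrightarrow> u dvd 1 \<and> j \<pi> ^ l dvd v"
proof
  assume "conj_h (cyc u v) \<in> T"
  then obtain x k where x: "x \<in> S_grp (beta_hat j s \<tau>)" and k: "k \<in> K_cong \<pi> l" and eq: "conj_h (cyc u v) = x ** k"
    by (auto simp: T_grp_def)
  obtain z where z: "z dvd 1" "x = conj_h (cyc z 0)" using x S_grp_cyc by blast
  obtain k1 k2 where k12: "k = conj_h (cyc k1 k2)" using conj_h_cyc_surj by blast
  have "j \<pi> ^ l dvd k1 - 1" "j \<pi> ^ l dvd k2" using k by (simp_all add: k12 K_cong_cyc)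
  moreover have "u = z * k1" "v = z * k2"
    using eq by (simp_all add: z(2) k12 conj_h_mult conj_h_eq_iff cyc_mult cyc_eq_iff)
  ultimately show "u dvd 1 \<and> j \<pi> ^ l dvd v" using z(1) by (simp add: unit_mult_iff cong_one_unit)
next
  assume uv: "u dvd 1 \<and> j \<pi> ^ l dvd v"
  have "conj_h (cyc u v) = conj_h (cyc u 0) ** conj_h (cyc 1 (uinv u * v))"
    using mult_uinv[of u] uv by (simp add: conj_h_mult cyc_mult flip: mult.assoc)
  moreover have "conj_h (cyc u 0) \<in> S_grp (beta_hat j s \<tau>)" unfolding S_grp_cyc using uv by blast
  moreover have "conj_h (cyc 1 (uinv u * v)) \<in> K_cong \<pi> l" using uv by (simp add: K_cong_cyc)
  ultimately show "conj_h (cyc u v) \<in> T" unfolding T_grp_def by blast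
qed

abbreviation "\<theta> \<equiv> box_char j s c \<pi> l \<nu> \<nu>' \<tau>"

text \<open>In a factorization \<open>z (k\<^sub>1 + k\<^sub>2 w)\<close> the trace of \<open>\<tau> (k\<^sub>1 - 1 + k\<^sub>2 w)\<close> does not see
  \<open>k\<^sub>2\<close>, so the second factor contributes \<open>\<psi> (Tr (\<tau> (k\<^sub>1 - 1))) = \<mu> k\<^sub>1\<close>. The value is therefore
  \<open>\<mu> (z k\<^sub>1) = \<mu> u\<close>, whatever the factorization.\<close>

lemma box_char_cyc:
  assumes u: "u dvd 1" and v: "j \<pi> ^ l dvd v"
  shows "\<theta> (conj_h (cyc u v)) = \<mu> u"
  unfolding box_char_def
proof (rule the_equality)
  have sz: "s (j a + j b * \<tau>) = j a + j b * s \<tau>" for a b by (simp add: s_add s_mult)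
  have tr: "trace (beta_hat j s \<tau> ** (conj_h (cyc k1 k2) - mat 1)) = 2 * re (\<tau> * (k1 - 1))" for k1 k2
  proof -
    have "conj_h (cyc k1 k2) - mat 1 = conj_h (cyc (k1 - 1) k2)"
      by (subst conj_h_one[symmetric]) (simp only: conj_h_diff cyc_one cyc_diff diff_zero)
    then show ?thesis by (simp add: beta_hat_cyc conj_h_mult cyc_mult trace_conj_h trace_cyc)
  qed
  have val: "\<nu> (j a + j b * \<tau>) * \<nu>' (j a + j b * s \<tau>) * c (trace (beta_hat j s \<tau> ** (k - mat 1))) = \<mu> u"
    if k: "k \<in> K_cong \<pi> l" and ab: "mat a + mat b ** beta_hat j s \<tau> \<in> GL2"
      and eq: "conj_h (cyc u v) = (mat a + mat b ** beta_hat j s \<tau>) ** k" for a b k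
  proof -
    let ?z = "j a + j b * \<tau>"
    obtain k1 k2 where k12: "k = conj_h (cyc k1 k2)" using conj_h_cyc_surj by blast
    have d: "j \<pi> ^ l dvd k1 - 1" using k by (simp add: k12 K_cong_cyc)
    have z: "?z dvd 1" using ab by (simp add: S_elt conj_h_cyc_GL2 nrm_unit_iff nrm_def[of 0])
    have "u = ?z * k1" using eq unfolding S_elt k12 conj_h_mult conj_h_eq_iff cyc_mult cyc_eq_iff by simp
    then have "\<mu> u = \<mu> ?z * \<mu> (1 + (k1 - 1))" using mu_mult[OF z cong_one_unit[OF d]] by simp
    then show ?thesis unfolding k12 tr mu_cong[OF d] mu_eq[of ?z] sz by simp
  qed
  obtain a b where ab: "u = j a + j b * \<tau>" using tau_generates by blast
  have 1: "mat a + mat b ** beta_hat j s \<tau> \<in> GL2"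
    using u by (simp add: S_elt ab[symmetric] conj_h_cyc_GL2 nrm_unit_iff nrm_def[of 0])
  have 2: "conj_h (cyc 1 (uinv u * v)) \<in> K_cong \<pi> l" using v by (simp add: K_cong_cyc)
  have 3: "conj_h (cyc u v) = (mat a + mat b ** beta_hat j s \<tau>) ** conj_h (cyc 1 (uinv u * v))"
    using mult_uinv[OF u] by (simp add: S_elt ab[symmetric] conj_h_mult cyc_mult flip: mult.assoc)
  show "\<exists>a b k. mat a + mat b ** beta_hat j s \<tau> \<in> GL2 \<and> k \<in> K_cong \<pi> l \<and>
      conj_h (cyc u v) = (mat a + mat b ** beta_hat j s \<tau>) ** k \<and>
      \<mu> u = \<nu> (j a + j b * \<tau>) * \<nu>' (j a + j b * s \<tau>) * c (trace (beta_hat j s \<tau> ** (k - mat 1)))"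
    using 1 2 3 val[OF 2 1 3, symmetric] by blast
  show "y = \<mu> u" if "\<exists>a b k. mat a + mat b ** beta_hat j s \<tau> \<in> GL2 \<and> k \<in> K_cong \<pi> l \<and>
      conj_h (cyc u v) = (mat a + mat b ** beta_hat j s \<tau>) ** k \<and>
      y = \<nu> (j a + j b * \<tau>) * \<nu>' (j a + j b * s \<tau>) * c (trace (beta_hat j s \<tau> ** (k - mat 1)))" for y
    using that val by blast
qed

lemma card_T: "card T = card {u::'oe. u dvd 1} * q ^ r"
proof -
  have "bij_betw (\<lambda>(u, v). conj_h (cyc u v)) ({u. u dvd 1} \<times> {v. j \<pi> ^ l dvd v}) T"
    unfolding bij_betw_def
  proof
    show "inj_on (\<lambda>(u, v). conj_h (cyc u v)) ({u. u dvd 1} \<times> {v. j \<pi> ^ l dvd v})"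
      by (auto simp: inj_on_def conj_h_eq_iff cyc_eq_iff)
    show "(\<lambda>(u, v). conj_h (cyc u v)) ` ({u. u dvd 1} \<times> {v. j \<pi> ^ l dvd v}) = T"
    proof (intro equalityI subsetI)
      fix t assume t: "t \<in> T"
      obtain u v where uv: "t = conj_h (cyc u v)" using conj_h_cyc_surj by blast
      show "t \<in> (\<lambda>(u, v). conj_h (cyc u v)) ` ({u. u dvd 1} \<times> {v. j \<pi> ^ l dvd v})"
        using t unfolding uv T_cyc by (intro image_eqI[of _ _ "(u, v)"]) simp_all
    qed (auto simp: T_cyc)
  qed
  from bij_betw_same_card[OF this]
  have "card T = card {u::'oe. u dvd 1} * card {v. j \<pi> ^ l dvd v}" by (simp add: card_cartesian_product)
  also have "card {v. j \<pi> ^ l dvd v} = q ^ r"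
    using E.card_ideal[OF l_le] by (simp add: qE_eq r_eq flip: power_mult)
  finally show ?thesis .
qed

text \<open>Hence \<open>(u + v w)(u' + v' w)\<close> has first component \<open>u u'\<close> on \<open>T\<close>, which makes \<open>\<theta>\<close>
  multiplicative there. It is here that \<open>r = 2 l\<close> enters.\<close>

lemma product_cong:
  assumes "j \<pi> ^ l dvd v" "j \<pi> ^ l dvd v'" shows "v * s v' = 0"
proof -
  have "j \<pi> ^ l * j \<pi> ^ l dvd v * s v'" using assms by (intro mult_dvd_mono) (simp_all add: dvd_s)
  moreover have "j \<pi> ^ l * j \<pi> ^ l = 0" using E.pi_top by (simp add: r_eq mult_2 power_add)
  ultimately show ?thesis by simp
qed

text \<open>Group elements are written as \<open>x = h (u + v w)\<close>, so that \<open>h\<close> accounts for the conjugation between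
  \<open>T\<close> and its model, and \<open>x g x\<inverse>\<close> is the image of \<open>(u + v w) g (u + v w)\<inverse>\<close>.\<close>

theorem cuspidal_character:
  assumes b: "\<beta> dvd 1" and i: "i < r" and g: "elt \<alpha> \<beta> i 1 dvd 1"
  shows "subspace_trace (ind_space T \<theta>) (ind_action (cyc (elt \<alpha> \<beta> i 1) 0))
    = (- of_nat q) ^ i * (\<mu> (elt \<alpha> \<beta> i 1) + \<mu> (elt \<alpha> \<beta> i (- 1)))"
proof -
  let ?z = "elt \<alpha> \<beta> i 1" and ?g = "cyc (elt \<alpha> \<beta> i 1) 0"
  have T_elem: "\<exists>u v. t = conj_h (cyc u v) \<and> u dvd 1 \<and> j \<pi> ^ l dvd v" if tT: "t \<in> T" for t
  proof -
    obtain u v where "t = conj_h (cyc u v)" using conj_h_cyc_surj by blast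
    then show ?thesis using tT T_cyc by blast
  qed
  have diff_unit: "nrm u - nrm v dvd 1" if "u dvd 1" "j \<pi> ^ l dvd v" for u v
  proof -
    have "nrm u dvd 1" "\<pi> dvd nrm v"
      using that dvd_j_pi[OF l_pos] by (simp_all add: nrm_unit_iff pi_dvd_nrm)
    then show ?thesis by (rule R.unit_diff_pi)
  qed
  have TG: "T \<subseteq> GL2"
  proof
    fix t assume "t \<in> T"
    then show "t \<in> GL2" using T_elem[of t] diff_unit by (auto simp: conj_h_cyc_GL2)
  qed
  have T1: "mat 1 \<in> T"
  proof -
    have "conj_h (cyc 1 0) \<in> T" by (simp add: T_cyc)
    then show ?thesis by (simp only: cyc_one[symmetric] conj_h_one)
  qed
  have TT: "t ** t' \<in> T \<and> \<theta> (t ** t') = \<theta> t * \<theta> t'" if tT: "t \<in> T" "t' \<in> T" for t t'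
  proof -
    obtain u v where t: "t = conj_h (cyc u v)" "u dvd 1" "j \<pi> ^ l dvd v" using T_elem[OF tT(1)] by blast
    obtain u' v' where t': "t' = conj_h (cyc u' v')" "u' dvd 1" "j \<pi> ^ l dvd v'" using T_elem[OF tT(2)] by blast
    have p: "t ** t' = conj_h (cyc (u * u') (u * v' + v * s u'))"
      by (simp add: t(1) t'(1) conj_h_mult cyc_mult product_cong[OF t(3) t'(3)])
    have d: "j \<pi> ^ l dvd u * v' + v * s u'"
      by (rule dvd_add[OF dvd_mult[OF t'(3)] dvd_mult2[OF t(3)]])
    have uu: "u * u' dvd 1" using t t' by (simp add: unit_mult_iff)
    have "t ** t' \<in> T" unfolding p T_cyc using uu d by simp
    moreover have "\<theta> (t ** t') = \<mu> (u * u')" unfolding p by (rule box_char_cyc[OF uu d])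
    moreover have "\<theta> t = \<mu> u" unfolding t(1) by (rule box_char_cyc[OF t(2,3)])
    moreover have "\<theta> t' = \<mu> u'" unfolding t'(1) by (rule box_char_cyc[OF t'(2,3)])
    ultimately show ?thesis by (simp only: mu_mult[OF t(2) t'(2)])
  qed
  have inv_conj_h: "matrix_inv (conj_h X) = conj_h (matrix_inv X)" if "X \<in> GL2" for X
    by (rule matrix_inv_eqI)
       (use that invertible_inverse[of X] in \<open>simp_all add: GL2_def conj_h_mult conj_h_one\<close>)
  have TI: "matrix_inv t \<in> T" if tT: "t \<in> T" for t
  proof -
    obtain u v where t: "t = conj_h (cyc u v)" "u dvd 1" "j \<pi> ^ l dvd v" using T_elem[OF tT] by blast
    have D: "nrm u - nrm v dvd 1" by (rule diff_unit[OF t(2,3)])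
    have "s u * j (uinv (nrm u - nrm v)) dvd 1"
      using t(2) D by (simp add: unit_mult_iff s_unit j_unit unit_uinv)
    then show ?thesis using t(3) unfolding t(1) inv_conj_h[OF inv_cyc(2)[OF D]] inv_cyc(1)[OF D] T_cyc by simp
  qed
  have g_GL2: "?g \<in> GL2" using g by (simp add: GL2_cyc nrm_unit_iff nrm_def[of 0])
  let ?P = "{(u, v). nrm u - nrm v dvd 1 \<and> j \<pi> ^ l dvd j \<pi> ^ i * (u * v)}"
  have conj: "(h ** cyc u v) ** ?g ** matrix_inv (h ** cyc u v)
      = conj_h (cyc (elt \<alpha> \<beta> i (ratio u v)) (- 2 * j \<beta> * \<Phi> * j (uinv (nrm u - nrm v)) * (j \<pi> ^ i * (u * v))))"
    if D: "nrm u - nrm v dvd 1" for u v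
  proof -
    let ?D = "nrm u - nrm v" and ?d = "j (uinv (nrm u - nrm v))" and ?B = "j (\<pi> ^ i * \<beta>) * \<Phi>"
    have z: "?z = j \<alpha> + ?B" by (simp add: elt_def)
    have sz: "s ?z = j \<alpha> - ?B" by (simp add: z s_add s_mult)
    have inv_hQ: "matrix_inv (h ** cyc u v) = matrix_inv (cyc u v) ** matrix_inv h"
      using matrix_inv_mult[of h "cyc u v"] inv_cyc(2)[OF D] h_GL2 by (simp add: GL2_def)
    have "(h ** cyc u v) ** ?g ** matrix_inv (h ** cyc u v) = conj_h (cyc u v ** ?g ** matrix_inv (cyc u v))"
      unfolding inv_hQ conj_h_def by (simp only: matrix_mul_assoc)
    also have "cyc u v ** ?g ** matrix_inv (cyc u v)
        = cyc (u * ?z * (s u * ?d) + v * s ?z * s (- (v * ?d))) (u * ?z * (- (v * ?d)) + v * s ?z * s (s u * ?d))"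
      unfolding inv_cyc(1)[OF D] cyc_mult by simp
    also have "u * ?z * (s u * ?d) + v * s ?z * s (- (v * ?d)) = elt \<alpha> \<beta> i (ratio u v)"
    proof -
      have "u * ?z * (s u * ?d) + v * s ?z * s (- (v * ?d)) = (?z * (u * s u) - s ?z * (v * s v)) * ?d"
        by (simp add: s_minus s_mult algebra_simps)
      also have "\<dots> = ((j \<alpha> + ?B) * j (nrm u) - (j \<alpha> - ?B) * j (nrm v)) * ?d"
        unfolding j_nrm sz unfolding z ..
      also have "\<dots> = j \<alpha> * j (?D * uinv ?D) + ?B * j ((nrm u + nrm v) * uinv ?D)"
        by (simp only: j_mult j_diff j_add) (simp add: algebra_simps)
      also have "\<dots> = elt \<alpha> \<beta> i (ratio u v)"
        unfolding mult_uinv[OF D] by (simp add: elt_def ratio_def j_add j_mult algebra_simps)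
      finally show ?thesis .
    qed
    also have "u * ?z * (- (v * ?d)) + v * s ?z * s (s u * ?d) = - 2 * j \<beta> * \<Phi> * ?d * (j \<pi> ^ i * (u * v))"
      unfolding sz unfolding z by (simp add: s_mult j_mult j_power algebra_simps)
    finally show ?thesis .
  qed
  have key: "(h ** cyc u v) ** ?g ** matrix_inv (h ** cyc u v) \<in> T \<longleftrightarrow> j \<pi> ^ l dvd j \<pi> ^ i * (u * v)"
      "j \<pi> ^ l dvd j \<pi> ^ i * (u * v) \<Longrightarrow> \<theta> ((h ** cyc u v) ** ?g ** matrix_inv (h ** cyc u v)) = \<mu> (elt \<alpha> \<beta> i (ratio u v))"
    if D: "nrm u - nrm v dvd 1" for u v
  proof -
    let ?e = "- 2 * j \<beta> * \<Phi> * j (uinv (nrm u - nrm v))" and ?w = "j \<pi> ^ i * (u * v)"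
    have "\<Phi> dvd 1" using j_unit[OF eps_unit] by (simp add: unit_mult_iff flip: Phi_sq)
    then have e: "?e dvd 1" using D b E_two_unit by (simp add: unit_mult_iff j_unit unit_uinv)
    have d: "j \<pi> ^ l dvd ?e * ?w \<longleftrightarrow> j \<pi> ^ l dvd ?w" by (rule dvd_unit_mult[OF e])
    have hQ: "h ** cyc u v \<in> GL2" by (rule GL2_mult[OF h_GL2 inv_cyc(2)[OF D]])
    then have ihQ: "matrix_inv (h ** cyc u v) \<in> GL2" using invertible_inverse(3) by (simp add: GL2_def)
    have "(h ** cyc u v) ** ?g ** matrix_inv (h ** cyc u v) \<in> GL2"
      by (rule GL2_mult[OF GL2_mult[OF hQ g_GL2] ihQ])
    then have D': "nrm (elt \<alpha> \<beta> i (ratio u v)) - nrm (?e * ?w) dvd 1"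
      unfolding conj[OF D] conj_h_cyc_GL2 .
    \<comment> \<open>The determinant \<open>N u' - N v'\<close> of a conjugate \<open>u' + v' w\<close> of \<open>g\<close> is a unit; with \<open>\<pi> | v'\<close> so is \<open>u'\<close>.\<close>
    have unit: "elt \<alpha> \<beta> i (ratio u v) dvd 1" if "j \<pi> ^ l dvd ?w"
    proof -
      have "j \<pi> dvd ?e * ?w" by (rule dvd_j_pi[OF l_pos]) (simp only: d that)
      then have "\<pi> dvd nrm (?e * ?w)" by (simp only: pi_dvd_nrm)
      from R.unit_add_pi[OF D' this] show ?thesis by (simp add: nrm_unit_iff)
    qed
    show "(h ** cyc u v) ** ?g ** matrix_inv (h ** cyc u v) \<in> T \<longleftrightarrow> j \<pi> ^ l dvd ?w"
      unfolding conj[OF D] T_cyc d using unit by blast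
    assume w: "j \<pi> ^ l dvd ?w"
    show "\<theta> ((h ** cyc u v) ** ?g ** matrix_inv (h ** cyc u v)) = \<mu> (elt \<alpha> \<beta> i (ratio u v))"
      unfolding conj[OF D] by (rule box_char_cyc[OF unit[OF w]]) (simp only: d w)
  qed
  have "of_nat (card T) * subspace_trace (ind_space T \<theta>) (ind_action ?g)
      = (\<Sum>x | x \<in> GL2 \<and> x ** ?g ** matrix_inv x \<in> T. \<theta> (x ** ?g ** matrix_inv x))"
    by (rule induced_trace[OF finite_mat2[OF R.finite_ring] TG T1]) (use TT TI g_GL2 in blast)+
  also have "\<dots> = (\<Sum>(u, v)\<in>?P. \<mu> (elt \<alpha> \<beta> i (ratio u v)))"
  proof -
    have bij: "bij_betw (\<lambda>p. h ** cyc (fst p) (snd p)) ?P {x. x \<in> GL2 \<and> x ** ?g ** matrix_inv x \<in> T}"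
      unfolding bij_betw_def
    proof
      show "inj_on (\<lambda>p. h ** cyc (fst p) (snd p)) ?P"
      proof (rule inj_onI)
        fix p p' :: "'oe \<times> 'oe" assume "h ** cyc (fst p) (snd p) = h ** cyc (fst p') (snd p')"
        then have "conj_h (cyc (fst p) (snd p)) = conj_h (cyc (fst p') (snd p'))" by (simp add: conj_h_def)
        then show "p = p'" by (simp add: conj_h_eq_iff cyc_eq_iff prod_eq_iff)
      qed
      show "(\<lambda>p. h ** cyc (fst p) (snd p)) ` ?P = {x. x \<in> GL2 \<and> x ** ?g ** matrix_inv x \<in> T}"
      proof (intro equalityI subsetI)
        fix x assume "x \<in> (\<lambda>p. h ** cyc (fst p) (snd p)) ` ?P"
        then obtain u v where "nrm u - nrm v dvd 1" "j \<pi> ^ l dvd j \<pi> ^ i * (u * v)" "x = h ** cyc u v" by auto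
        then show "x \<in> {x. x \<in> GL2 \<and> x ** ?g ** matrix_inv x \<in> T}"
          using key(1) GL2_mult[OF h_GL2 inv_cyc(2)] by simp
      next
        fix x assume x: "x \<in> {x. x \<in> GL2 \<and> x ** ?g ** matrix_inv x \<in> T}"
        obtain u v where uv: "matrix_inv h ** x = cyc u v" using cyc_surj by blast
        have "h ** (matrix_inv h ** x) = x" by (simp add: matrix_mul_assoc inv_h)
        then have xq: "x = h ** cyc u v" unfolding uv by simp
        have "det h * (nrm u - nrm v) dvd 1" using x unfolding xq by (simp add: GL2_iff det_mul det_cyc)
        then have D: "nrm u - nrm v dvd 1" by (simp add: unit_mult_iff)
        then have "(u, v) \<in> ?P" using x key(1)[OF D] unfolding xq by simp
        then show "x \<in> (\<lambda>p. h ** cyc (fst p) (snd p)) ` ?P"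
          by (intro image_eqI[of _ _ "(u, v)"]) (simp_all add: xq)
      qed
    qed
    have "(\<Sum>x | x \<in> GL2 \<and> x ** ?g ** matrix_inv x \<in> T. \<theta> (x ** ?g ** matrix_inv x))
        = (\<Sum>p\<in>?P. \<theta> ((h ** cyc (fst p) (snd p)) ** ?g ** matrix_inv (h ** cyc (fst p) (snd p))))"
      by (rule sum.reindex_bij_betw[OF bij, symmetric])
    also have "\<dots> = (\<Sum>(u, v)\<in>?P. \<mu> (elt \<alpha> \<beta> i (ratio u v)))"
      by (rule sum.cong[OF refl]) (use key(2) in auto)
    finally show ?thesis .
  qed
  also have "\<dots> = of_nat (card T) * ((- of_nat q) ^ i * (\<mu> ?z + \<mu> (elt \<alpha> \<beta> i (- 1))))"
    unfolding card_T by (rule orbit_sum[OF g b i])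
  finally show ?thesis
    using E.units_nonempty R.q_pos by (simp only: mult_cancel_left card_T) simp
qed

end

section \<open>Quotients of the valuation ring\<close>

context nonarch_local_field
begin

lemma val_one [simp]: "v 1 = 0"
  using val_mult[of 1 1] by simp

lemma val_minus [simp]: "v (- x) = v x"
proof (cases "x = 0")
  case False
  have "v (- 1) + v (- 1) = 0" using val_mult[of "- 1" "- 1"] by simp
  then show ?thesis using val_mult[of "- 1" x] False by simp
qed simp

lemma val_inverse: "x \<noteq> 0 \<Longrightarrow> v (inverse x) = - v x"
  using val_mult[of x "inverse x"] by simp

lemma val_divide: "x \<noteq> 0 \<Longrightarrow> y \<noteq> 0 \<Longrightarrow> v (x / y) = v x - v y"
  by (simp add: divide_inverse val_mult val_inverse)

lemma val_power: "x \<noteq> 0 \<Longrightarrow> v (x ^ n) = int n * v x"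
  by (induction n) (simp_all add: val_mult algebra_simps)

lemma ideal_0 [simp]: "0 \<in> val_ideal v n"
  by (simp add: val_ideal_def)

lemma ring_1 [simp]: "1 \<in> val_ring v"
  by (simp add: val_ideal_def)

lemma ideal_add: "x \<in> val_ideal v n \<Longrightarrow> y \<in> val_ideal v n \<Longrightarrow> x + y \<in> val_ideal v n"
  using val_add[of x y] by (cases "x = 0 \<or> y = 0 \<or> x + y = 0") (auto simp: val_ideal_def)

lemma ideal_minus: "x \<in> val_ideal v n \<Longrightarrow> - x \<in> val_ideal v n"
  by (auto simp: val_ideal_def)

lemma ideal_diff: "x \<in> val_ideal v n \<Longrightarrow> y \<in> val_ideal v n \<Longrightarrow> x - y \<in> val_ideal v n"
  using ideal_add[OF _ ideal_minus, of x n y] by simp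

lemma ideal_mult: "x \<in> val_ideal v m \<Longrightarrow> y \<in> val_ideal v n \<Longrightarrow> x * y \<in> val_ideal v (m + n)"
  using val_mult[of x y] by (cases "x = 0 \<or> y = 0") (auto simp: val_ideal_def)

lemma ring_mult: "x \<in> val_ring v \<Longrightarrow> y \<in> val_ring v \<Longrightarrow> x * y \<in> val_ring v"
  using ideal_mult[of x 0 y 0] by simp

lemma ring_power: "x \<in> val_ring v \<Longrightarrow> x ^ n \<in> val_ring v"
  by (induction n) (simp_all add: ring_mult)

lemma uniformizer_ring: "uniformizer v p \<Longrightarrow> p \<in> val_ring v"
  by (simp add: uniformizer_def val_ideal_def)

lemma uniformizer_power_mem:
  assumes "uniformizer v p"
  shows "{p ^ n * x | x. x \<in> val_ring v} = val_ideal v (int n)"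
proof (intro equalityI subsetI)
  fix y assume "y \<in> {p ^ n * x | x. x \<in> val_ring v}"
  then obtain x where "y = p ^ n * x" "x \<in> val_ring v" by blast
  moreover have "p ^ n \<in> val_ideal v (int n)" using assms by (simp add: val_ideal_def uniformizer_def val_power)
  ultimately show "y \<in> val_ideal v (int n)" using ideal_mult[of "p ^ n" "int n" x 0] by simp
next
  fix y assume y: "y \<in> val_ideal v (int n)"
  have p: "p \<noteq> 0" "v (p ^ n) = int n" using assms by (simp_all add: uniformizer_def val_power)
  have "y / p ^ n \<in> val_ring v"
    using y p by (cases "y = 0") (auto simp: val_ideal_def val_divide)
  moreover have "y = p ^ n * (y / p ^ n)" using p by simp
  ultimately show "y \<in> {p ^ n * x | x. x \<in> val_ring v}" by blast
qed

text \<open>The fibres of such an \<open>f\<close> are the residue classes.\<close>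

lemma card_residue_field:
  assumes "\<And>x y. x \<in> val_ring v \<Longrightarrow> y \<in> val_ring v \<Longrightarrow> f x = f y \<longleftrightarrow> x - y \<in> val_ideal v 1"
  shows "card (residue_field v) = card (f ` val_ring v)"
proof -
  let ?g = "\<lambda>b. {y \<in> val_ring v. b = f y}"
  have "residue_field v = (\<lambda>x. ?g (f x)) ` val_ring v"
    unfolding residue_field_def quotient_def using assms by (auto simp: Image_def)
  then have "residue_field v = ?g ` f ` val_ring v" by (simp add: image_image)
  moreover have "inj_on ?g (f ` val_ring v)"
  proof (rule inj_onI)
    fix b b' assume b: "b \<in> f ` val_ring v" "b' \<in> f ` val_ring v" and eq: "?g b = ?g b'"
    from b obtain x where x: "x \<in> val_ring v" "b = f x" by blast
    then have "x \<in> ?g b'" using eq by blast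
    then show "b = b'" using x by simp
  qed
  ultimately show ?thesis by (simp add: card_image)
qed

end

text \<open>Both \<open>\<O>\<^sub>r\<close> and \<open>\<O>\<^sub>r\<^sup>E\<close> are instances, since \<open>\<iota> \<omega>\<close> is a uniformizer of \<open>E\<close>.\<close>

locale val_ring_quotient = nonarch_local_field v
  for v :: "'f::field \<Rightarrow> int" +
  fixes p :: 'f and r :: nat and P :: "'f \<Rightarrow> 'o::comm_ring_1"
  assumes unif: "uniformizer v p" and exponent_pos: "0 < r"
    and quot: "ring_quotient_map (val_ring v) {p ^ r * x | x. x \<in> val_ring v} P"
begin

lemma P_1 [simp]: "P 1 = 1"
  and P_add: "x \<in> val_ring v \<Longrightarrow> y \<in> val_ring v \<Longrightarrow> P (x + y) = P x + P y"
  and P_mult: "x \<in> val_ring v \<Longrightarrow> y \<in> val_ring v \<Longrightarrow> P (x * y) = P x * P y"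
  using quot by (auto simp: ring_quotient_map_def)

lemma P_surj: "\<exists>x\<in>val_ring v. P x = a"
proof -
  have "a \<in> P ` val_ring v" using quot by (simp add: ring_quotient_map_def)
  then show ?thesis by blast
qed

lemma P_eq_0: "x \<in> val_ring v \<Longrightarrow> P x = 0 \<longleftrightarrow> x \<in> val_ideal v (int r)"
proof -
  have "{x \<in> val_ring v. P x = 0} = val_ideal v (int r)"
    using quot unfolding uniformizer_power_mem[OF unif] by (simp add: ring_quotient_map_def)
  then show "x \<in> val_ring v \<Longrightarrow> P x = 0 \<longleftrightarrow> x \<in> val_ideal v (int r)" by blast
qed

lemma P_0 [simp]: "P 0 = 0"
  using P_eq_0[of 0] by simp

lemma P_minus: "x \<in> val_ring v \<Longrightarrow> P (- x) = - P x"
  using P_add[of x "- x"] ideal_minus[of x 0] by (simp add: eq_neg_iff_add_eq_0 add.commute)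

lemma P_diff: "x \<in> val_ring v \<Longrightarrow> y \<in> val_ring v \<Longrightarrow> P (x - y) = P x - P y"
  using P_add[of x "- y"] ideal_minus[of y 0] by (simp add: P_minus)

lemma P_power: "x \<in> val_ring v \<Longrightarrow> P (x ^ n) = P x ^ n"
  by (induction n) (simp_all add: P_mult ring_power)

lemma p_ring: "p \<in> val_ring v"
  by (rule uniformizer_ring[OF unif])

lemma P_dvd: "x \<in> val_ideal v 1 \<Longrightarrow> P p dvd P x"
proof -
  assume "x \<in> val_ideal v 1"
  then have "x \<in> {p ^ 1 * y | y. y \<in> val_ring v}"
    using uniformizer_power_mem[OF unif, of 1] by simp
  then obtain y where "x = p * y" "y \<in> val_ring v" by auto
  then show ?thesis by (simp add: P_mult p_ring)
qed

lemma P_unit: "x \<in> val_ring v \<Longrightarrow> x \<notin> val_ideal v 1 \<Longrightarrow> P x dvd 1"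
proof -
  assume x: "x \<in> val_ring v" "x \<notin> val_ideal v 1"
  then have "x \<noteq> 0" "v x = 0" by (auto simp: val_ideal_def)
  then have i: "inverse x \<in> val_ring v" "x * inverse x = 1" by (simp_all add: val_ideal_def val_inverse)
  then have "P x * P (inverse x) = 1" using P_mult[OF x(1) i(1)] by simp
  then show ?thesis by (intro dvdI[of _ _ "P (inverse x)"]) simp
qed

lemma P_dvd_iff: "x \<in> val_ring v \<Longrightarrow> P p dvd P x \<longleftrightarrow> x \<in> val_ideal v 1"
proof
  assume x: "x \<in> val_ring v" and d: "P p dvd P x"
  from d obtain b where b: "P x = P p * b" by (elim dvdE)
  obtain y where y: "y \<in> val_ring v" "P y = b" using P_surj by blast
  have py: "p * y \<in> val_ring v" by (rule ring_mult[OF p_ring y(1)])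
  have "P (x - p * y) = 0" using x y b py by (simp add: P_diff P_mult p_ring)
  then have "x - p * y \<in> val_ideal v (int r)" using P_eq_0[OF ideal_diff[OF x py]] by simp
  then have "x - p * y \<in> val_ideal v 1" using exponent_pos by (auto simp: val_ideal_def)
  moreover have "p * y \<in> val_ideal v 1"
    using ideal_mult[of p 1 y 0] unif y by (simp add: val_ideal_def uniformizer_def)
  ultimately have "(x - p * y) + p * y \<in> val_ideal v 1" by (rule ideal_add)
  then show "x \<in> val_ideal v 1" by simp
qed (rule P_dvd)

text \<open>Finitely many representatives of the residue field are the digits of \<open>\<pi>\<close>-adic expansions of length
  \<open>r\<close>.\<close>

lemma finite_quotient: "finite (UNIV :: 'o set)"
proof -
  let ?\<pi> = "P p"
  define D0 where "D0 = P ` (\<lambda>X. SOME x. x \<in> X) ` residue_field v"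
  have fin0: "finite D0" unfolding D0_def by (intro finite_imageI finite_residue_field)
  have D0: "\<exists>d\<in>D0. ?\<pi> dvd a - d" for a
  proof -
    obtain x where x: "x \<in> val_ring v" "P x = a" using P_surj by blast
    let ?R = "{(x, y). x \<in> val_ring v \<and> y \<in> val_ring v \<and> x - y \<in> val_ideal v 1}"
    let ?X = "?R `` {x}"
    have X: "?X \<in> residue_field v" unfolding residue_field_def by (rule quotientI[OF x(1)])
    have "x \<in> ?X" using x by simp
    then have "(SOME y. y \<in> ?X) \<in> ?X" by (rule someI)
    then have y: "(SOME y. y \<in> ?X) \<in> val_ring v" "x - (SOME y. y \<in> ?X) \<in> val_ideal v 1" by auto
    have "?\<pi> dvd P (x - (SOME y. y \<in> ?X))" by (rule P_dvd[OF y(2)])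
    then have "?\<pi> dvd a - P (SOME y. y \<in> ?X)" by (simp only: P_diff[OF x(1) y(1)] x(2))
    moreover have "P (SOME y. y \<in> ?X) \<in> D0" unfolding D0_def using X by blast
    ultimately show ?thesis by blast
  qed
  have "\<exists>D. finite D \<and> (\<forall>a. \<exists>d\<in>D. ?\<pi> ^ k dvd a - d)" for k
  proof (induction k)
    case (Suc k)
    then obtain D where D: "finite D" "\<And>a. \<exists>d\<in>D. ?\<pi> ^ k dvd a - d" by blast
    let ?D = "(\<lambda>(d, e). d + ?\<pi> ^ k * e) ` (D \<times> D0)"
    have "\<exists>d\<in>?D. ?\<pi> ^ Suc k dvd a - d" for a
    proof -
      obtain d where d: "d \<in> D" "?\<pi> ^ k dvd a - d" using D(2) by blast
      then obtain b where b: "a - d = ?\<pi> ^ k * b" by (elim dvdE)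
      obtain e where e: "e \<in> D0" "?\<pi> dvd b - e" using D0 by blast
      have "a - (d + ?\<pi> ^ k * e) = ?\<pi> ^ k * (b - e)" using b by (simp add: algebra_simps)
      moreover have "?\<pi> ^ k * ?\<pi> dvd ?\<pi> ^ k * (b - e)" by (rule mult_dvd_mono[OF dvd_refl e(2)])
      ultimately have "?\<pi> ^ Suc k dvd a - (d + ?\<pi> ^ k * e)" by (simp add: mult.commute)
      then show ?thesis using d(1) e(1) by (intro bexI[of _ "d + ?\<pi> ^ k * e"] image_eqI[of _ _ "(d, e)"]) simp_all
    qed
    moreover have "finite ?D" using D(1) fin0 by simp
    ultimately show ?case by blast
  qed (intro exI[of _ "{0}"], simp)
  then obtain D where D: "finite D" "\<And>a. \<exists>d\<in>D. ?\<pi> ^ r dvd a - d" by blast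
  have "?\<pi> ^ r = P (p ^ r)" by (rule P_power[OF p_ring, symmetric])
  also have "\<dots> = 0"
    using P_eq_0[OF ring_power[OF p_ring]] unif by (simp add: val_ideal_def uniformizer_def val_power)
  finally have z: "?\<pi> ^ r = 0" .
  have "a \<in> D" for a
  proof -
    obtain d where "d \<in> D" "?\<pi> ^ r dvd a - d" using D(2) by blast
    then show ?thesis by (simp add: z)
  qed
  then have "UNIV \<subseteq> D" by blast
  then show ?thesis by (rule finite_subset[OF _ D(1)])
qed

lemma chain_ring: "finite_chain_ring (P p) r (card (residue_field v))"
proof
  show "finite (UNIV :: 'o set)" by (rule finite_quotient)
  show "0 < r" by (rule exponent_pos)
  have pn: "P p ^ n = 0 \<longleftrightarrow> r \<le> n" for n
    unfolding P_power[OF p_ring, symmetric] P_eq_0[OF ring_power[OF p_ring]]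
    using unif by (auto simp: val_ideal_def uniformizer_def val_power)
  show "P p ^ r = 0" "P p ^ (r - 1) \<noteq> 0" using exponent_pos by (simp_all add: pn)
  show "P p dvd a" if "\<not> a dvd 1" for a
  proof -
    obtain x where x: "x \<in> val_ring v" "P x = a" using P_surj by blast
    then have "x \<in> val_ideal v 1" using P_unit[of x] that by blast
    then show ?thesis using P_dvd x by blast
  qed
  let ?f = "\<lambda>x. P (p ^ (r - 1) * x)"
  have "card (residue_field v) = card (?f ` val_ring v)"
  proof (rule card_residue_field)
    fix x y assume xy: "x \<in> val_ring v" "y \<in> val_ring v"
    have m: "p ^ (r - 1) * x \<in> val_ring v" "p ^ (r - 1) * y \<in> val_ring v" "p ^ (r - 1) * (x - y) \<in> val_ring v"
      using xy p_ring by (auto intro!: ring_mult ring_power ideal_diff)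
    have "?f x = ?f y \<longleftrightarrow> P (p ^ (r - 1) * (x - y)) = 0"
      using P_diff[OF m(1,2)] by (simp add: right_diff_distrib)
    also have "\<dots> \<longleftrightarrow> p ^ (r - 1) * (x - y) \<in> val_ideal v (int r)" by (rule P_eq_0[OF m(3)])
    also have "\<dots> \<longleftrightarrow> x - y \<in> val_ideal v 1"
      using unif exponent_pos
      by (cases "x = y") (auto simp: val_ideal_def uniformizer_def val_mult val_power of_nat_diff)
    finally show "?f x = ?f y \<longleftrightarrow> x - y \<in> val_ideal v 1" .
  qed
  also have "?f ` val_ring v = range ((*) (P p ^ (r - 1)))"
  proof (intro equalityI subsetI)
    fix a assume "a \<in> ?f ` val_ring v"
    then obtain x where "x \<in> val_ring v" "a = ?f x" by blast
    then show "a \<in> range ((*) (P p ^ (r - 1)))"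
      by (simp add: P_mult P_power p_ring ring_power)
  next
    fix a assume "a \<in> range ((*) (P p ^ (r - 1)))"
    then obtain b where b: "a = P p ^ (r - 1) * b" by blast
    obtain x where x: "x \<in> val_ring v" "P x = b" using P_surj by blast
    then have "a = ?f x" using b by (simp add: P_mult P_power p_ring ring_power)
    then show "a \<in> ?f ` val_ring v" using x by blast
  qed
  finally show "card (range ((*) (P p ^ (r - 1)))) = card (residue_field v)" ..
qed

end

section \<open>The unramified quadratic extension modulo the power of the prime\<close>

text \<open>If \<open>\<epsilon>\<close> were congruent to \<open>x\<^sup>2\<close>, then \<open>\<epsilon>/x\<^sup>2\<close>, being congruent to 1, would be a square, and so
  would \<open>\<epsilon>\<close>.\<close>

lemma (in finite_chain_ring) nonsquare_residue:
  assumes two: "(2::'a) dvd 1" and eps: "\<epsilon> dvd 1" "\<nexists>x. \<epsilon> = x\<^sup>2"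
  shows "\<not> \<pi> dvd x\<^sup>2 - \<epsilon>"
proof
  assume d: "\<pi> dvd x\<^sup>2 - \<epsilon>"
  from unit_add_pi[OF eps(1) d] have x2: "x\<^sup>2 dvd 1" by simp
  let ?i = "uinv (x\<^sup>2)"
  have i: "x\<^sup>2 * ?i = 1" by (rule mult_uinv[OF x2])
  have "\<epsilon> * ?i - 1 = \<epsilon> * ?i - x\<^sup>2 * ?i" by (simp only: i)
  also have "\<dots> = - ?i * (x\<^sup>2 - \<epsilon>)" by (simp add: algebra_simps)
  finally have "\<pi> dvd \<epsilon> * ?i - 1" using d by simp
  then obtain u where u: "u\<^sup>2 = \<epsilon> * ?i" using square_root_exists[OF two] by blast
  have "(u * x)\<^sup>2 = \<epsilon> * (x\<^sup>2 * ?i)" by (simp only: power_mult_distrib u ac_simps)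
  then have "\<epsilon> = (u * x)\<^sup>2" by (simp only: i mult_1_right)
  then show False using eps(2) by blast
qed

locale extension_quotient =
  unramified_quadratic_extension v w \<iota> \<sigma>
  for v :: "'f::field \<Rightarrow> int" and w :: "'e::field \<Rightarrow> int" and \<iota> \<sigma> +
  fixes \<omega> :: 'f and r :: nat
    and pF :: "'f \<Rightarrow> 'o::comm_ring_1" and pE :: "'e \<Rightarrow> 'oe::comm_ring_1"
    and j :: "'o \<Rightarrow> 'oe" and s :: "'oe \<Rightarrow> 'oe" and \<Phi> :: 'oe and \<epsilon> :: 'o
  assumes char: "residue_char v \<noteq> 2" and unif: "uniformizer v \<omega>" and r0: "0 < r"
    and qF: "ring_quotient_map (val_ring v) {\<omega> ^ r * x | x. x \<in> val_ring v} pF"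
    and qE: "ring_quotient_map (val_ring w) {\<iota> \<omega> ^ r * z | z. z \<in> val_ring w} pE"
    and j_pF: "x \<in> val_ring v \<Longrightarrow> j (pF x) = pE (\<iota> x)"
    and s_pE: "z \<in> val_ring w \<Longrightarrow> s (pE z) = pE (\<sigma> z)"
    and eps: "\<epsilon> dvd 1" "\<nexists>x. \<epsilon> = x\<^sup>2" and Phi: "\<Phi>\<^sup>2 = j \<epsilon>"
begin

lemma emb_0 [simp]: "\<iota> 0 = 0"
proof -
  have "\<iota> 0 + \<iota> 0 = \<iota> 0 + 0" using emb_add[of 0 0] by (simp only: add_0_right)
  then show ?thesis by (simp only: add_left_cancel)
qed

lemma emb_minus: "\<iota> (- x) = - \<iota> x"
  using emb_add[of x "- x"] by (simp add: eq_neg_iff_add_eq_0 add.commute)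

lemma emb_eq_0 [simp]: "\<iota> x = 0 \<longleftrightarrow> x = 0"
proof
  assume z: "\<iota> x = 0"
  show "x = 0"
  proof (rule ccontr)
    assume "x \<noteq> 0"
    then have "\<iota> x * \<iota> (inverse x) = 1" using emb_mult[of x "inverse x"] by (simp add: emb_one)
    then show False using z by simp
  qed
qed simp

lemma emb_divide: "y \<noteq> 0 \<Longrightarrow> \<iota> (x / y) = \<iota> x / \<iota> y"
  using emb_mult[of "x / y" y] by (simp add: eq_divide_eq)

lemma emb_ideal: "\<iota> x \<in> val_ideal w n \<longleftrightarrow> x \<in> val_ideal v n"
  using unramified[of x] by (cases "x = 0") (auto simp: val_ideal_def)

lemma unif_E: "uniformizer w (\<iota> \<omega>)"
  using unif unramified[of \<omega>] by (simp add: uniformizer_def)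

sublocale QF: val_ring_quotient v \<omega> r pF
  by standard (rule unif r0 qF)+

sublocale QE: val_ring_quotient w "\<iota> \<omega>" r pE
  by standard (rule unif_E r0 qE)+

sublocale RF: finite_chain_ring "pF \<omega>" r "card (residue_field v)"
  by (rule QF.chain_ring)

lemma j_omega: "j (pF \<omega>) = pE (\<iota> \<omega>)"
  by (rule j_pF[OF QF.p_ring])

sublocale RE: finite_chain_ring "j (pF \<omega>)" r "card (residue_field w)"
  unfolding j_omega by (rule QE.chain_ring)

lemma j_1: "j 1 = 1"
  using j_pF[of 1] by (simp add: emb_one)

lemma j_add: "j (a + b) = j a + j b" and j_mult: "j (a * b) = j a * j b"
proof -
  obtain x where x: "x \<in> val_ring v" "pF x = a" using QF.P_surj by blast
  obtain y where y: "y \<in> val_ring v" "pF y = b" using QF.P_surj by blast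
  have xy: "x + y \<in> val_ring v" "x * y \<in> val_ring v"
    using x y by (auto intro: F.ideal_add F.ring_mult)
  have i: "\<iota> x \<in> val_ring w" "\<iota> y \<in> val_ring w" using x y by (simp_all add: emb_ideal)
  show "j (a + b) = j a + j b"
    using j_pF[OF xy(1)] j_pF[OF x(1)] j_pF[OF y(1)] x y i by (simp add: QF.P_add QE.P_add emb_add)
  show "j (a * b) = j a * j b"
    using j_pF[OF xy(2)] j_pF[OF x(1)] j_pF[OF y(1)] x y i by (simp add: QF.P_mult QE.P_mult emb_mult)
qed

lemma two_unit: "(2::'o) dvd 1"
proof -
  have "(2::'f) \<notin> val_ideal v 1"
  proof
    assume two: "(2::'f) \<in> val_ideal v 1"
    have "residue_char v = 2"
      unfolding residue_char_def
    proof (rule Least_equality)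
      show "0 < (2::nat) \<and> (of_nat 2 :: 'f) \<in> val_ideal v 1" using two by simp
      fix n :: nat assume n: "0 < n \<and> (of_nat n :: 'f) \<in> val_ideal v 1"
      have "n \<noteq> 1"
      proof
        assume "n = 1"
        then show False using n by (simp add: val_ideal_def)
      qed
      then show "2 \<le> n" using n by simp
    qed
    then show False using char by simp
  qed
  moreover have "(2::'f) \<in> val_ring v" using F.ideal_add[of 1 0 1] by simp
  ultimately have "pF 2 dvd 1" by (intro QF.P_unit)
  moreover have "pF 2 = 2" using QF.P_add[of 1 1] by simp
  ultimately show ?thesis by simp
qed

lemma pi_dvd_of_j: "j (pF \<omega>) dvd j a \<Longrightarrow> pF \<omega> dvd a"
proof (rule RF.nonunit_dvd, rule notI)
  assume d: "j (pF \<omega>) dvd j a" and a: "a dvd 1"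
  have "j a * j (uinv a) = 1" using mult_uinv[OF a] by (simp add: j_1 flip: j_mult)
  then have "j a dvd 1" by (intro dvdI[of _ _ "j (uinv a)"]) simp
  then show False using d RE.unit_iff by blast
qed

text \<open>Multiplying by \<open>a - b \<Phi>\<close> gives \<open>\<pi> | a\<^sup>2 - \<epsilon> b\<^sup>2\<close>, and \<open>\<epsilon>\<close> stays a non-square modulo the maximal
  ideal.\<close>

lemma residue_independent:
  assumes "j (pF \<omega>) dvd j a + j b * \<Phi>"
  shows "pF \<omega> dvd a \<and> pF \<omega> dvd b"
proof -
  let ?p = "pF \<omega>"
  have Ph: "\<Phi> * \<Phi> = j \<epsilon>" using Phi by (simp add: power2_eq_square)
  have jm: "j (x - y) = j x - j y" for x y using j_add[of "x - y" y] by simp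
  have "j ?p dvd (j a + j b * \<Phi>) * (j a - j b * \<Phi>)" by (rule dvd_mult2[OF assms])
  also have "(j a + j b * \<Phi>) * (j a - j b * \<Phi>) = j a * j a - j b * j b * (\<Phi> * \<Phi>)"
    by (simp add: algebra_simps)
  also have "\<dots> = j (a * a - b * b * \<epsilon>)" by (simp add: Ph jm j_mult)
  finally have d: "?p dvd a * a - b * b * \<epsilon>" by (rule pi_dvd_of_j)
  have b: "?p dvd b"
  proof (rule RF.nonunit_dvd, rule notI)
    assume b: "b dvd 1"
    let ?i = "uinv b"
    have i: "b * ?i = 1" by (rule mult_uinv[OF b])
    have "(a * ?i)\<^sup>2 - \<epsilon> = (a * a) * (?i * ?i) - \<epsilon> * ((b * ?i) * (b * ?i))"
      unfolding i by (simp add: power2_eq_square algebra_simps)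
    also have "\<dots> = (?i * ?i) * (a * a - b * b * \<epsilon>)" by (simp add: algebra_simps)
    finally have "?p dvd (a * ?i)\<^sup>2 - \<epsilon>" using d by simp
    then show False using RF.nonsquare_residue[OF two_unit eps] by blast
  qed
  then have "?p dvd b * b * \<epsilon>" by simp
  with d have "?p dvd (a * a - b * b * \<epsilon>) + b * b * \<epsilon>" by (rule dvd_add)
  then have "\<not> a * a dvd 1" by (simp add: RF.unit_iff)
  then have "?p dvd a" using RF.nonunit_dvd[of a] by (auto simp: unit_mult_iff)
  then show ?thesis using b ..
qed

text \<open>The only use of the degree: three elements of \<open>E\<close> are linearly dependent over \<open>F\<close>.\<close>

lemma linear_relation: "\<exists>a b c. (a, b, c) \<noteq> (0, 0, 0) \<and> \<iota> a + \<iota> b * y + \<iota> c * z = 0"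
proof (cases "y = 1 \<or> z = 1 \<or> y = z")
  case True
  then consider "y = 1" | "z = 1" | "y = z" by blast
  then show ?thesis
  proof cases
    case 1 then show ?thesis by (intro exI[of _ 1] exI[of _ "- 1"] exI[of _ 0]) (simp add: emb_one emb_minus)
  next
    case 2 then show ?thesis by (intro exI[of _ 1] exI[of _ 0] exI[of _ "- 1"]) (simp add: emb_one emb_minus)
  next
    case 3 then show ?thesis by (intro exI[of _ 0] exI[of _ 1] exI[of _ "- 1"]) (simp add: emb_one emb_minus)
  qed
next
  case False
  interpret vs: vector_space "\<lambda>a z. \<iota> a * z"
    by standard (simp_all add: algebra_simps emb_add emb_mult emb_one)
  let ?S = "{1, y, z}"
  have c: "card ?S = 3" using False by auto
  obtain B where B: "vs.independent B" "UNIV \<subseteq> vs.span B" "card B = vs.dim UNIV"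
    by (rule vs.basis_exists)
  have finB: "finite B" using B(3) degree_two by (intro card_ge_0_finite) simp
  have "vs.dependent ?S"
  proof (rule ccontr)
    assume "\<not> vs.dependent ?S"
    moreover have "?S \<subseteq> vs.span B" using B(2) by blast
    ultimately have "card ?S \<le> card B" using vs.independent_span_bound[OF finB, of ?S] by blast
    then show False using B(3) degree_two c by simp
  qed
  then obtain u where u: "\<exists>x\<in>?S. u x \<noteq> 0" "(\<Sum>x\<in>?S. \<iota> (u x) * x) = 0"
    using vs.dependent_finite[of ?S] by auto
  then show ?thesis
    using False by (intro exI[of _ "u 1"] exI[of _ "u y"] exI[of _ "u z"]) (auto simp: add.assoc)
qed

lemma minimal_valuation:
  assumes "(a, b) \<noteq> (0, 0)"
  shows "\<exists>d. d \<noteq> 0 \<and> a / d \<in> val_ring v \<and> b / d \<in> val_ring v \<and> (a / d = 1 \<or> b / d = 1)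
    \<and> (a \<in> val_ring v \<and> b \<in> val_ring v \<or> v d < 0)"
proof -
  consider "a \<noteq> 0" "b = 0 \<or> v a \<le> v b" | "b \<noteq> 0" "a = 0 \<or> v b \<le> v a"
    using assms by fastforce
  then show ?thesis
  proof cases
    case 1
    then show ?thesis by (intro exI[of _ a], cases "b = 0") (auto simp: val_ideal_def F.val_divide)
  next
    case 2
    then show ?thesis by (intro exI[of _ b], cases "a = 0") (auto simp: val_ideal_def F.val_divide)
  qed
qed

text \<open>A lift \<open>y\<close> of \<open>\<Phi>\<close> generates \<open>\<O>\<^sup>E\<close> over \<open>\<O>\<close>. By \<open>linear_relation\<close> the coordinates exist in \<open>F\<close>.
  Were one of them not integral, dividing by the one of least valuation would give a relation between
  \<open>1\<close> and \<open>y\<close> modulo the maximal ideal in which one coefficient is 1, against the independence of \<open>1\<close>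
  and \<open>\<Phi>\<close> in the residue field.\<close>

lemma integral_coordinates:
  assumes y: "y \<in> val_ring w" "pE y = \<Phi>" and z: "z \<in> val_ring w"
  shows "\<exists>a\<in>val_ring v. \<exists>b\<in>val_ring v. z = \<iota> a + \<iota> b * y"
proof -
  have indep: "a \<in> val_ideal v 1 \<and> b \<in> val_ideal v 1"
    if ab: "a \<in> val_ring v" "b \<in> val_ring v" and i: "\<iota> a + \<iota> b * y \<in> val_ideal w 1" for a b
  proof -
    have m: "\<iota> a \<in> val_ring w" "\<iota> b \<in> val_ring w" "\<iota> b * y \<in> val_ring w"
      using ab y by (auto simp: emb_ideal intro: E.ring_mult)
    have "pE (\<iota> \<omega>) dvd pE (\<iota> a + \<iota> b * y)" by (rule QE.P_dvd[OF i])
    also have "pE (\<iota> a + \<iota> b * y) = j (pF a) + j (pF b) * \<Phi>"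
      using ab m y by (simp add: QE.P_add QE.P_mult j_pF)
    finally have "pF \<omega> dvd pF a \<and> pF \<omega> dvd pF b"
      unfolding j_omega[symmetric] by (rule residue_independent)
    then show ?thesis using ab by (simp add: QF.P_dvd_iff)
  qed
  have scaled: "a \<in> val_ring v \<and> b \<in> val_ring v"
    if ne: "(a, b) \<noteq> (0, 0)" and x: "\<iota> a + \<iota> b * y = x" "x \<in> val_ring w" for a b x
  proof (rule ccontr)
    assume not: "\<not> (a \<in> val_ring v \<and> b \<in> val_ring v)"
    obtain d where d: "d \<noteq> 0" "a / d \<in> val_ring v" "b / d \<in> val_ring v" "a / d = 1 \<or> b / d = 1" "v d < 0"
      using minimal_valuation[OF ne] not by blast
    have "\<iota> (a / d) + \<iota> (b / d) * y = x / \<iota> d"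
      using d(1) x(1) by (simp add: emb_divide divide_simps)
    also have "\<dots> \<in> val_ideal w 1"
      using x(2) d(1,5) by (cases "x = 0") (auto simp: val_ideal_def E.val_divide unramified)
    finally have "a / d \<in> val_ideal v 1 \<and> b / d \<in> val_ideal v 1" by (rule indep[OF d(2,3)])
    then have "1 \<in> val_ideal v 1" using d(4) by auto
    then show False by (simp add: val_ideal_def)
  qed
  obtain a b c where abc: "(a, b, c) \<noteq> (0, 0, 0)" "\<iota> a + \<iota> b * y + \<iota> c * z = 0"
    using linear_relation by blast
  have "c \<noteq> 0"
  proof
    assume c: "c = 0"
    then have ab: "(a, b) \<noteq> (0, 0)" "\<iota> a + \<iota> b * y = 0" using abc by simp_all
    obtain d where d: "d \<noteq> 0" "a / d \<in> val_ring v" "b / d \<in> val_ring v" "a / d = 1 \<or> b / d = 1"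
      using minimal_valuation[OF ab(1)] by blast
    have "\<iota> (a / d) + \<iota> (b / d) * y = (\<iota> a + \<iota> b * y) / \<iota> d"
      using d(1) by (simp add: emb_divide divide_simps)
    then have "\<iota> (a / d) + \<iota> (b / d) * y \<in> val_ideal w 1" using ab(2) by simp
    then have "a / d \<in> val_ideal v 1 \<and> b / d \<in> val_ideal v 1" by (rule indep[OF d(2,3)])
    then have "1 \<in> val_ideal v 1" using d(4) by auto
    then show False by (simp add: val_ideal_def)
  qed
  define A B where "A = - (a / c)" and "B = - (b / c)"
  have ic: "\<iota> c \<noteq> 0" using \<open>c \<noteq> 0\<close> by simp
  have "\<iota> c * z = - (\<iota> a + \<iota> b * y)" 
    using abc(2) by (simp only: eq_neg_iff_add_eq_0 add.assoc add.commute add.left_commute)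
  then have "z = - (\<iota> a + \<iota> b * y) / \<iota> c" using ic by (simp add: eq_divide_eq mult.commute)
  then have zAB: "z = \<iota> A + \<iota> B * y"
    using \<open>c \<noteq> 0\<close> ic by (simp add: A_def B_def emb_minus emb_divide field_simps)
  have "A \<in> val_ring v \<and> B \<in> val_ring v"
  proof (cases "(A, B) = (0, 0)")
    case False
    then show ?thesis using scaled[OF False zAB[symmetric] z] by blast
  qed simp
  then show ?thesis using zAB by blast
qed

text \<open>The automorphism is not assumed to preserve the valuation. But \<open>y\<close> is a root of a monic
  quadratic polynomial over \<open>\<O>\<close>, hence so is \<open>\<sigma> y\<close>, which is therefore integral.\<close>

lemma sigma_ring:
  assumes "z \<in> val_ring w" shows "\<sigma> z \<in> val_ring w"
proof -
  obtain y where y: "y \<in> val_ring w" "pE y = \<Phi>" using QE.P_surj by blast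
  obtain a b where ab: "a \<in> val_ring v" "b \<in> val_ring v" "y * y = \<iota> a + \<iota> b * y"
    using integral_coordinates[OF y E.ring_mult[OF y(1) y(1)]] by blast
  have sy: "\<sigma> y \<in> val_ring w"
  proof (rule ccontr)
    assume not: "\<sigma> y \<notin> val_ring w"
    then have ny: "\<sigma> y \<noteq> 0" "w (\<sigma> y) < 0" by (auto simp: val_ideal_def)
    have "\<sigma> y * \<sigma> y = \<iota> a + \<iota> b * \<sigma> y"
      using arg_cong[OF ab(3), of \<sigma>] by (simp add: gal_add gal_mult gal_fixes)
    then have "\<sigma> y = \<iota> a * inverse (\<sigma> y) + \<iota> b" using ny(1) by (simp add: field_simps)
    moreover have "inverse (\<sigma> y) \<in> val_ring w" using ny by (simp add: val_ideal_def E.val_inverse)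
    ultimately have "\<sigma> y \<in> val_ring w"
      using ab(1,2) by (metis E.ideal_add E.ring_mult emb_ideal)
    then show False using not by contradiction
  qed
  obtain c d where cd: "c \<in> val_ring v" "d \<in> val_ring v" "z = \<iota> c + \<iota> d * y"
    using integral_coordinates[OF y assms] by blast
  have "\<sigma> z = \<iota> c + \<iota> d * \<sigma> y" by (simp add: cd(3) gal_add gal_mult gal_fixes)
  moreover have "\<iota> c \<in> val_ring w" "\<iota> d \<in> val_ring w" using cd by (simp_all add: emb_ideal)
  ultimately show ?thesis using sy by (simp add: E.ideal_add E.ring_mult)
qed

lemma s_add: "s (x + y) = s x + s y" and s_mult: "s (x * y) = s x * s y"
proof -
  obtain a where a: "a \<in> val_ring w" "pE a = x" using QE.P_surj by blast
  obtain b where b: "b \<in> val_ring w" "pE b = y" using QE.P_surj by blast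
  note m = sigma_ring[OF a(1)] sigma_ring[OF b(1)]
  show "s (x + y) = s x + s y"
    using s_pE[OF E.ideal_add[OF a(1) b(1)]] s_pE[OF a(1)] s_pE[OF b(1)] a b m
    by (simp add: QE.P_add gal_add)
  show "s (x * y) = s x * s y"
    using s_pE[OF E.ring_mult[OF a(1) b(1)]] s_pE[OF a(1)] s_pE[OF b(1)] a b m
    by (simp add: QE.P_mult gal_mult)
qed

lemma s_j: "s (j a) = j a"
proof -
  obtain x where x: "x \<in> val_ring v" "pF x = a" using QF.P_surj by blast
  then show ?thesis using s_pE[of "\<iota> x"] j_pF[OF x(1)] by (simp add: emb_ideal gal_fixes)
qed

lemma coordinates: "\<exists>a b. z = j a + j b * \<Phi>"
proof -
  obtain y where y: "y \<in> val_ring w" "pE y = \<Phi>" using QE.P_surj by blast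
  obtain x where x: "x \<in> val_ring w" "pE x = z" using QE.P_surj by blast
  obtain a b where ab: "a \<in> val_ring v" "b \<in> val_ring v" "x = \<iota> a + \<iota> b * y"
    using integral_coordinates[OF y x(1)] by blast
  have m: "\<iota> a \<in> val_ring w" "\<iota> b \<in> val_ring w" "\<iota> b * y \<in> val_ring w"
    using ab y by (auto simp: emb_ideal intro: E.ring_mult)
  have "z = j (pF a) + j (pF b) * \<Phi>"
    using x(2) ab m y by (simp add: QE.P_add QE.P_mult j_pF)
  then show ?thesis by (intro exI)
qed

lemma E_two_unit: "(2::'oe) dvd 1"
proof -
  have "j 2 = 2" using j_add[of 1 1] by (simp add: j_1)
  moreover have "j 2 * j (uinv 2) = 1" using mult_uinv[OF two_unit] by (simp add: j_1 flip: j_mult)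
  ultimately show ?thesis by (intro dvdI[of _ _ "j (uinv 2)"]) simp
qed

text \<open>From \<open>(s \<Phi>)\<^sup>2 = \<Phi>\<^sup>2\<close>: the factors \<open>s \<Phi> + \<Phi>\<close> and \<open>s \<Phi> - \<Phi>\<close> have product 0 and differ by the
  unit \<open>2 \<Phi>\<close>, so one of them is a unit in the local ring and the other one is 0.\<close>

lemma s_Phi: "s \<Phi> = \<Phi> \<or> s \<Phi> = - \<Phi>"
proof -
  have Ph: "\<Phi> * \<Phi> = j \<epsilon>" using Phi by (simp add: power2_eq_square)
  have "j \<epsilon> * j (uinv \<epsilon>) = 1" using mult_uinv[OF eps(1)] by (simp add: j_1 flip: j_mult)
  then have "\<Phi> * \<Phi> dvd 1" unfolding Ph by (intro dvdI[of _ _ "j (uinv \<epsilon>)"]) simp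
  then have u: "2 * \<Phi> dvd 1" using E_two_unit by (simp only: unit_mult_iff)
  have "(s \<Phi> + \<Phi>) * (s \<Phi> - \<Phi>) = s (\<Phi> * \<Phi>) - \<Phi> * \<Phi>" by (simp add: s_mult algebra_simps)
  also have "\<dots> = 0" by (simp add: Ph s_j)
  finally have z: "(s \<Phi> + \<Phi>) * (s \<Phi> - \<Phi>) = 0" .
  show ?thesis
  proof (cases "s \<Phi> + \<Phi> dvd 1")
    case True
    then have "s \<Phi> - \<Phi> = 0" using z by (simp only: unit_eq_0)
    then show ?thesis by simp
  next
    case False
    have "2 * \<Phi> - (s \<Phi> + \<Phi>) dvd 1" by (rule RE.unit_diff_pi[OF u RE.nonunit_dvd[OF False]])
    then have "- (s \<Phi> - \<Phi>) dvd 1" by (simp add: algebra_simps)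
    then have u': "s \<Phi> - \<Phi> dvd 1" by (simp only: minus_dvd_iff)
    have "(s \<Phi> - \<Phi>) * (s \<Phi> + \<Phi>) = 0" using z by (simp only: mult.commute)
    then have "s \<Phi> + \<Phi> = 0" using u' by (simp only: unit_eq_0)
    then show ?thesis by (simp add: eq_neg_iff_add_eq_0)
  qed
qed

end

section \<open>The character of the cuspidal representation\<close>

theorem proposition14:
  fixes v :: "'f::field \<Rightarrow> int" and w :: "'e::field \<Rightarrow> int"
    and \<iota> :: "'f \<Rightarrow> 'e" and \<sigma> :: "'e \<Rightarrow> 'e" and \<omega> :: 'f
    and r l q i :: nat
    and pF :: "'f \<Rightarrow> 'o::comm_ring_1" and pE :: "'e \<Rightarrow> 'oe::comm_ring_1"
    and j :: "'o \<Rightarrow> 'oe" and s :: "'oe \<Rightarrow> 'oe"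
    and \<psi> :: "'f \<Rightarrow> complex" and c :: "'o \<Rightarrow> complex"
    and \<nu> \<nu>' :: "'oe \<Rightarrow> complex" and \<tau> \<Phi> :: 'oe
    and \<epsilon> \<alpha> \<beta> \<pi> :: 'o
  assumes "unramified_quadratic_extension v w \<iota> \<sigma>"
    and "residue_char v \<noteq> 2"
    and "q = card (residue_field v)"
    and "uniformizer v \<omega>"
    and "even r" and "2 \<le> r" and "l = r div 2"
    and "ring_quotient_map (val_ring v) {\<omega> ^ r * x | x. x \<in> val_ring v} pF"
    and "ring_quotient_map (val_ring w) {\<iota> \<omega> ^ r * z | z. z \<in> val_ring w} pE"
    and "\<forall>x\<in>val_ring v. j (pF x) = pE (\<iota> x)"
    and "\<forall>z\<in>val_ring w. s (pE z) = pE (\<sigma> z)"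
    and "\<pi> = pF \<omega>"
    and "additive_char_of_level v \<omega> r \<psi>"
    and "\<forall>x\<in>val_ring v. c (pF x) = \<psi> x"
    and "regular_couple j s \<pi> r \<nu> \<nu>'"
    and "tau_lift j s c \<pi> l \<nu> \<nu>' \<tau>"
    and "\<epsilon> dvd 1" and "\<nexists>x. \<epsilon> = x\<^sup>2" and "\<Phi>\<^sup>2 = j \<epsilon>"
    and "i \<le> r - 1"
    and "\<beta> dvd 1" and "(\<alpha>\<^sup>2 - \<epsilon> * \<beta>\<^sup>2 * \<pi> ^ (2 * i)) dvd 1"
  shows "subspace_trace (cuspidal_space j s c \<pi> l \<nu> \<nu>' \<tau>)
           (ind_action (mat2 \<alpha> (\<pi> ^ i * \<epsilon> * \<beta>) (\<pi> ^ i * \<beta>) \<alpha>))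
         = (- of_nat q) ^ i *
           (\<nu> (j \<alpha> + j \<pi> ^ i * \<Phi> * j \<beta>) * \<nu>' (j \<alpha> - j \<pi> ^ i * \<Phi> * j \<beta>)
            + \<nu> (j \<alpha> - j \<pi> ^ i * \<Phi> * j \<beta>) * \<nu>' (j \<alpha> + j \<pi> ^ i * \<Phi> * j \<beta>))"
proof -
  interpret X: extension_quotient v w \<iota> \<sigma> \<omega> r pF pE j s \<Phi> \<epsilon>
    using assms by (intro extension_quotient.intro extension_quotient_axioms.intro) auto
  have pi: "\<pi> = pF \<omega>" by (rule assms)
  have q: "card (residue_field v) = q" using assms by simp
  let ?qE = "card (residue_field w)"
  note assms_reg = \<open>regular_couple j s \<pi> r \<nu> \<nu>'\<close> and assms_tau = \<open>tau_lift j s c \<pi> l \<nu> \<nu>' \<tau>\<close>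
  have r2: "r = 2 * l" "1 \<le> l" using \<open>even r\<close> \<open>2 \<le> r\<close> \<open>l = r div 2\<close> by auto
  have \<nu>: "\<nu> (x * y) = \<nu> x * \<nu> y" "\<nu>' (x * y) = \<nu>' x * \<nu>' y" "\<nu> x \<noteq> 0" "\<nu>' x \<noteq> 0"
    if "x dvd 1" "y dvd 1" for x y
    using assms_reg that by (auto simp: regular_couple_def unit_character_def)
  have \<nu>1: "\<nu> 1 = 1" "\<nu>' 1 = 1" using \<nu>[of 1 1] by simp_all
  obtain z0 where z0: "s z0 = - z0" "\<nu> (1 + j \<pi> ^ (r - 1) * z0) * inverse (\<nu>' (1 + j \<pi> ^ (r - 1) * z0)) \<noteq> 1"
    using assms_reg by (auto simp: regular_couple_def)
  \<comment> \<open>Otherwise \<open>s\<close> is trivial, so \<open>s z\<^sub>0 = - z\<^sub>0\<close> gives \<open>z\<^sub>0 = 0\<close>, against regularity.\<close>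
  have sPhi: "s \<Phi> = - \<Phi>"
  proof (rule ccontr)
    assume "s \<Phi> \<noteq> - \<Phi>"
    then have sp: "s \<Phi> = \<Phi>" using X.s_Phi by blast
    obtain a b where "z0 = j a + j b * \<Phi>" using X.coordinates by blast
    then have "s z0 = z0" by (simp add: X.s_add X.s_mult X.s_j sp)
    then have "2 * z0 = z0 - (- z0)" "z0 = - z0" using z0(1) by simp_all
    then have "2 * z0 = 0" by simp
    then have "z0 = 0" using unit_eq_0[OF X.E_two_unit] by simp
    then show False using z0(2) by (simp add: \<nu>1)
  qed
  interpret U: unramified_pair \<pi> r q ?qE j s \<Phi> \<epsilon>
  proof (unfold pi q[symmetric], intro_locales, rule unramified_pair_axioms.intro)
    show "\<Phi> * \<Phi> = j \<epsilon>" using assms by (simp add: power2_eq_square)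
  qed (rule X.two_unit X.eps X.j_1 X.j_add X.j_mult X.s_add X.s_mult X.s_j sPhi X.coordinates)+
  have c_pF: "c (pF x) = \<psi> x" if "x \<in> val_ring v" for x using assms that by blast
  have psi: "additive_char_of_level v \<omega> r \<psi>" by (rule assms)
  interpret C: unramified_pair_character \<pi> r q ?qE j s \<Phi> \<epsilon> c
  proof (intro_locales, rule chain_ring_character_axioms.intro)
    fix a b
    obtain x where x: "x \<in> val_ring v" "pF x = a" using X.QF.P_surj by blast
    obtain y where y: "y \<in> val_ring v" "pF y = b" using X.QF.P_surj by blast
    have "c (pF (x + y)) = c (pF x) * c (pF y)"
      unfolding c_pF[OF X.F.ideal_add[OF x(1) y(1)]] c_pF[OF x(1)] c_pF[OF y(1)]
      using psi x(1) y(1) by (simp add: additive_char_of_level_def)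
    then show "c (a + b) = c a * c b" using x y by (simp add: X.QF.P_add)
    show "c a \<noteq> 0" using psi x c_pF[OF x(1)] by (auto simp: additive_char_of_level_def)
  next
    obtain x where x: "x \<in> val_ring v" "\<psi> (\<omega> ^ (r - 1) * x) \<noteq> 1"
      using psi by (auto simp: additive_char_of_level_def)
    have m: "\<omega> ^ (r - 1) \<in> val_ring v" by (rule X.F.ring_power[OF X.QF.p_ring])
    have "c (\<pi> ^ (r - 1) * pF x) = \<psi> (\<omega> ^ (r - 1) * x)"
      using c_pF[OF X.F.ring_mult[OF m x(1)]] x m
      by (simp add: pi X.QF.P_mult X.QF.P_power X.QF.p_ring)
    then show "\<exists>x. c (\<pi> ^ (r - 1) * x) \<noteq> 1" using x(2) by (intro exI[of _ "pF x"]) simp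
  qed
  define \<mu> where "\<mu> z = \<nu> z * \<nu>' (s z)" for z
  have mu_cong: "\<mu> (1 + x) = c (2 * U.re (\<tau> * x))" if x: "j \<pi> ^ l dvd x" for x
  proof -
    obtain z where z: "x = j \<pi> ^ l * z" using x by (elim dvdE)
    have sx: "s (1 + x) = 1 + j \<pi> ^ l * s z"
      by (simp add: z U.s_add U.s_mult flip: U.j_power)
    have "j \<pi> ^ l * (\<tau> * z + s \<tau> * s z) = \<tau> * x + s (\<tau> * x)"
      by (simp add: z U.s_mult algebra_simps flip: U.j_power)
    also have "\<dots> = j (2 * U.re (\<tau> * x))" by (simp add: U.eq_iff_coords)
    finally have e: "j \<pi> ^ l * (\<tau> * z + s \<tau> * s z) = j (2 * U.re (\<tau> * x))" .
    have "\<mu> (1 + x) = c (inv j (j \<pi> ^ l * (\<tau> * z + s \<tau> * s z)))"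
      using assms_tau unfolding \<mu>_def sx unfolding z tau_lift_def by blast
    then show ?thesis by (simp add: e)
  qed
  \<comment> \<open>If \<open>\<pi> | im \<tau>\<close>, then \<open>Tr (\<tau> x) = 0\<close> for the \<open>x = \<pi>\<^sup>r\<^sup>-\<^sup>1 z\<^sub>0\<close> that witnesses regularity.\<close>
  have im_tau: "U.im \<tau> dvd 1"
  proof (rule ccontr)
    assume "\<not> U.im \<tau> dvd 1"
    then have "\<pi> dvd U.im \<tau>" by (rule U.R.nonunit_dvd)
    then obtain y where y: "U.im \<tau> = \<pi> * y" by (elim dvdE)
    define x where "x = j \<pi> ^ (r - 1) * z0"
    have sx: "s x = - x" using z0(1) by (simp add: x_def U.s_mult flip: U.j_power)
    have "x * x = j \<pi> ^ (r - 1 + (r - 1)) * (z0 * z0)" by (simp add: x_def power_add ac_simps)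
    also have "j \<pi> ^ (r - 1 + (r - 1)) = 0" using \<open>2 \<le> r\<close> by (subst U.E.pi_pow_eq_0) simp
    finally have xx: "x * x = 0" by simp
    have "(1 + x) * (1 - x) = 1 - x * x" by (simp add: algebra_simps)
    then have inv: "(1 + x) * (1 - x) = 1" using xx by simp
    then have u: "1 + x dvd 1" "1 - x dvd 1" using unit_mult_iff[of "1 + x" "1 - x"] by simp_all
    have "\<nu>' (1 + x) * \<nu>' (1 - x) = 1" using \<nu>(2)[OF u] inv \<nu>1 by simp
    then have "inverse (\<nu>' (1 + x)) = \<nu>' (1 - x)" by (rule inverse_unique)
    moreover have "s (1 + x) = 1 - x" by (simp add: U.s_add sx)
    ultimately have "\<mu> (1 + x) \<noteq> 1" using z0(2) by (simp add: \<mu>_def x_def)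
    moreover have "\<mu> (1 + x) = 1"
    proof -
      have "l \<le> r - 1" using r2 by simp
      then have d: "j \<pi> ^ l dvd x" unfolding x_def by (intro dvd_mult2 le_imp_power_dvd)
      have "2 * U.re x = U.re x - U.re (s x)" by (simp add: sx)
      also have "\<dots> = 0" by simp
      finally have re: "U.re x = 0" by (simp only: unit_eq_0[OF X.two_unit])
      have "U.im x = \<pi> ^ (r - 1) * U.im z0"
        by (simp add: x_def U.im_mult flip: U.j_power)
      then have "U.im \<tau> * U.im x = (\<pi> * \<pi> ^ (r - 1)) * (y * U.im z0)" by (simp add: y ac_simps)
      also have "\<pi> * \<pi> ^ (r - 1) = \<pi> ^ r" using \<open>2 \<le> r\<close> by (simp flip: power_Suc)
      finally have "U.im \<tau> * U.im x = 0" by (simp add: U.R.pi_top)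
      then have "U.re (\<tau> * x) = 0" by (simp add: U.re_mult re mult.assoc)
      then show ?thesis using mu_cong[OF d] by simp
    qed
    ultimately show False by contradiction
  qed
  interpret D: cuspidal_datum \<pi> r q ?qE j s \<Phi> \<epsilon> c \<mu> l \<tau> \<nu> \<nu>'
  proof (intro_locales, rule orbit_sum_axioms.intro)
    show "r = 2 * l" by (rule r2)
    show "\<mu> (x * y) = \<mu> x * \<mu> y" if "x dvd 1" "y dvd 1" for x y
      using that \<nu>(1)[OF that] \<nu>(2)[OF U.s_unit U.s_unit, OF that] by (simp add: \<mu>_def U.s_mult)
    show "\<mu> (1 + x) = c (2 * U.re (\<tau> * x))" if "j \<pi> ^ l dvd x" for x by (rule mu_cong[OF that])
    show "U.im \<tau> dvd 1" by (rule im_tau)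
  next
    show "cuspidal_datum_axioms s \<mu> \<nu> \<nu>'" by (rule cuspidal_datum_axioms.intro) (simp add: \<mu>_def)
  qed
  have i: "i < r" using \<open>i \<le> r - 1\<close> \<open>2 \<le> r\<close> by simp
  have coords: "U.re (D.elt \<alpha> \<beta> i 1) = \<alpha>" "U.im (D.elt \<alpha> \<beta> i 1) = \<pi> ^ i * \<beta>"
    by (simp_all add: D.elt_def)
  have p2: "\<pi> ^ (2 * i) = \<pi> ^ i * \<pi> ^ i" by (simp only: mult_2 power_add)
  have "U.nrm (D.elt \<alpha> \<beta> i 1) = \<alpha>\<^sup>2 - \<epsilon> * \<beta>\<^sup>2 * \<pi> ^ (2 * i)"
    unfolding p2 U.nrm_def coords by (simp add: power2_eq_square ac_simps)
  then have g: "D.elt \<alpha> \<beta> i 1 dvd 1"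
    using \<open>(\<alpha>\<^sup>2 - \<epsilon> * \<beta>\<^sup>2 * \<pi> ^ (2 * i)) dvd 1\<close> U.nrm_unit_iff[of "D.elt \<alpha> \<beta> i 1"] by simp
  have g_cyc: "mat2 \<alpha> (\<pi> ^ i * \<epsilon> * \<beta>) (\<pi> ^ i * \<beta>) \<alpha> = D.cyc (D.elt \<alpha> \<beta> i 1) 0"
    unfolding D.cyc_def coords by (simp add: mat2_eq_iff ac_simps)
  have e: "D.elt \<alpha> \<beta> i 1 = j \<alpha> + j \<pi> ^ i * \<Phi> * j \<beta>" "D.elt \<alpha> \<beta> i (- 1) = j \<alpha> - j \<pi> ^ i * \<Phi> * j \<beta>"
    by (simp_all add: D.elt_def U.j_mult U.j_power U.j_minus ac_simps)
  have se: "s (D.elt \<alpha> \<beta> i 1) = D.elt \<alpha> \<beta> i (- 1)" "s (D.elt \<alpha> \<beta> i (- 1)) = D.elt \<alpha> \<beta> i 1"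
    by (simp_all add: D.elt_def U.s_add U.s_diff U.s_mult U.j_minus)
  show ?thesis
    unfolding cuspidal_space_def g_cyc D.cuspidal_character[OF \<open>\<beta> dvd 1\<close> i g] \<mu>_def se unfolding e ..
qed

end
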